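(* Let $k\ge 5$ and let $\phi\in C^k(\mathbb{R})$ satisfy $\phi(0)=0$, $\phi(-r)=\phi(r)$ for all $r\in\mathbb{R}$, and $\phi''(0)=1$. For $\epsilon\ge 0$ let $\mathcal{E}=\mathcal{E}_\epsilon$ be the energy difference functional on $\dot{\mathcal{H}}^1$ defined in the context. Then $\mathcal{E}$ is well-defined on $\dot{\mathcal{H}}^1$ and $k$-times continuously differentiable. Furthermore, for $\epsilon$ sufficiently small, the minimisation problem $$\text{find } \bar u\in\arg\min_{\dot{\mathcal{H}}^1}\mathcal{E}$$ has a locally unique solution $\bar u\in\dot{\mathcal{H}}^1$ that depends continuously on $\epsilon$ and satisfies strong stability, that is, there exists $\lambda>0$ such that for all $v\in\dot{\mathcal{H}}^1$ $$\delta^2\mathcal{E}(\bar u)[v,v]\ \ge\ \lambda\,\|v\|_{\dot{\mathcal{H}}^1}^2 .$$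
   Context: Lattice: $\Lambda=\{l-(\tfrac12,\tfrac12): l\in\mathbb{Z}^2\}$, $\Gamma_0=\{(x_1,0): x_1\le 0\}$, $\Gamma_\pm=\{m\in\Lambda: m_1<0,\ m_2=\pm\tfrac12\}$. $\mathcal{R}=\{e_1,e_2,-e_1,-e_2\}$ is the set of nearest-neighbour directions; $\mathcal{R}(m)=\mathcal{R}$ if $m\notin\Gamma_+\cup\Gamma_-$, $\mathcal{R}(m)=\mathcal{R}\setminus\{-e_2\}$ if $m\in\Gamma_+$, and $\mathcal{R}(m)=\mathcal{R}\setminus\{e_2\}$ if $m\in\Gamma_-$. For $u:\Lambda\to\mathbb{R}$, $D_\rho u(m)=u(m+\rho)-u(m)$, and the discrete gradient $Du(m)\in\mathbb{R}^{\mathcal{R}}$ has components $(Du(m))_\rho=D_\rho u(m)$ if $\rho\in\mathcal{R}(m)$ and $(Du(m))_\rho=0$ if $\rho\notin\mathcal{R}(m)$. Function space: with $\hat x=(\tfrac12,\tfrac12)$, $\dot{\mathcal{H}}^1=\{u:\Lambda\to\mathbb{R}: Du\in\ell^2,\ u(\hat x)=0\}$, with norm $\|u\|_{\dot{\mathcal{H}}^1}=\|Du\|_{\ell^2}=(\sum_{m\in\Lambda}|Du(m)|^2)^{1/2}$. Predictor: for $x=(r_x\cos\theta_x,r_x\sin\theta_x)\in\mathbb{R}^2\setminus\Gamma_0$ with $\theta_x\in(-\pi,\pi)$, $\omega(x)=(\omega_1(x),\omega_2(x))=(\sqrt{r_x}\cos(\theta_x/2),\sqrt{r_x}\sin(\theta_x/2))$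 (complex square root), and $\hat u(x)=\epsilon\,\omega_2(x)$, where $\epsilon\ge0$ is the loading parameter. Energy: $V(Du(m))=\sum_{\rho\in\mathcal{R}}\phi((Du(m))_\rho)$ and $$\mathcal{E}(u)=\sum_{m\in\Lambda}\big(V(D\hat u(m)+Du(m))-V(D\hat u(m))\big).$$ For finitely supported $u$ this is a finite sum; "well-defined on $\dot{\mathcal{H}}^1$" means that the functional so defined on finitely supported $u\in\dot{\mathcal{H}}^1$ has a (unique) continuous extension to $\dot{\mathcal{H}}^1$, again denoted $\mathcal{E}$. $\delta^2\mathcal{E}$ denotes the second variation (Fréchet derivative). $\arg\min$ is understood in the sense of local minimisers with respect to $\|\cdot\|_{\dot{\mathcal{H}}^1}$; "locally unique" means unique in some neighbourhood. *)

theory Defs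
  imports "HOL-Analysis.Analysis"
begin

section \<open>Lattice and discrete gradient\<close>

text \<open>A lattice point is represented by its integer index; its position is given by
  \<open>site\<close>. No lattice point lies on the crack.\<close>

type_synonym index = "int \<times> int"

definition site :: "index \<Rightarrow> real \<times> real" where
  "site l = (real_of_int (fst l), real_of_int (snd l)) - (1/2, 1/2)"

definition Gamma_plus :: "index set" where
  "Gamma_plus = {l. fst (site l) < 0 \<and> snd (site l) = 1/2}"

definition Gamma_minus :: "index set" where
  "Gamma_minus = {l. fst (site l) < 0 \<and> snd (site l) = - (1/2)}"

definition e1 :: index where "e1 = (1, 0)"
definition e2 :: index where "e2 = (0, 1)"

definition nn :: "index set" where
  "nn = {e1, e2, - e1, - e2}"

definition nn_at :: "index \<Rightarrow> index set" where
  "nn_at m = (if m \<in> Gamma_plus then nn - {- e2}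
              else if m \<in> Gamma_minus then nn - {e2} else nn)"

definition Dgrad :: "(index \<Rightarrow> real) \<Rightarrow> index \<Rightarrow> index \<Rightarrow> real" where
  "Dgrad u m \<rho> = (if \<rho> \<in> nn_at m then u (m + \<rho>) - u m else 0)"

definition xhat :: index where
  "xhat = (THE l. site l = (1/2, 1/2))"

lemma site_xhat: "site xhat = (1/2, 1/2)" and xhat_eq: "xhat = (1, 1)"
proof -
  have *: "site l = (1/2, 1/2) \<longleftrightarrow> l = (1, 1)" for l
    by (cases l) (auto simp: site_def)
  show "xhat = (1, 1)"
    unfolding xhat_def * by simp
  then show "site xhat = (1/2, 1/2)"
    by (simp add: *)
qed

section \<open>The discrete homogeneous Sobolev space\<close>

definition Dnorm_sq :: "(index \<Rightarrow> real) \<Rightarrow> index \<Rightarrow> real" where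
  "Dnorm_sq u m = (L2_set (Dgrad u m) nn)\<^sup>2"

lemma Dnorm_sq_nonneg [simp]: "0 \<le> Dnorm_sq u m"
  by (simp add: Dnorm_sq_def)

lemma Dgrad_zero [simp]: "Dgrad (\<lambda>_. 0) m = (\<lambda>_. 0)"
  by (auto simp: Dgrad_def)

lemma Dgrad_add: "Dgrad (\<lambda>x. u x + v x) m = (\<lambda>\<rho>. Dgrad u m \<rho> + Dgrad v m \<rho>)"
  by (auto simp: Dgrad_def)

lemma Dgrad_scale: "Dgrad (\<lambda>x. c * u x) m = (\<lambda>\<rho>. c * Dgrad u m \<rho>)"
  by (auto simp: Dgrad_def algebra_simps)

lemma Dnorm_sq_zero [simp]: "Dnorm_sq (\<lambda>_. 0) = (\<lambda>_. 0)"
  by (simp add: Dnorm_sq_def[abs_def] L2_set_def)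

lemma Dnorm_sq_scale: "Dnorm_sq (\<lambda>x. c * u x) m = c\<^sup>2 * Dnorm_sq u m"
  by (simp add: Dnorm_sq_def Dgrad_scale L2_set_def sum_nonneg power_mult_distrib
      flip: sum_distrib_left)

lemma Dnorm_partial_triangle:
  "sqrt (sum (Dnorm_sq (\<lambda>x. u x + v x)) F) \<le> sqrt (sum (Dnorm_sq u) F) + sqrt (sum (Dnorm_sq v) F)"
proof -
  have "L2_set (\<lambda>m. L2_set (Dgrad (\<lambda>x. u x + v x) m) nn) F
      \<le> L2_set (\<lambda>m. L2_set (Dgrad u m) nn + L2_set (Dgrad v m) nn) F"
    by (intro L2_set_mono) (auto simp: Dgrad_add L2_set_triangle_ineq)
  also have "\<dots> \<le> L2_set (\<lambda>m. L2_set (Dgrad u m) nn) F + L2_set (\<lambda>m. L2_set (Dgrad v m) nn) F"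
    by (rule L2_set_triangle_ineq)
  finally show ?thesis
    by (simp add: Dnorm_sq_def[abs_def] L2_set_def)
qed

lemma Dnorm_partial_bound:
  assumes "Dnorm_sq u summable_on UNIV" "Dnorm_sq v summable_on UNIV" "finite F"
  shows "sum (Dnorm_sq (\<lambda>x. u x + v x)) F
    \<le> (sqrt (infsum (Dnorm_sq u) UNIV) + sqrt (infsum (Dnorm_sq v) UNIV))\<^sup>2"
proof -
  have "sqrt (sum (Dnorm_sq (\<lambda>x. u x + v x)) F)
      \<le> sqrt (infsum (Dnorm_sq u) UNIV) + sqrt (infsum (Dnorm_sq v) UNIV)"
    by (rule order_trans[OF Dnorm_partial_triangle add_mono])
       (use assms in \<open>auto intro!: finite_sum_le_infsum\<close>)
  then show ?thesis
    using real_sqrt_le_iff sqrt_le_D by blast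
qed

lemma Dnorm_summable_add:
  assumes "Dnorm_sq u summable_on UNIV" "Dnorm_sq v summable_on UNIV"
  shows "Dnorm_sq (\<lambda>x. u x + v x) summable_on UNIV"
  by (rule nonneg_bdd_above_summable_on)
     (use Dnorm_partial_bound[OF assms] in \<open>auto intro!: bdd_aboveI2\<close>)

lemma Dnorm_triangle:
  assumes "Dnorm_sq u summable_on UNIV" "Dnorm_sq v summable_on UNIV"
  shows "sqrt (infsum (Dnorm_sq (\<lambda>x. u x + v x)) UNIV)
    \<le> sqrt (infsum (Dnorm_sq u) UNIV) + sqrt (infsum (Dnorm_sq v) UNIV)"
proof -
  have "infsum (Dnorm_sq (\<lambda>x. u x + v x)) UNIV
    \<le> (sqrt (infsum (Dnorm_sq u) UNIV) + sqrt (infsum (Dnorm_sq v) UNIV))\<^sup>2"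
    by (rule infsum_le_finite_sums[OF Dnorm_summable_add])
       (use Dnorm_partial_bound[OF assms] assms in auto)
  then show ?thesis
    by (simp add: infsum_nonneg real_le_lsqrt)
qed

lemma Dnorm_summable_scale:
  assumes "Dnorm_sq u summable_on UNIV"
  shows "Dnorm_sq (\<lambda>x. c * u x) summable_on UNIV"
  unfolding Dnorm_sq_scale[abs_def] using assms by (rule summable_on_cmult_right)

lemma Dnorm_zero_imp_const:
  assumes "\<And>m. Dnorm_sq u m = 0"
  shows "u l = u xhat"
proof -
  have D: "Dgrad u m \<rho> = 0" if "\<rho> \<in> nn" for m \<rho>
    using assms[of m] that by (auto simp: Dnorm_sq_def L2_set_eq_0_iff nn_def)
  have "e1 \<in> nn_at m" "e1 \<in> nn" for m
    by (simp_all add: nn_at_def nn_def e1_def e2_def)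
  then have h: "u (i + 1, j) = u (i, j)" for i j
    using D[of e1 "(i, j)"] by (simp add: Dgrad_def) (simp add: e1_def)
  have "e2 \<in> nn_at (1, j)" "e2 \<in> nn" for j
    by (simp_all add: nn_at_def nn_def e1_def e2_def Gamma_plus_def Gamma_minus_def site_def)
  then have v: "u (1, j + 1) = u (1, j)" for j
    using D[of e2 "(1, j)"] by (simp add: Dgrad_def) (simp add: e2_def)
  have H: "u (i, j) = u (1, j)" for i j
  proof (induction i rule: int_induct[where k = 1])
    case (step2 i) then show ?case using h[of "i - 1" j] by simp
  qed (auto simp: h)
  have V: "u (1, j) = u (1, 1)" for j
  proof (induction j rule: int_induct[where k = 1])
    case (step2 j) then show ?case using v[of "j - 1"] by simp
  qed (auto simp: v)
  show ?thesis
    by (cases l) (metis H V xhat_eq)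
qed

typedef hdot1 = "{u :: index \<Rightarrow> real. Dnorm_sq u summable_on UNIV \<and> u xhat = 0}"
  morphisms lattice_fun Abs_hdot1
  by (rule exI[of _ "\<lambda>_. 0"]) simp

setup_lifting type_definition_hdot1

instantiation hdot1 :: real_normed_vector
begin

lift_definition zero_hdot1 :: hdot1 is "\<lambda>_. 0"
  by simp

lift_definition plus_hdot1 :: "hdot1 \<Rightarrow> hdot1 \<Rightarrow> hdot1" is "\<lambda>u v x. u x + v x"
  by (simp add: Dnorm_summable_add)

lift_definition scaleR_hdot1 :: "real \<Rightarrow> hdot1 \<Rightarrow> hdot1" is "\<lambda>c u x. c * u x"
  by (simp add: Dnorm_summable_scale)

lift_definition uminus_hdot1 :: "hdot1 \<Rightarrow> hdot1" is "\<lambda>u x. - u x"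
  using Dnorm_summable_scale[where c = "-1"] by simp

lift_definition minus_hdot1 :: "hdot1 \<Rightarrow> hdot1 \<Rightarrow> hdot1" is "\<lambda>u v x. u x - v x"
proof -
  fix u v :: "index \<Rightarrow> real"
  assume u: "Dnorm_sq u summable_on UNIV \<and> u xhat = 0"
    and v: "Dnorm_sq v summable_on UNIV \<and> v xhat = 0"
  show "Dnorm_sq (\<lambda>x. u x - v x) summable_on UNIV \<and> u xhat - v xhat = 0"
    using Dnorm_summable_add[of u "\<lambda>x. -1 * v x"] Dnorm_summable_scale[of v "-1"] u v by simp
qed

lift_definition norm_hdot1 :: "hdot1 \<Rightarrow> real" is "\<lambda>u. sqrt (\<Sum>\<^sub>\<infinity>m. Dnorm_sq u m)" .

definition dist_hdot1 :: "hdot1 \<Rightarrow> hdot1 \<Rightarrow> real" where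
  "dist_hdot1 u v = norm (u - v)"

definition sgn_hdot1 :: "hdot1 \<Rightarrow> hdot1" where
  "sgn_hdot1 u = scaleR (inverse (norm u)) u"

definition uniformity_hdot1 :: "(hdot1 \<times> hdot1) filter" where
  "uniformity_hdot1 = (INF e\<in>{0 <..}. principal {(x, y). dist x y < e})"

definition open_hdot1 :: "hdot1 set \<Rightarrow> bool" where
  "open_hdot1 S = (\<forall>x\<in>S. \<forall>\<^sub>F (x', y) in uniformity. x' = x \<longrightarrow> y \<in> S)"

instance
proof
  fix a b c :: hdot1 and r s :: real
  show "a + b + c = a + (b + c)" by transfer (simp add: add.assoc)
  show "a + b = b + a" by transfer (simp add: add.commute)
  show "0 + a = a" by transfer simp
  show "- a + a = 0" by transfer simp
  show "a - b = a + - b" by transfer simp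
  show "r *\<^sub>R (a + b) = r *\<^sub>R a + r *\<^sub>R b" by transfer (simp add: algebra_simps)
  show "(r + s) *\<^sub>R a = r *\<^sub>R a + s *\<^sub>R a" by transfer (simp add: algebra_simps)
  show "r *\<^sub>R s *\<^sub>R a = (r * s) *\<^sub>R a" by transfer (simp add: algebra_simps)
  show "1 *\<^sub>R a = a" by transfer simp
  show "dist a b = norm (a - b)" by (simp add: dist_hdot1_def)
  show "sgn a = scaleR (inverse (norm a)) a" by (simp add: sgn_hdot1_def)
  show "uniformity = (INF e\<in>{0 <..}. principal {(x, y :: hdot1). dist x y < e})"
    by (simp add: uniformity_hdot1_def)
  show "open U = (\<forall>x\<in>U. \<forall>\<^sub>F (x', y) in uniformity. x' = x \<longrightarrow> y \<in> U)" for U :: "hdot1 set"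
    by (simp add: open_hdot1_def)
  show "norm (a + b) \<le> norm a + norm b"
    by transfer (simp add: Dnorm_triangle)
  show "norm (r *\<^sub>R a) = \<bar>r\<bar> * norm a"
    by transfer (simp add: Dnorm_sq_scale[abs_def] infsum_cmult_right real_sqrt_mult)
  show "norm a = 0 \<longleftrightarrow> a = 0"
  proof
    show "norm a = 0 \<Longrightarrow> a = 0"
    proof transfer
      fix u :: "index \<Rightarrow> real"
      assume u: "Dnorm_sq u summable_on UNIV \<and> u xhat = 0"
        and z: "sqrt (infsum (Dnorm_sq u) UNIV) = 0"
      then have "Dnorm_sq u m = 0" for m
        by (intro nonneg_infsum_le_0D[where A = UNIV]) auto
      then show "u = (\<lambda>_. 0)"
        using Dnorm_zero_imp_const u by metis
    qed
    show "a = 0 \<Longrightarrow> norm a = 0"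
      by simp (transfer, simp)
  qed
qed

end

section \<open>Predictor and energy difference\<close>

definition polar_r :: "real \<times> real \<Rightarrow> real" where
  "polar_r x = sqrt ((fst x)\<^sup>2 + (snd x)\<^sup>2)"

text \<open>\<^const>\<open>Arg\<close> takes values in \<open>]-pi, pi]\<close>, and the value \<open>pi\<close> is taken only on the crack.\<close>

definition polar_theta :: "real \<times> real \<Rightarrow> real" where
  "polar_theta x = Arg (Complex (fst x) (snd x))"

definition omega :: "real \<times> real \<Rightarrow> real \<times> real" where
  "omega x = (sqrt (polar_r x) * cos (polar_theta x / 2), sqrt (polar_r x) * sin (polar_theta x / 2))"

definition u_hat :: "real \<Rightarrow> index \<Rightarrow> real" where
  "u_hat \<epsilon> m = \<epsilon> * snd (omega (site m))"

definition site_potential :: "(real \<Rightarrow> real) \<Rightarrow> (index \<Rightarrow> real) \<Rightarrow> real" where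
  "site_potential \<phi> g = (\<Sum>\<rho>\<in>nn. \<phi> (g \<rho>))"

definition finite_support :: "hdot1 \<Rightarrow> bool" where
  "finite_support u \<longleftrightarrow> finite {m. lattice_fun u m \<noteq> 0}"

text \<open>Only meaningful for finitely supported u, where all but finitely many terms vanish.\<close>

definition energy_fin :: "(real \<Rightarrow> real) \<Rightarrow> real \<Rightarrow> hdot1 \<Rightarrow> real" where
  "energy_fin \<phi> \<epsilon> u =
    (\<Sum>\<^sub>\<infinity>m. site_potential \<phi> (\<lambda>\<rho>. Dgrad (u_hat \<epsilon>) m \<rho> + Dgrad (lattice_fun u) m \<rho>)
         - site_potential \<phi> (Dgrad (u_hat \<epsilon>) m))"

definition is_energy_extension :: "(real \<Rightarrow> real) \<Rightarrow> real \<Rightarrow> (hdot1 \<Rightarrow> real) \<Rightarrow> bool" where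
  "is_energy_extension \<phi> \<epsilon> E \<longleftrightarrow>
    continuous_on UNIV E \<and> (\<forall>u. finite_support u \<longrightarrow> E u = energy_fin \<phi> \<epsilon> u)"

definition energy :: "(real \<Rightarrow> real) \<Rightarrow> real \<Rightarrow> hdot1 \<Rightarrow> real" where
  "energy \<phi> \<epsilon> = (THE E. is_energy_extension \<phi> \<epsilon> E)"

section \<open>Differentiability\<close>

definition C_k_real :: "nat \<Rightarrow> (real \<Rightarrow> real) \<Rightarrow> bool" where
  "C_k_real k f \<longleftrightarrow>
    (\<forall>j<k. (deriv ^^ j) f differentiable_on UNIV) \<and> continuous_on UNIV ((deriv ^^ k) f)"

text \<open>An n-linear map is represented as a function on argument lists of length n;
  its values on other lists are irrelevant.\<close>

definition bounded_multilinear ::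
    "nat \<Rightarrow> ('a::real_normed_vector list \<Rightarrow> 'b::real_normed_vector) \<Rightarrow> bool" where
  "bounded_multilinear n T \<longleftrightarrow>
    (\<forall>v i. length v = n \<longrightarrow> i < n \<longrightarrow> linear (\<lambda>w. T (v[i := w]))) \<and>
    (\<exists>C. \<forall>v. length v = n \<longrightarrow> norm (T v) \<le> C * prod_list (map norm v))"

text \<open>The operator norm of an n-linear map is at most c (for nonnegative c).\<close>

definition multilinear_norm_le ::
    "nat \<Rightarrow> ('a::real_normed_vector list \<Rightarrow> 'b::real_normed_vector) \<Rightarrow> real \<Rightarrow> bool" where
  "multilinear_norm_le n T c \<longleftrightarrow> (\<forall>v. length v = n \<longrightarrow> norm (T v) \<le> c * prod_list (map norm v))"

text \<open>k-fold continuous Frechet differentiability: F j x is the j-th derivative at x,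
  under the usual identification of linear maps into j-linear maps with (j+1)-linear maps;
  the derivative of F j and the continuity are with respect to the operator norm. The order k
  is a variable here, so the iterated derivatives cannot be given nested bounded-linear types.\<close>

definition C_k_frechet :: "nat \<Rightarrow> ('a::real_normed_vector \<Rightarrow> 'b::real_normed_vector) \<Rightarrow> bool" where
  "C_k_frechet k f \<longleftrightarrow>
    (\<exists>F :: nat \<Rightarrow> 'a \<Rightarrow> 'a list \<Rightarrow> 'b.
      (\<forall>x. F 0 x [] = f x) \<and>
      (\<forall>j\<le>k. \<forall>x. bounded_multilinear j (F j x)) \<and>
      (\<forall>j<k. \<forall>x. \<forall>e>0. \<forall>\<^sub>F h in nhds 0.
         multilinear_norm_le j (\<lambda>v. F j (x + h) v - F j x v - F (Suc j) x (h # v)) (e * norm h)) \<and>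
      (\<forall>j\<le>k. \<forall>x. \<forall>e>0. \<forall>\<^sub>F y in nhds x.
         multilinear_norm_le j (\<lambda>v. F j y v - F j x v) e))"

text \<open>Frechet derivative of the map taking x to the Frechet derivative of f at x,
  the latter regarded as an element of the normed dual.\<close>

definition second_variation ::
    "('a::real_normed_vector \<Rightarrow> real) \<Rightarrow> 'a \<Rightarrow> 'a \<Rightarrow> 'a \<Rightarrow> real" where
  "second_variation f u v w =
    blinfun_apply (frechet_derivative (\<lambda>x. Blinfun (frechet_derivative f (at x))) (at u) v) w"

definition local_minimiser :: "('a::metric_space \<Rightarrow> real) \<Rightarrow> 'a \<Rightarrow> bool" where
  "local_minimiser f u \<longleftrightarrow> (\<exists>r>0. \<forall>w\<in>ball u r. f u \<le> f w)"

definition locally_unique_minimiser :: "('a::metric_space \<Rightarrow> real) \<Rightarrow> 'a \<Rightarrow> bool" where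
  "locally_unique_minimiser f u \<longleftrightarrow>
    local_minimiser f u \<and> (\<exists>r>0. \<forall>w\<in>ball u r. local_minimiser f w \<longrightarrow> w = u)"

end

theory Submission
  imports Defs "HOL-Real_Asymp.Real_Asymp"
begin

text \<open>The squared norm of the space is the sum of the squares of all bond differences, so the
  differences are square-summable coordinates. With \<open>b\<close> the difference of \<open>u\<close> along a bond and
  \<open>\<epsilon> \<alpha>\<close> that of the predictor, the energy is rewritten as
  \<open>E\<^sub>\<epsilon> u = (\<Sum> \<phi> (\<epsilon> \<alpha> + b) - \<phi> (\<epsilon> \<alpha>) - \<epsilon> \<alpha> b) + \<epsilon> L u\<close>, where \<open>L u\<close> stands for the
  conditionally meaningful sum of \<open>\<alpha> b\<close>.

  The first part is a superposition functional on square-summable sequences. A product of two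
  coordinates is already summable, so from the second derivative on, local bounds on the
  derivatives of \<open>\<phi>\<close> suffice for \<open>k\<close>-fold differentiability (locale \<open>superposition\<close>,
  lemma \<open>frechet_jet\<close>). The first derivative needs the coefficients \<open>\<phi>' (\<epsilon> \<alpha>) - \<epsilon> \<alpha>\<close> to be
  square summable: \<open>\<phi>\<close> is even, so they are of order \<open>\<alpha>\<^sup>3\<close>, and \<open>\<alpha>\<close> decays like \<open>r\<close> to the
  power \<open>-1/2\<close>, which gives a summable square in the plane.

  For \<open>L\<close>, summation by parts moves the differences onto the predictor. Since the predictor is
  the imaginary part of \<open>sqrt z\<close>, which is harmonic and continues evenly across the crack, its
  discrete Laplacian decays like \<open>r\<close> to the power \<open>-7/2\<close>, while functions of the space grow at
  most like the square root of \<open>r\<close> (lemma \<open>pointwise_bound\<close>). Hence \<open>L\<close> is a bounded linear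
  functional (lemmas \<open>bounded_linear_predictor_load\<close>, \<open>predictor_load_finite_support\<close>).

  Uniqueness of the extension is the density of finitely supported functions, which holds
  although constants are not controlled at infinity: truncation makes a function bounded, and
  logarithmic cutoffs have arbitrarily small energy (lemma \<open>finite_support_dense\<close>).

  For small \<open>\<epsilon>\<close> and small displacements all bond arguments stay where \<open>\<phi>'' \<ge> 1/2\<close>, so the
  energies are uniformly strongly convex on a fixed ball; they differ there by a functional
  whose Lipschitz constant is proportional to the difference of the loads. Since zero minimises
  the unloaded energy, completeness yields minimisers near zero, Lipschitz in \<open>\<epsilon>\<close> and unique
  (lemma \<open>strongly_convex_family_minimisers\<close>). The bound \<open>\<phi>'' \<ge> 1/2\<close> is also strong stability.\<close>

section \<open>Jets of Frechet derivatives\<close>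

text \<open>Differentiability of order \<open>k\<close> with the family of derivatives named, so that a particular
  derivative can be identified later.\<close>

definition frechet_jet ::
    "nat \<Rightarrow> (nat \<Rightarrow> 'a::real_normed_vector \<Rightarrow> 'a list \<Rightarrow> 'b::real_normed_vector) \<Rightarrow> bool" where
  "frechet_jet k F \<longleftrightarrow>
      (\<forall>j\<le>k. \<forall>x. bounded_multilinear j (F j x)) \<and>
      (\<forall>j<k. \<forall>x. \<forall>e>0. \<forall>\<^sub>F h in nhds 0.
         multilinear_norm_le j (\<lambda>v. F j (x + h) v - F j x v - F (Suc j) x (h # v)) (e * norm h)) \<and>
      (\<forall>j\<le>k. \<forall>x. \<forall>e>0. \<forall>\<^sub>F y in nhds x.
         multilinear_norm_le j (\<lambda>v. F j y v - F j x v) e)"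

lemma frechet_jet_imp_C_k:
  "frechet_jet k F \<Longrightarrow> (\<And>x. F 0 x [] = f x) \<Longrightarrow> C_k_frechet k f"
  unfolding frechet_jet_def C_k_frechet_def by (intro exI[of _ F]) auto

lemma prod_list_norm_nonneg: "0 \<le> prod_list (map norm v)"
  by (induction v) auto

lemma multilinear_norm_leD:
  "multilinear_norm_le n T c \<Longrightarrow> length v = n \<Longrightarrow> norm (T v) \<le> c * prod_list (map norm v)"
  by (simp add: multilinear_norm_le_def)

text \<open>Below the top order continuity is automatic, since a differentiable map is
  continuous; so only the top derivative has to be checked.\<close>

lemma frechet_jetI:
  fixes F :: "nat \<Rightarrow> 'a::real_normed_vector \<Rightarrow> 'a list \<Rightarrow> 'b::real_normed_vector"
  assumes mult: "\<And>j x. j \<le> k \<Longrightarrow> bounded_multilinear j (F j x)"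
    and diff: "\<And>j x e. j < k \<Longrightarrow> e > 0 \<Longrightarrow> \<exists>d>0. \<forall>h v. norm h < d \<longrightarrow> length v = j \<longrightarrow>
      norm (F j (x + h) v - F j x v - F (Suc j) x (h # v)) \<le> e * norm h * prod_list (map norm v)"
    and top: "\<And>x e. e > 0 \<Longrightarrow> \<exists>d>0. \<forall>h v. norm h < d \<longrightarrow> length v = k \<longrightarrow>
      norm (F k (x + h) v - F k x v) \<le> e * prod_list (map norm v)"
  shows "frechet_jet k F"
  unfolding frechet_jet_def
proof (intro conjI allI impI)
  fix j x assume "j \<le> k" then show "bounded_multilinear j (F j x)" by (rule mult)
next
  fix j x and e :: real assume "j < k" "e > 0"
  from diff[OF this, of x] show "\<forall>\<^sub>F h in nhds 0.
         multilinear_norm_le j (\<lambda>v. F j (x + h) v - F j x v - F (Suc j) x (h # v)) (e * norm h)"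
    by (auto simp: eventually_nhds_metric multilinear_norm_le_def)
next
  fix j x and e :: real assume jk: "j \<le> k" and e: "e > 0"
  have "\<exists>d>0. \<forall>h v. norm h < d \<longrightarrow> length v = j \<longrightarrow>
      norm (F j (x + h) v - F j x v) \<le> e * prod_list (map norm v)"
  proof (cases "j = k")
    case True then show ?thesis using top[OF e, of x] by blast
  next
    case False
    then have lt: "j < k" using jk by simp
    obtain d where d: "d > 0" and D: "\<And>h v. norm h < d \<Longrightarrow> length v = j \<Longrightarrow>
      norm (F j (x + h) v - F j x v - F (Suc j) x (h # v)) \<le> 1 * norm h * prod_list (map norm v)"
      using diff[OF lt zero_less_one, of x] by blast
    obtain C where C: "\<And>v. length v = Suc j \<Longrightarrow> norm (F (Suc j) x v) \<le> C * prod_list (map norm v)"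
      using mult[of "Suc j" x] lt unfolding bounded_multilinear_def by auto
    have "norm (F j (x + h) v - F j x v) \<le> e * prod_list (map norm v)"
      if h: "norm h < min d (e / (1 + \<bar>C\<bar>))" and v: "length v = j" for h v
    proof -
      let ?P = "prod_list (map norm v)"
      have P: "0 \<le> ?P" by (rule prod_list_norm_nonneg)
      have "norm (F j (x + h) v - F j x v)
          \<le> norm (F j (x + h) v - F j x v - F (Suc j) x (h # v)) + norm (F (Suc j) x (h # v))"
        by (metis diff_add_cancel norm_triangle_ineq)
      also have "\<dots> \<le> 1 * norm h * ?P + C * (norm h * ?P)"
        using D[of h v] C[of "h # v"] h v by (intro add_mono) auto
      also have "\<dots> \<le> norm h * ?P + \<bar>C\<bar> * (norm h * ?P)"
        using P by (simp add: mult_right_mono)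
      also have "\<dots> = ((1 + \<bar>C\<bar>) * norm h) * ?P" by (simp add: algebra_simps)
      also have "\<dots> \<le> e * ?P"
        using h P by (intro mult_right_mono) (auto simp: field_simps add_pos_nonneg)
      finally show ?thesis .
    qed
    moreover have "min d (e / (1 + \<bar>C\<bar>)) > 0" using d e by (simp add: add_pos_nonneg)
    ultimately show ?thesis by blast
  qed
  then obtain d where d: "d > 0" and D: "\<And>h v. norm h < d \<Longrightarrow> length v = j \<Longrightarrow>
      norm (F j (x + h) v - F j x v) \<le> e * prod_list (map norm v)" by blast
  have "norm (F j y v - F j x v) \<le> e * prod_list (map norm v)"
    if "dist y x < d" "length v = j" for y v
    using D[of "y - x" v] that by (simp add: dist_norm)
  then show "\<forall>\<^sub>F y in nhds x. multilinear_norm_le j (\<lambda>v. F j y v - F j x v) e"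
    using d by (auto simp: eventually_nhds_metric multilinear_norm_le_def)
qed

lemma frechet_jet_bounded_linear_1:
  assumes "frechet_jet k F" "1 \<le> k"
  shows "bounded_linear (\<lambda>v. F 1 x [v])"
proof -
  have b: "bounded_multilinear 1 (F 1 x)" using assms by (simp add: frechet_jet_def)
  then have lin: "linear (\<lambda>w. F 1 x ([undefined][0 := w]))"
    unfolding bounded_multilinear_def by (metis length_Cons list.size(3) One_nat_def less_one)
  from b obtain C where "\<And>v. length v = 1 \<Longrightarrow> norm (F 1 x v) \<le> C * prod_list (map norm v)"
    unfolding bounded_multilinear_def by blast
  then have "norm (F 1 x [v]) \<le> norm v * C" for v by (metis (no_types, lifting) One_nat_def
    length_Cons list.simps(8,9) list.size(3) mult.commute mult.right_neutral prod_list.Cons prod_list.Nil)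
  with lin show ?thesis by (intro bounded_linear_intro[where K = C]) (auto simp: linear_iff)
qed

lemma frechet_jet_has_derivative:
  assumes F: "frechet_jet k F" and k: "1 \<le> k"
  shows "((\<lambda>x. F 0 x []) has_derivative (\<lambda>v. F 1 x [v])) (at x)"
  unfolding has_derivative_at_alt
proof (intro conjI allI impI)
  show "bounded_linear (\<lambda>v. F 1 x [v])" by (rule frechet_jet_bounded_linear_1[OF F k])
  fix e :: real assume "e > 0"
  with F k have "\<forall>\<^sub>F h in nhds 0.
      multilinear_norm_le 0 (\<lambda>v. F 0 (x + h) v - F 0 x v - F (Suc 0) x (h # v)) (e * norm h)"
    by (auto simp: frechet_jet_def)
  then obtain d where "d > 0" and D: "\<And>h. norm h < d \<Longrightarrow>
      multilinear_norm_le 0 (\<lambda>v. F 0 (x + h) v - F 0 x v - F (Suc 0) x (h # v)) (e * norm h)"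
    by (auto simp: eventually_nhds_metric)
  moreover have "norm (F 0 y [] - F 0 x [] - F 1 x [y - x]) \<le> e * norm (y - x)"
    if "norm (y - x) < d" for y
    using multilinear_norm_leD[OF D[OF that], of "[]"] by simp
  ultimately show "\<exists>d>0. \<forall>y. norm (y - x) < d \<longrightarrow>
      norm (F 0 y [] - F 0 x [] - F 1 x [y - x]) \<le> e * norm (y - x)" by blast
qed

text \<open>Regarding the first derivatives as elements of the dual space, the estimate on the first-order
  remainder in the operator norm is exactly differentiability of the gradient map.\<close>

lemma frechet_jet_second_variation:
  fixes F :: "nat \<Rightarrow> 'a::real_normed_vector \<Rightarrow> 'a list \<Rightarrow> real"
  assumes F: "frechet_jet k F" and k: "2 \<le> k" and f: "\<And>x. f x = F 0 x []"
  shows "second_variation f x v w = F 2 x [v, w]"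
proof -
  let ?D = "\<lambda>x. Blinfun (\<lambda>v. F 1 x [v])"
  let ?H = "\<lambda>x v. Blinfun (\<lambda>w. F 2 x [v, w])"
  have f': "f = (\<lambda>x. F 0 x [])" using f by blast
  have "frechet_derivative f (at x) = (\<lambda>v. F 1 x [v])" for x
    using frechet_derivative_at[OF frechet_jet_has_derivative[OF F, of x]] k by (simp add: f')
  then have fd: "(\<lambda>x. Blinfun (frechet_derivative f (at x))) = ?D" by simp
  have bl1: "bounded_linear (\<lambda>v. F 1 x [v])" for x
    using frechet_jet_bounded_linear_1[OF F] k by simp
  have D_app: "blinfun_apply (?D x) v = F 1 x [v]" for x v
    by (rule bounded_linear_Blinfun_apply[OF bl1, THEN fun_cong])
  have m2: "bounded_multilinear 2 (F 2 x)" for x using F k by (simp add: frechet_jet_def)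
  have lin1: "linear (\<lambda>v. F 2 x [v, w])" for x w
    using m2[of x, unfolded bounded_multilinear_def, THEN conjunct1, rule_format, of "[0, w]" 0] by simp
  have lin2: "linear (\<lambda>w. F 2 x [v, w])" for x v
    using m2[of x, unfolded bounded_multilinear_def, THEN conjunct1, rule_format, of "[v, 0]" 1] by simp
  obtain C where C0: "\<And>v. length v = 2 \<Longrightarrow> norm (F 2 x v) \<le> C * prod_list (map norm v)"
    using m2[of x] unfolding bounded_multilinear_def by blast
  have C: "norm (F 2 x [v, w]) \<le> \<bar>C\<bar> * norm v * norm w" for v w
    using C0[of "[v, w]"] mult_right_mono[OF abs_ge_self[of C], of "norm v * norm w"]
    by (simp add: mult.assoc)
  have bl2: "bounded_linear (\<lambda>w. F 2 x [v, w])" for v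
    using lin2[of x v] C[of v]
    by (intro bounded_linear_intro[where K = "\<bar>C\<bar> * norm v"]) (auto simp: linear_iff mult.commute)
  have H_app: "blinfun_apply (?H x v) w = F 2 x [v, w]" for v w
    by (simp add: bounded_linear_Blinfun_apply[OF bl2])
  have "(?D has_derivative ?H x) (at x)"
    unfolding has_derivative_at_alt
  proof (intro conjI allI impI)
    show "bounded_linear (?H x)"
    proof (rule bounded_linear_intro[where K = "\<bar>C\<bar>"])
      show "?H x (a + b) = ?H x a + ?H x b" for a b
        by (rule blinfun_eqI) (unfold plus_blinfun.rep_eq H_app, rule linear_add[OF lin1])
      show "?H x (r *\<^sub>R a) = r *\<^sub>R ?H x a" for r a
        by (rule blinfun_eqI) (unfold scaleR_blinfun.rep_eq H_app, rule linear_scale[OF lin1])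
      show "norm (?H x a) \<le> norm a * \<bar>C\<bar>" for a
        using C[of a] by (intro norm_blinfun_bound) (auto simp: H_app mult.commute)
    qed
    fix e :: real assume "e > 0"
    have "1 < k" using k by simp
    have "\<forall>\<^sub>F h in nhds 0.
        multilinear_norm_le 1 (\<lambda>v. F 1 (x + h) v - F 1 x v - F (Suc 1) x (h # v)) (e * norm h)"
      using F[unfolded frechet_jet_def] \<open>1 < k\<close> \<open>e > 0\<close> by blast
    then obtain d where "d > 0" and R: "\<And>h. norm h < d \<Longrightarrow>
        multilinear_norm_le 1 (\<lambda>v. F 1 (x + h) v - F 1 x v - F (Suc 1) x (h # v)) (e * norm h)"
      by (auto simp: eventually_nhds_metric)
    moreover have "norm (?D y - ?D x - ?H x (y - x)) \<le> e * norm (y - x)" if "norm (y - x) < d" for y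
    proof (rule norm_blinfun_bound)
      show "0 \<le> e * norm (y - x)" using \<open>e > 0\<close> by simp
      show "norm (blinfun_apply (?D y - ?D x - ?H x (y - x)) w) \<le> e * norm (y - x) * norm w" for w
        using multilinear_norm_leD[OF R[OF that], of "[w]"]
        unfolding minus_blinfun.rep_eq D_app H_app by (simp add: numeral_2_eq_2)
    qed
    ultimately show "\<exists>d>0. \<forall>y. norm (y - x) < d \<longrightarrow>
        norm (?D y - ?D x - ?H x (y - x)) \<le> e * norm (y - x)" by blast
  qed
  then have "frechet_derivative ?D (at x) = ?H x"
    by (metis frechet_derivative_at)
  then show ?thesis
    unfolding second_variation_def fd by (simp add: H_app)
qed

text \<open>A bounded linear functional contributes its value at order zero and itself at order one; in
  every remainder its contributions cancel.\<close>

lemma frechet_jet_add_linear: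
  fixes F :: "nat \<Rightarrow> 'a::real_normed_vector \<Rightarrow> 'a list \<Rightarrow> real"
  assumes F: "frechet_jet k F" and l: "bounded_linear l"
  shows "frechet_jet k
    (\<lambda>j x v. F j x v + (if j = 0 then l x else if j = 1 then l (hd v) else 0))"
    (is "frechet_jet k ?G")
  unfolding frechet_jet_def
proof (intro conjI allI impI)
  interpret l: bounded_linear l by (rule l)
  obtain K where K: "K > 0" "\<And>x. norm (l x) \<le> K * norm x"
    using l.pos_bounded by (metis mult.commute)
  fix j x assume j: "j \<le> k"
  then have FB: "bounded_multilinear j (F j x)" using F by (simp add: frechet_jet_def)
  obtain C where C: "\<And>v. length v = j \<Longrightarrow> norm (F j x v) \<le> C * prod_list (map norm v)"
    using FB unfolding bounded_multilinear_def by blast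
  show "bounded_multilinear j (?G j x)"
    unfolding bounded_multilinear_def
  proof (intro conjI allI impI)
    fix v :: "'a list" and i assume v: "length v = j" and i: "i < j"
    then have "linear (\<lambda>w. F j x (v[i := w]))" using FB by (simp add: bounded_multilinear_def)
    moreover have "j = 1 \<Longrightarrow> hd (v[i := w]) = w" for w
      using v i by (cases v) auto
    ultimately show "linear (\<lambda>w. ?G j x (v[i := w]))"
      using i by (auto simp: linear_iff l.add l.scaleR algebra_simps)
  next
    have "norm (?G j x v) \<le> (C + (if j = 0 then \<bar>l x\<bar> else K)) * prod_list (map norm v)"
      if v: "length v = j" for v
    proof -
      have "j = 1 \<Longrightarrow> \<exists>a. v = [a]" using v by (cases v) auto
      then have "\<bar>if j = 0 then l x else if j = 1 then l (hd v) else 0\<bar>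
          \<le> (if j = 0 then \<bar>l x\<bar> else K) * prod_list (map norm v)"
        using v K prod_list_norm_nonneg[of v] by auto
      then show ?thesis using C[OF v] by (simp add: distrib_right)
    qed
    then show "\<exists>C. \<forall>v. length v = j \<longrightarrow> norm (?G j x v) \<le> C * prod_list (map norm v)"
      by blast
  qed
next
  interpret l: bounded_linear l by (rule l)
  fix j x and e :: real assume "j < k" "e > 0"
  have "?G j (x + h) v - ?G j x v - ?G (Suc j) x (h # v)
      = F j (x + h) v - F j x v - F (Suc j) x (h # v)" for h v
    by (simp add: l.add)
  then show "\<forall>\<^sub>F h in nhds 0. multilinear_norm_le j
      (\<lambda>v. ?G j (x + h) v - ?G j x v - ?G (Suc j) x (h # v)) (e * norm h)"
    using F \<open>j < k\<close> \<open>e > 0\<close> by (simp only: frechet_jet_def)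
next
  interpret l: bounded_linear l by (rule l)
  obtain K where K: "K > 0" "\<And>x. norm (l x) \<le> K * norm x"
    using l.pos_bounded by (metis mult.commute)
  fix j x and e :: real assume jk: "j \<le> k" and e: "e > 0"
  have "\<forall>\<^sub>F y in nhds x. multilinear_norm_le j (\<lambda>v. F j y v - F j x v) (e / 2)"
    using F jk e by (simp add: frechet_jet_def)
  moreover have "\<forall>\<^sub>F y in nhds x. norm (y - x) < e / (2 * K)"
    using e K by (auto simp: eventually_nhds_metric dist_norm intro!: exI[of _ "e / (2 * K)"])
  ultimately show "\<forall>\<^sub>F y in nhds x. multilinear_norm_le j (\<lambda>v. ?G j y v - ?G j x v) e"
  proof eventually_elim
    case (elim y)
    have "\<bar>l y - l x\<bar> \<le> e / 2"
      using K(2)[of "y - x"] elim(2) K(1) by (simp add: l.diff field_simps)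
    moreover have "norm (?G j y v - ?G j x v) \<le> e / 2 * prod_list (map norm v) + e / 2 * prod_list (map norm v)"
      if v: "length v = j" for v
    proof -
      have "norm (?G j y v - ?G j x v) \<le> norm (F j y v - F j x v) + (if j = 0 then \<bar>l y - l x\<bar> else 0)"
        by auto
      also have "\<dots> \<le> e / 2 * prod_list (map norm v) + e / 2 * prod_list (map norm v)"
        using multilinear_norm_leD[OF elim(1) v] \<open>\<bar>l y - l x\<bar> \<le> e / 2\<close> v e prod_list_norm_nonneg[of v]
        by (intro add_mono) auto
      finally show ?thesis .
    qed
    ultimately show ?case by (simp add: multilinear_norm_le_def)
  qed
qed


section \<open>Square-summable coordinates\<close>

text \<open>The mean value theorem without a sign condition on the increment; both the distance bound and
  the enclosing interval are useful in what follows.\<close>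

lemma mvt_increment:
  fixes f f' :: "real \<Rightarrow> real"
  assumes "\<And>t. (f has_real_derivative f' t) (at t)"
  obtains \<xi> where "f (b + h) - f b = h * f' \<xi>" "\<bar>\<xi> - b\<bar> \<le> \<bar>h\<bar>"
    "min b (b + h) \<le> \<xi>" "\<xi> \<le> max b (b + h)"
proof (cases h "0::real" rule: linorder_cases)
  case equal
  then show ?thesis by (intro that[of b]) auto
next
  case less
  then obtain z where "b + h < z" "z < b" "f b - f (b + h) = (b - (b + h)) * f' z"
    using MVT2[of "b + h" b f f'] assms by auto
  then show ?thesis using less by (intro that[of z]) (auto simp: algebra_simps)
next
  case greater
  then obtain z where "b < z" "z < b + h" "f (b + h) - f b = (b + h - b) * f' z"
    using MVT2[of b "b + h" f f'] assms by auto
  then show ?thesis using greater by (intro that[of z]) (auto simp: algebra_simps)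
qed

lemma summable_on_real_bound:
  fixes f g :: "'p \<Rightarrow> real"
  assumes "g summable_on A" "\<And>p. p \<in> A \<Longrightarrow> \<bar>f p\<bar> \<le> g p"
  shows "f summable_on A"
proof -
  have "(\<lambda>p. norm (f p)) summable_on A"
    by (rule Infinite_Sum.abs_summable_on_comparison_test'[OF assms(1)]) (use assms(2) in auto)
  then show ?thesis by (rule abs_summable_summable)
qed

lemma has_sum_diff_real:
  fixes f g :: "'p \<Rightarrow> real"
  assumes "(f has_sum a) A" "(g has_sum b) A"
  shows "((\<lambda>p. f p - g p) has_sum (a - b)) A"
  using has_sum_add[OF assms(1) has_sum_uminus[THEN iffD2], of g "-b"] assms(2) by simp

lemma summable_on_diff_real:
  fixes f g :: "'p \<Rightarrow> real"
  assumes "f summable_on A" "g summable_on A"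
  shows "(\<lambda>p. f p - g p) summable_on A"
  using has_sum_diff_real[OF has_sum_infsum has_sum_infsum, OF assms] by (rule has_sum_imp_summable)

lemma infsum_diff_real:
  fixes f g :: "'p \<Rightarrow> real"
  assumes "f summable_on A" "g summable_on A"
  shows "(\<Sum>\<^sub>\<infinity>p\<in>A. f p - g p) = infsum f A - infsum g A"
  using has_sum_diff_real[OF has_sum_infsum has_sum_infsum, OF assms] by (rule infsumI)

lemma summable_on_squares_add:
  fixes f g :: "'p \<Rightarrow> real"
  assumes "(\<lambda>p. (f p)\<^sup>2) summable_on A" "(\<lambda>p. (g p)\<^sup>2) summable_on A"
  shows "(\<lambda>p. (f p + g p)\<^sup>2) summable_on A"
proof (rule summable_on_real_bound)
  show "(\<lambda>p. 2 * (f p)\<^sup>2 + 2 * (g p)\<^sup>2) summable_on A"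
    by (intro summable_on_add summable_on_cmult_right assms)
  show "\<bar>(f p + g p)\<^sup>2\<bar> \<le> 2 * (f p)\<^sup>2 + 2 * (g p)\<^sup>2" for p
    using sum_squares_bound[of "f p" "g p"] by (simp only: abs_power2) (simp add: power2_sum)
qed

lemma infsum_Cauchy_Schwarz:
  fixes f g :: "'p \<Rightarrow> real"
  assumes f: "(\<lambda>p. (f p)\<^sup>2) summable_on A" and g: "(\<lambda>p. (g p)\<^sup>2) summable_on A"
  shows "(\<lambda>p. \<bar>f p\<bar> * \<bar>g p\<bar>) summable_on A"
    and "(\<Sum>\<^sub>\<infinity>p\<in>A. \<bar>f p\<bar> * \<bar>g p\<bar>) \<le> sqrt (\<Sum>\<^sub>\<infinity>p\<in>A. (f p)\<^sup>2) * sqrt (\<Sum>\<^sub>\<infinity>p\<in>A. (g p)\<^sup>2)"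
proof -
  have "(\<lambda>p. norm (f p * g p)) summable_on A"
    by (rule abs_summable_product) (use f g in \<open>simp_all add: power2_eq_square\<close>)
  then show s: "(\<lambda>p. \<bar>f p\<bar> * \<bar>g p\<bar>) summable_on A" by (simp add: abs_mult)
  show "(\<Sum>\<^sub>\<infinity>p\<in>A. \<bar>f p\<bar> * \<bar>g p\<bar>) \<le> sqrt (\<Sum>\<^sub>\<infinity>p\<in>A. (f p)\<^sup>2) * sqrt (\<Sum>\<^sub>\<infinity>p\<in>A. (g p)\<^sup>2)"
  proof (rule infsum_le_finite_sums[OF s])
    fix F assume F: "finite F" "F \<subseteq> A"
    have "(\<Sum>p\<in>F. \<bar>f p\<bar> * \<bar>g p\<bar>) \<le> L2_set f F * L2_set g F"
      by (rule L2_set_mult_ineq)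
    also have "\<dots> \<le> sqrt (\<Sum>\<^sub>\<infinity>p\<in>A. (f p)\<^sup>2) * sqrt (\<Sum>\<^sub>\<infinity>p\<in>A. (g p)\<^sup>2)"
      unfolding L2_set_def using F f g
      by (intro mult_mono real_sqrt_le_mono finite_sum_le_infsum) (auto intro!: infsum_nonneg sum_nonneg)
    finally show "(\<Sum>p\<in>F. \<bar>f p\<bar> * \<bar>g p\<bar>)
        \<le> sqrt (\<Sum>\<^sub>\<infinity>p\<in>A. (f p)\<^sup>2) * sqrt (\<Sum>\<^sub>\<infinity>p\<in>A. (g p)\<^sup>2)" .
  qed
qed

text \<open>A normed space embedded isometrically into the square-summable families. Differentiability
  and convexity of the energy are matters of these coordinates alone.\<close>

locale ell2_coordinates =
  fixes B :: "'a::real_normed_vector \<Rightarrow> 'p \<Rightarrow> real"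
  assumes linear_B: "linear (\<lambda>x. B x p)"
    and has_sum_B: "((\<lambda>p. (B x p)\<^sup>2) has_sum (norm x)\<^sup>2) UNIV"
begin

lemma B_add: "B (x + y) p = B x p + B y p"
  using linear_add[OF linear_B] .

lemma B_diff: "B (x - y) p = B x p - B y p"
  using linear_diff[OF linear_B] .

lemma B_scale: "B (c *\<^sub>R x) p = c * B x p"
  using linear_scale[OF linear_B] by simp

lemma B_zero [simp]: "B 0 p = 0"
  using linear_0[OF linear_B] .

lemma summable_B: "(\<lambda>p. (B x p)\<^sup>2) summable_on UNIV"
  using has_sum_B by (rule has_sum_imp_summable)

lemma infsum_B: "(\<Sum>\<^sub>\<infinity>p. (B x p)\<^sup>2) = (norm x)\<^sup>2"
  using has_sum_B by (rule infsumI)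

lemma abs_B_le: "\<bar>B x p\<bar> \<le> norm x"
proof -
  have "(\<Sum>p\<in>{p}. (B x p)\<^sup>2) \<le> (norm x)\<^sup>2"
    by (rule finite_sum_le_has_sum[OF has_sum_B]) auto
  then show ?thesis by (simp add: abs_le_square_iff[symmetric])
qed

lemma pairing:
  assumes c: "(\<lambda>p. (c p)\<^sup>2) summable_on UNIV" and M: "0 \<le> M"
    and f: "\<And>p. \<bar>f p\<bar> \<le> M * (\<bar>c p\<bar> * \<bar>B a p\<bar>)"
  shows "f summable_on UNIV"
    and "\<bar>infsum f UNIV\<bar> \<le> M * (sqrt (\<Sum>\<^sub>\<infinity>p. (c p)\<^sup>2) * norm a)"
proof -
  note CS = infsum_Cauchy_Schwarz[OF c summable_B[of a]]
  have s: "(\<lambda>p. M * (\<bar>c p\<bar> * \<bar>B a p\<bar>)) summable_on UNIV"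
    by (intro summable_on_cmult_right CS)
  show "f summable_on UNIV" by (rule summable_on_real_bound[OF s]) (rule f)
  have "norm (infsum f UNIV) \<le> (\<Sum>\<^sub>\<infinity>p. M * (\<bar>c p\<bar> * \<bar>B a p\<bar>))"
    by (rule norm_infsum_le[OF _ has_sum_infsum[OF s]])
       (use f \<open>f summable_on UNIV\<close> in auto)
  also have "\<dots> = M * (\<Sum>\<^sub>\<infinity>p. \<bar>c p\<bar> * \<bar>B a p\<bar>)"
    by (rule infsum_cmult_right) (rule CS)
  also have "\<dots> \<le> M * (sqrt (\<Sum>\<^sub>\<infinity>p. (c p)\<^sup>2) * norm a)"
    using CS(2) M by (intro mult_left_mono) (simp_all add: infsum_B)
  finally show "\<bar>infsum f UNIV\<bar> \<le> M * (sqrt (\<Sum>\<^sub>\<infinity>p. (c p)\<^sup>2) * norm a)" by simp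
qed

abbreviation Bprod :: "'a list \<Rightarrow> 'p \<Rightarrow> real" where
  "Bprod v p \<equiv> prod_list (map (\<lambda>w. B w p) v)"

lemma abs_Bprod_le: "\<bar>Bprod v p\<bar> \<le> prod_list (map norm v)"
  by (induction v) (auto simp: abs_mult intro!: mult_mono abs_B_le prod_list_norm_nonneg)

text \<open>One linear factor is paired with the square-summable coefficient by Cauchy--Schwarz; the
  others are bounded by norms.\<close>

lemma weighted_product_1:
  assumes c: "(\<lambda>p. (c p)\<^sup>2) summable_on UNIV" and v: "1 \<le> length v"
    and f: "\<And>p. \<bar>f p\<bar> \<le> c p * \<bar>Bprod v p\<bar>" and c0: "\<And>p. 0 \<le> c p"
  shows "f summable_on UNIV"
    and "\<bar>infsum f UNIV\<bar> \<le> sqrt (\<Sum>\<^sub>\<infinity>p. (c p)\<^sup>2) * prod_list (map norm v)"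
proof -
  obtain a w where v: "v = a # w" using v by (cases v) auto
  let ?M = "prod_list (map norm w)"
  have b: "\<bar>f p\<bar> \<le> ?M * (\<bar>c p\<bar> * \<bar>B a p\<bar>)" for p
  proof -
    have "\<bar>f p\<bar> \<le> c p * (\<bar>B a p\<bar> * \<bar>Bprod w p\<bar>)" using f[of p] by (simp add: v abs_mult)
    also have "\<dots> \<le> c p * (\<bar>B a p\<bar> * ?M)"
      by (intro mult_left_mono abs_Bprod_le) (auto simp: c0)
    finally show ?thesis using c0[of p] by (simp add: mult_ac)
  qed
  note P = pairing[OF c prod_list_norm_nonneg b]
  show "f summable_on UNIV" by (rule P)
  show "\<bar>infsum f UNIV\<bar> \<le> sqrt (\<Sum>\<^sub>\<infinity>p. (c p)\<^sup>2) * prod_list (map norm v)"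
    using P(2) by (simp add: v mult_ac)
qed

text \<open>With two linear factors a bounded coefficient is enough, because one of the factors serves as
  the square-summable coefficient for the other.\<close>

lemma weighted_product_2:
  assumes v: "2 \<le> length v" and M: "0 \<le> M" and f: "\<And>p. \<bar>f p\<bar> \<le> M * \<bar>Bprod v p\<bar>"
  shows "f summable_on UNIV" and "\<bar>infsum f UNIV\<bar> \<le> M * prod_list (map norm v)"
proof -
  obtain a w where v: "v = a # w" "1 \<le> length w" using v by (cases v) auto
  let ?c = "\<lambda>p. M * \<bar>B a p\<bar>"
  have c: "(\<lambda>p. (?c p)\<^sup>2) summable_on UNIV"
    using summable_on_cmult_right[OF summable_B, of "M\<^sup>2" a] by (simp add: power_mult_distrib)
  have "(\<Sum>\<^sub>\<infinity>p. (?c p)\<^sup>2) = M\<^sup>2 * (norm a)\<^sup>2"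
    using infsum_cmult_right[OF summable_B, of "M\<^sup>2" a] by (simp add: power_mult_distrib infsum_B)
  then have s: "sqrt (\<Sum>\<^sub>\<infinity>p. (?c p)\<^sup>2) = M * norm a"
    using M by (simp add: real_sqrt_mult)
  have b: "\<bar>f p\<bar> \<le> ?c p * \<bar>Bprod w p\<bar>" for p
    using f[of p] by (simp add: v abs_mult mult_ac)
  note P = weighted_product_1[OF c v(2) b]
  show "f summable_on UNIV" by (rule P) (use M in auto)
  show "\<bar>infsum f UNIV\<bar> \<le> M * prod_list (map norm v)"
    using P(2) M unfolding s by (simp add: v mult_ac)
qed

text \<open>The isometric coordinates make the norm Hilbertian; this identity is all that is needed of the
  inner product.\<close>

lemma norm_convex_combination:
  fixes x y :: 'a
  shows "(norm ((1 - t) *\<^sub>R x + t *\<^sub>R y))\<^sup>2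
     = (1 - t) * (norm x)\<^sup>2 + t * (norm y)\<^sup>2 - t * (1 - t) * (norm (x - y))\<^sup>2"
proof -
  have "((\<lambda>p. (1 - t) * (B x p)\<^sup>2 + t * (B y p)\<^sup>2 + (- (t * (1 - t))) * (B (x - y) p)\<^sup>2)
      has_sum ((1 - t) * (norm x)\<^sup>2 + t * (norm y)\<^sup>2 + (- (t * (1 - t))) * (norm (x - y))\<^sup>2)) UNIV"
    by (intro has_sum_add has_sum_cmult_right has_sum_B)
  moreover have "(1 - t) * (B x p)\<^sup>2 + t * (B y p)\<^sup>2 + (- (t * (1 - t))) * (B (x - y) p)\<^sup>2
      = (B ((1 - t) *\<^sub>R x + t *\<^sub>R y) p)\<^sup>2" for p
    by (simp add: B_add B_scale B_diff power2_eq_square algebra_simps)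
  ultimately show ?thesis
    using has_sum_unique[OF has_sum_B] by fastforce
qed

end

section \<open>Superposition functionals\<close>

text \<open>Functionals \<open>\<Sum> g\<^sub>p (B x p)\<close> whose integrand depends on the coordinate. Uniform control is asked
  of the derivatives of order at least two only: at order one the derivative at zero must be
  merely square summable, and the rest follows by integration from \<open>g 0 p 0 = 0\<close>.\<close>

locale superposition = ell2_coordinates B for B :: "'a::real_normed_vector \<Rightarrow> 'p \<Rightarrow> real" +
  fixes g :: "nat \<Rightarrow> 'p \<Rightarrow> real \<Rightarrow> real" and k :: nat
  assumes k2: "2 \<le> k"
    and g_deriv: "\<And>j p t. j < k \<Longrightarrow> (g j p has_real_derivative g (Suc j) p t) (at t)"
    and g_bound: "\<And>j R. 2 \<le> j \<Longrightarrow> j \<le> k \<Longrightarrow> \<exists>C. \<forall>p t. \<bar>t\<bar> \<le> R \<longrightarrow> \<bar>g j p t\<bar> \<le> C"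
    and g_equicont: "\<And>j R e. 2 \<le> j \<Longrightarrow> j \<le> k \<Longrightarrow> 0 < e \<Longrightarrow>
      \<exists>d>0. \<forall>p s t. \<bar>s\<bar> \<le> R \<longrightarrow> \<bar>t\<bar> \<le> R \<longrightarrow> \<bar>s - t\<bar> < d \<longrightarrow> \<bar>g j p s - g j p t\<bar> \<le> e"
    and g0_zero: "\<And>p. g 0 p 0 = 0"
    and g1_zero: "(\<lambda>p. (g 1 p 0)\<^sup>2) summable_on UNIV"
begin

definition jet :: "nat \<Rightarrow> 'a \<Rightarrow> 'a list \<Rightarrow> real" where
  "jet j x v = (\<Sum>\<^sub>\<infinity>p. g j p (B x p) * Bprod v p)"

lemma g_bound':
  assumes "2 \<le> j" "j \<le> k"
  obtains C where "0 \<le> C" "\<And>p t. \<bar>t\<bar> \<le> R \<Longrightarrow> \<bar>g j p t\<bar> \<le> C"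
  using g_bound[OF assms, of R] by (metis abs_ge_self abs_ge_zero order_trans)

lemma g1_lipschitz:
  obtains C where "0 \<le> C"
    "\<And>p s h. \<bar>s\<bar> \<le> R \<Longrightarrow> \<bar>s + h\<bar> \<le> R \<Longrightarrow> \<bar>g 1 p (s + h) - g 1 p s\<bar> \<le> C * \<bar>h\<bar>"
proof -
  obtain C where C: "0 \<le> C" "\<And>p t. \<bar>t\<bar> \<le> R \<Longrightarrow> \<bar>g 2 p t\<bar> \<le> C"
    using g_bound'[of 2 R] k2 by auto
  have "\<bar>g 1 p (s + h) - g 1 p s\<bar> \<le> C * \<bar>h\<bar>" if "\<bar>s\<bar> \<le> R" "\<bar>s + h\<bar> \<le> R" for p s h
  proof -
    have "(g 1 p has_real_derivative g 2 p t) (at t)" for t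
      using g_deriv[of 1 p t] k2 by (simp add: numeral_2_eq_2)
    then obtain z where z: "g 1 p (s + h) - g 1 p s = h * g 2 p z"
      "min s (s + h) \<le> z" "z \<le> max s (s + h)"
      using mvt_increment[of "g 1 p" "g 2 p" s h] by blast
    then have "\<bar>z\<bar> \<le> R" using that by (auto simp: min_def max_def split: if_splits)
    then show ?thesis
      using C(2)[of z p] unfolding z(1) by (simp add: abs_mult mult_left_mono mult.commute[of C])
  qed
  with C(1) show ?thesis by (rule that)
qed

text \<open>Bounding the first derivative on the whole segment from zero by one square-summable family
  makes both the value, by the mean value theorem, and the first derivative summable.\<close>

lemma g1_envelope:
  obtains c where "(\<lambda>p. (c p)\<^sup>2) summable_on UNIV" "\<And>p. 0 \<le> c p"
    "\<And>p s. \<bar>s\<bar> \<le> \<bar>B x p\<bar> \<Longrightarrow> \<bar>g 1 p s\<bar> \<le> c p"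
proof -
  obtain C where C: "0 \<le> C" "\<And>p s h. \<bar>s\<bar> \<le> norm x \<Longrightarrow> \<bar>s + h\<bar> \<le> norm x \<Longrightarrow>
      \<bar>g 1 p (s + h) - g 1 p s\<bar> \<le> C * \<bar>h\<bar>"
    using g1_lipschitz by blast
  let ?c = "\<lambda>p. \<bar>g 1 p 0\<bar> + C * \<bar>B x p\<bar>"
  have "(\<lambda>p. (C * \<bar>B x p\<bar>)\<^sup>2) summable_on UNIV"
    using summable_on_cmult_right[OF summable_B, of "C\<^sup>2" x] by (simp add: power_mult_distrib)
  then have "(\<lambda>p. (?c p)\<^sup>2) summable_on UNIV"
    using g1_zero by (intro summable_on_squares_add) auto
  moreover have "\<bar>g 1 p s\<bar> \<le> ?c p" if s: "\<bar>s\<bar> \<le> \<bar>B x p\<bar>" for p s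
  proof -
    have "\<bar>g 1 p (0 + s) - g 1 p 0\<bar> \<le> C * \<bar>s\<bar>"
      using abs_B_le[of x p] s by (intro C(2)) auto
    also have "\<dots> \<le> C * \<bar>B x p\<bar>" using s C(1) by (intro mult_left_mono) auto
    finally show ?thesis by simp
  qed
  ultimately show ?thesis using C(1) by (intro that[of ?c]) auto
qed

lemma summable_value: "(\<lambda>p. g 0 p (B x p)) summable_on UNIV"
proof -
  obtain c where c: "(\<lambda>p. (c p)\<^sup>2) summable_on UNIV" "\<And>p. 0 \<le> c p"
    "\<And>p s. \<bar>s\<bar> \<le> \<bar>B x p\<bar> \<Longrightarrow> \<bar>g 1 p s\<bar> \<le> c p" using g1_envelope by blast
  have "\<bar>g 0 p (B x p)\<bar> \<le> 1 * (\<bar>c p\<bar> * \<bar>B x p\<bar>)" for p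
  proof -
    have "(g 0 p has_real_derivative g 1 p t) (at t)" for t
      using g_deriv[of 0 p t] k2 by simp
    then obtain z where z: "g 0 p (0 + B x p) - g 0 p 0 = B x p * g 1 p z" "\<bar>z - 0\<bar> \<le> \<bar>B x p\<bar>"
      using mvt_increment[of "g 0 p" "g 1 p" 0 "B x p"] by blast
    then have "\<bar>g 0 p (B x p)\<bar> = \<bar>B x p\<bar> * \<bar>g 1 p z\<bar>" by (simp add: g0_zero abs_mult)
    then show ?thesis
      using c(3)[of z p] z(2) c(2)[of p] by (simp add: mult_left_mono mult.commute[of "c p"])
  qed
  then show ?thesis by (rule pairing(1)[OF c(1), rotated]) auto
qed

lemma summable_jet:
  assumes j: "j \<le> k" and v: "length v = j"
  shows "(\<lambda>p. g j p (B x p) * Bprod v p) summable_on UNIV"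
    and "\<exists>C. \<forall>v. length v = j \<longrightarrow> \<bar>jet j x v\<bar> \<le> C * prod_list (map norm v)"
proof -
  consider "j = 0" | "j = 1" | "2 \<le> j" by linarith
  then have "(\<forall>v. length v = j \<longrightarrow> (\<lambda>p. g j p (B x p) * Bprod v p) summable_on UNIV) \<and>
    (\<exists>C. \<forall>v. length v = j \<longrightarrow> \<bar>jet j x v\<bar> \<le> C * prod_list (map norm v))"
  proof cases
    case 1
    then show ?thesis using summable_value[of x] by (auto intro!: exI[of _ "\<bar>jet 0 x []\<bar>"])
  next
    case 2
    obtain c where c: "(\<lambda>p. (c p)\<^sup>2) summable_on UNIV" "\<And>p. 0 \<le> c p"
      "\<And>p s. \<bar>s\<bar> \<le> \<bar>B x p\<bar> \<Longrightarrow> \<bar>g 1 p s\<bar> \<le> c p" using g1_envelope by blast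
    have b: "\<bar>g j p (B x p) * Bprod v p\<bar> \<le> c p * \<bar>Bprod v p\<bar>" for v p
      using c(3)[of "B x p" p] by (simp add: 2 abs_mult mult_right_mono)
    have len: "length v = j \<Longrightarrow> 1 \<le> length v" for v :: "'a list" using 2 by simp
    show ?thesis unfolding jet_def
      using weighted_product_1[OF c(1) len b c(2)] by (intro conjI exI allI impI) assumption+
  next
    case 3
    obtain C where C: "0 \<le> C" "\<And>p t. \<bar>t\<bar> \<le> norm x \<Longrightarrow> \<bar>g j p t\<bar> \<le> C"
      using g_bound'[OF 3 j] by blast
    have b: "\<bar>g j p (B x p) * Bprod v p\<bar> \<le> C * \<bar>Bprod v p\<bar>" for v p
      using C(2)[OF abs_B_le] by (simp add: abs_mult mult_right_mono)
    have len: "length v = j \<Longrightarrow> 2 \<le> length v" for v :: "'a list" using 3 by simp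
    show ?thesis unfolding jet_def
      using weighted_product_2[OF len C(1) b] by (intro conjI exI allI impI) assumption+
  qed
  then show "(\<lambda>p. g j p (B x p) * Bprod v p) summable_on UNIV"
    and "\<exists>C. \<forall>v. length v = j \<longrightarrow> \<bar>jet j x v\<bar> \<le> C * prod_list (map norm v)"
    using v by blast+
qed

lemma Bprod_update:
  assumes "i < length v"
  shows "Bprod (v[i := w]) p = Bprod (take i v) p * Bprod (drop (Suc i) v) p * B w p"
  using assms by (simp add: upd_conv_take_nth_drop)

lemma bounded_multilinear_jet:
  assumes j: "j \<le> k"
  shows "bounded_multilinear j (jet j x)"
  unfolding bounded_multilinear_def
proof (intro conjI allI impI)
  obtain C where "\<And>v. length v = j \<Longrightarrow> \<bar>jet j x v\<bar> \<le> C * prod_list (map norm v)"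
    using summable_jet(2)[OF j length_replicate] by blast
  then show "\<exists>C. \<forall>v. length v = j \<longrightarrow> norm (jet j x v) \<le> C * prod_list (map norm v)"
    by auto
  fix v :: "'a list" and i assume v: "length v = j" "i < j"
  then have s: "(\<lambda>p. g j p (B x p) * Bprod (v[i := w]) p) summable_on UNIV" for w
    by (intro summable_jet(1)[OF j]) simp
  show "linear (\<lambda>w. jet j x (v[i := w]))"
  proof
    fix a b
    have "jet j x (v[i := a + b]) = (\<Sum>\<^sub>\<infinity>p. g j p (B x p) * Bprod (v[i := a]) p
        + g j p (B x p) * Bprod (v[i := b]) p)"
      unfolding jet_def using v by (intro infsum_cong) (simp add: Bprod_update B_add algebra_simps)
    then show "jet j x (v[i := a + b]) = jet j x (v[i := a]) + jet j x (v[i := b])"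
      by (simp only: infsum_add[OF s s] jet_def)
    fix r
    have "jet j x (v[i := r *\<^sub>R a]) = (\<Sum>\<^sub>\<infinity>p. r * (g j p (B x p) * Bprod (v[i := a]) p))"
      unfolding jet_def using v by (intro infsum_cong) (simp add: Bprod_update B_scale algebra_simps)
    then show "jet j x (v[i := r *\<^sub>R a]) = r *\<^sub>R jet j x (v[i := a])"
      by (simp only: infsum_cmult_right[OF s] jet_def real_scaleR_def)
  qed
qed

lemma jet_remainder:
  assumes "j < k" "length v = j"
  shows "jet j (x + h) v - jet j x v - jet (Suc j) x (h # v) =
    (\<Sum>\<^sub>\<infinity>p. (g j p (B x p + B h p) - g j p (B x p) - g (Suc j) p (B x p) * B h p) * Bprod v p)"
proof -
  have s: "(\<lambda>p. g j p (B (x + h) p) * Bprod v p) summable_on UNIV"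
    "(\<lambda>p. g j p (B x p) * Bprod v p) summable_on UNIV"
    "(\<lambda>p. g (Suc j) p (B x p) * Bprod (h # v) p) summable_on UNIV"
    using summable_jet(1)[of j v "x + h"] summable_jet(1)[of j v x]
      summable_jet(1)[of "Suc j" "h # v" x] assms by (simp_all only: length_Cons Suc_le_eq less_imp_le)
  have "jet j (x + h) v - jet j x v - jet (Suc j) x (h # v) =
    (\<Sum>\<^sub>\<infinity>p. g j p (B (x + h) p) * Bprod v p - g j p (B x p) * Bprod v p
       - g (Suc j) p (B x p) * Bprod (h # v) p)"
    unfolding jet_def by (simp only: infsum_diff_real[OF s(1,2)] infsum_diff_real[OF summable_on_diff_real[OF s(1,2)] s(3)])
  also have "\<dots> = (\<Sum>\<^sub>\<infinity>p. (g j p (B x p + B h p) - g j p (B x p) - g (Suc j) p (B x p) * B h p) * Bprod v p)"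
    by (intro infsum_cong) (simp add: B_add algebra_simps)
  finally show ?thesis .
qed

text \<open>At order zero the remainder is quadratic in the increment, so that one factor is
  left to produce smallness after summation; at higher orders the modulus of continuity of
  the next derivative is used, the sum being controlled by two of the linear factors.\<close>

lemma jet_differentiable:
  assumes j: "j < k" and e: "0 < e"
  shows "\<exists>d>0. \<forall>h v. norm h < d \<longrightarrow> length v = j \<longrightarrow>
    norm (jet j (x + h) v - jet j x v - jet (Suc j) x (h # v)) \<le> e * norm h * prod_list (map norm v)"
proof (cases "j = 0")
  case True
  obtain C where C: "0 \<le> C" "\<And>p s h. \<bar>s\<bar> \<le> norm x + 1 \<Longrightarrow> \<bar>s + h\<bar> \<le> norm x + 1 \<Longrightarrow>
      \<bar>g 1 p (s + h) - g 1 p s\<bar> \<le> C * \<bar>h\<bar>"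
    using g1_lipschitz by blast
  have "\<bar>jet 0 (x + h) [] - jet 0 x [] - jet (Suc 0) x [h]\<bar> \<le> e * norm h"
    if h: "norm h < min 1 (e / (C + 1))" for h
  proof -
    let ?r = "\<lambda>p. g 0 p (B x p + B h p) - g 0 p (B x p) - g 1 p (B x p) * B h p"
    have "\<bar>?r p\<bar> \<le> C * \<bar>Bprod [h, h] p\<bar>" for p
    proof -
      have "(g 0 p has_real_derivative g 1 p t) (at t)" for t
        using g_deriv[of 0 p t] k2 by simp
      then obtain z where z: "g 0 p (B x p + B h p) - g 0 p (B x p) = B h p * g 1 p z"
        "\<bar>z - B x p\<bar> \<le> \<bar>B h p\<bar>"
        using mvt_increment[of "g 0 p" "g 1 p" "B x p" "B h p"] by blast
      have "\<bar>g 1 p (B x p + (z - B x p)) - g 1 p (B x p)\<bar> \<le> C * \<bar>z - B x p\<bar>"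
        using abs_B_le[of x p] abs_B_le[of h p] h z(2) by (intro C(2)) auto
      also have "\<dots> \<le> C * \<bar>B h p\<bar>" using z(2) C(1) by (rule mult_left_mono)
      finally have "\<bar>B h p\<bar> * \<bar>g 1 p z - g 1 p (B x p)\<bar> \<le> \<bar>B h p\<bar> * (C * \<bar>B h p\<bar>)"
        by (intro mult_left_mono) auto
      moreover have "?r p = B h p * (g 1 p z - g 1 p (B x p))" using z(1) by (simp add: algebra_simps)
      ultimately show ?thesis by (simp add: abs_mult mult_ac)
    qed
    from weighted_product_2(2)[OF _ C(1) this]
    have "\<bar>jet 0 (x + h) [] - jet 0 x [] - jet (Suc 0) x [h]\<bar> \<le> C * (norm h * norm h)"
      using jet_remainder[OF j, of "[]" x h] True by simp
    also have "\<dots> \<le> e * norm h"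
    proof -
      have "C * norm h \<le> (C + 1) * norm h" by (simp add: distrib_right)
      also have "\<dots> \<le> e" using h C(1) by (simp add: field_simps)
      finally show ?thesis by (metis mult.assoc mult_right_mono norm_ge_zero)
    qed
    finally show ?thesis .
  qed
  moreover have "min 1 (e / (C + 1)) > 0" using e C(1) by simp
  ultimately show ?thesis using True by (intro exI[of _ "min 1 (e / (C + 1))"]) auto
next
  case False
  then have j2: "2 \<le> Suc j" "Suc j \<le> k" using j by auto
  obtain d where d: "d > 0" "\<And>p s t. \<bar>s\<bar> \<le> norm x + 1 \<Longrightarrow> \<bar>t\<bar> \<le> norm x + 1 \<Longrightarrow> \<bar>s - t\<bar> < d \<Longrightarrow>
      \<bar>g (Suc j) p s - g (Suc j) p t\<bar> \<le> e"
    using g_equicont[OF j2 e, of "norm x + 1"] by blast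
  have "\<bar>jet j (x + h) v - jet j x v - jet (Suc j) x (h # v)\<bar> \<le> e * norm h * prod_list (map norm v)"
    if h: "norm h < min 1 d" and v: "length v = j" for h v
  proof -
    let ?r = "\<lambda>p. g j p (B x p + B h p) - g j p (B x p) - g (Suc j) p (B x p) * B h p"
    have "\<bar>?r p * Bprod v p\<bar> \<le> e * \<bar>Bprod (h # v) p\<bar>" for p
    proof -
      obtain z where z: "g j p (B x p + B h p) - g j p (B x p) = B h p * g (Suc j) p z"
        "\<bar>z - B x p\<bar> \<le> \<bar>B h p\<bar>"
        using mvt_increment[of "g j p" "g (Suc j) p" "B x p" "B h p"] g_deriv[OF j] by blast
      have "\<bar>g (Suc j) p z - g (Suc j) p (B x p)\<bar> \<le> e"
        using abs_B_le[of x p] abs_B_le[of h p] h z(2) by (intro d(2)) auto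
      then have le: "\<bar>B h p * Bprod v p\<bar> * \<bar>g (Suc j) p z - g (Suc j) p (B x p)\<bar> \<le> \<bar>B h p * Bprod v p\<bar> * e"
        by (intro mult_left_mono) auto
      have "?r p = B h p * (g (Suc j) p z - g (Suc j) p (B x p))"
        using z(1) by (simp add: algebra_simps)
      then have eq: "?r p * Bprod v p = (B h p * Bprod v p) * (g (Suc j) p z - g (Suc j) p (B x p))"
        by (simp only: mult_ac)
      show ?thesis unfolding eq using le by (simp add: abs_mult mult_ac)
    qed
    from weighted_product_2(2)[OF _ _ this] show ?thesis
      using e v j2 by (simp add: jet_remainder[OF j v] mult.assoc)
  qed
  moreover have "min 1 d > 0" using d by simp
  ultimately show ?thesis by (intro exI[of _ "min 1 d"]) auto
qed

lemma frechet_jet: "frechet_jet k jet"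
proof (rule frechet_jetI)
  show "j \<le> k \<Longrightarrow> bounded_multilinear j (jet j x)" for j x by (rule bounded_multilinear_jet)
  show "j < k \<Longrightarrow> 0 < e \<Longrightarrow> \<exists>d>0. \<forall>h v. norm h < d \<longrightarrow> length v = j \<longrightarrow>
    norm (jet j (x + h) v - jet j x v - jet (Suc j) x (h # v)) \<le> e * norm h * prod_list (map norm v)"
    for j x e by (rule jet_differentiable)
  fix x :: 'a and e :: real assume e: "0 < e"
  obtain d where d: "d > 0" "\<And>p s t. \<bar>s\<bar> \<le> norm x + 1 \<Longrightarrow> \<bar>t\<bar> \<le> norm x + 1 \<Longrightarrow> \<bar>s - t\<bar> < d \<Longrightarrow>
      \<bar>g k p s - g k p t\<bar> \<le> e"
    using g_equicont[OF k2 order_refl e, of "norm x + 1"] by blast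
  have "\<bar>jet k (x + h) v - jet k x v\<bar> \<le> e * prod_list (map norm v)"
    if h: "norm h < min 1 d" and v: "length v = k" for h v
  proof -
    have s: "(\<lambda>p. g k p (B y p) * Bprod v p) summable_on UNIV" for y
      using v by (intro summable_jet(1)) auto
    have "\<bar>g k p (B (x + h) p) * Bprod v p - g k p (B x p) * Bprod v p\<bar> \<le> e * \<bar>Bprod v p\<bar>" for p
    proof -
      have "\<bar>g k p (B (x + h) p) - g k p (B x p)\<bar> \<le> e"
        using abs_B_le[of x p] abs_B_le[of h p] h by (intro d(2)) (auto simp: B_add)
      then show ?thesis by (simp add: abs_mult mult_right_mono flip: left_diff_distrib)
    qed
    from weighted_product_2(2)[OF _ _ this] show ?thesis
      using e v k2 unfolding jet_def by (simp add: infsum_diff_real[OF s s, symmetric])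
  qed
  moreover have "min 1 d > 0" using d by simp
  ultimately show "\<exists>d>0. \<forall>h v. norm h < d \<longrightarrow> length v = k \<longrightarrow>
      norm (jet k (x + h) v - jet k x v) \<le> e * prod_list (map norm v)"
    by (intro exI[of _ "min 1 d"]) auto
qed

text \<open>Subtracting \<open>lam / 2\<close> times the squared norm leaves a sum of convex functions of the
  coordinates, since all coordinates of a point of the ball have modulus at most \<open>r\<close>.\<close>

lemma strongly_convex_on_ball:
  assumes conv: "\<And>p t. \<bar>t\<bar> \<le> r \<Longrightarrow> lam \<le> g 2 p t" and x: "norm x \<le> r" and y: "norm y \<le> r"
    and t: "0 \<le> t" "t \<le> 1"
  shows "jet 0 ((1 - t) *\<^sub>R x + t *\<^sub>R y) [] \<le> (1 - t) * jet 0 x [] + t * jet 0 y []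
    - lam / 2 * (t * (1 - t) * (norm (x - y))\<^sup>2)"
proof -
  let ?z = "(1 - t) *\<^sub>R x + t *\<^sub>R y"
  let ?q = "\<lambda>p s. g 0 p s - lam / 2 * s\<^sup>2"
  have convex: "convex_on {-r..r} (?q p)" for p
  proof (rule f''_ge0_imp_convex)
    show "(?q p has_real_derivative g 1 p s - lam * s) (at s)" for s
      using g_deriv[of 0 p s] k2 by (auto intro!: derivative_eq_intros)
    show "((\<lambda>s. g 1 p s - lam * s) has_real_derivative g 2 p s - lam) (at s)" for s
      using g_deriv[of 1 p s] k2 by (auto intro!: derivative_eq_intros simp: numeral_2_eq_2)
    show "0 \<le> g 2 p s - lam" if "s \<in> {-r..r}" for s
      using conv[of s p] that by auto
  qed simp
  have q: "?q p (B ?z p) \<le> (1 - t) * ?q p (B x p) + t * ?q p (B y p)" for p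
    using convex_onD[OF convex t, of "B x p" "B y p" p] abs_B_le[of x p] abs_B_le[of y p] x y
    by (simp add: B_add B_scale abs_le_iff)
  have hs: "((\<lambda>p. ?q p (B u p)) has_sum jet 0 u [] - lam / 2 * (norm u)\<^sup>2) UNIV" for u
  proof -
    have "((\<lambda>p. g 0 p (B u p)) has_sum jet 0 u []) UNIV"
      unfolding jet_def using has_sum_infsum[OF summable_value[of u]] by simp
    from has_sum_add[OF this has_sum_cmult_right[OF has_sum_B, of "- (lam / 2)" u]]
    show ?thesis by simp
  qed
  have "jet 0 ?z [] - lam / 2 * (norm ?z)\<^sup>2 \<le>
     (1 - t) * (jet 0 x [] - lam / 2 * (norm x)\<^sup>2) + t * (jet 0 y [] - lam / 2 * (norm y)\<^sup>2)"
    by (rule has_sum_mono[OF hs has_sum_add[OF has_sum_cmult_right[OF hs] has_sum_cmult_right[OF hs]]])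
       (rule q)
  then show ?thesis
    unfolding norm_convex_combination by (simp add: algebra_simps diff_divide_distrib add_divide_distrib)
qed

end


section \<open>Minimisers of a Lipschitz family of strongly convex functionals\<close>

text \<open>The midpoint inequality makes every minimising sequence Cauchy, so no weak compactness is
  involved; applied to the limit it yields quadratic growth.\<close>

lemma strongly_convex_minimiser_exists:
  fixes E :: "'a::banach \<Rightarrow> real"
  assumes c: "0 < c" and r: "0 < r" and cont: "continuous_on UNIV E"
    and conv: "\<And>x y. norm x \<le> r \<Longrightarrow> norm y \<le> r \<Longrightarrow>
      E ((1/2) *\<^sub>R x + (1/2) *\<^sub>R y) \<le> E x / 2 + E y / 2 - c * (norm (x - y))\<^sup>2"
    and bdd: "\<And>x. norm x \<le> r \<Longrightarrow> b \<le> E x"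
  shows "\<exists>u. norm u \<le> r \<and> (\<forall>x. norm x \<le> r \<longrightarrow> E u + c * (norm (u - x))\<^sup>2 \<le> E x)"
proof -
  let ?S = "cball (0::'a) r"
  define m where "m = Inf (E ` ?S)"
  have bb: "bdd_below (E ` ?S)" using bdd by (auto intro!: bdd_belowI2)
  have ne: "E ` ?S \<noteq> {}" using r by auto
  have m_le: "m \<le> E x" if "norm x \<le> r" for x
    unfolding m_def using that bb by (intro cINF_lower) auto
  have mid: "norm ((1/2) *\<^sub>R x + (1/2) *\<^sub>R y) \<le> r" if "norm x \<le> r" "norm y \<le> r" for x y :: 'a
    using norm_triangle_ineq[of "(1/2) *\<^sub>R x" "(1/2) *\<^sub>R y"] that by simp
  have gap: "c * (norm (x - y))\<^sup>2 \<le> (E x - m) / 2 + (E y - m) / 2"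
    if "norm x \<le> r" "norm y \<le> r" for x y
    using conv[OF that] m_le[OF mid[OF that]] by (simp add: field_simps)
  define q where "q n = inverse (real (Suc n))" for n
  have q_pos: "q n > 0" for n by (simp add: q_def)
  have q_mono: "i \<ge> n \<Longrightarrow> q i \<le> q n" for i n
    by (auto simp: q_def intro!: le_imp_inverse_le)
  have "\<exists>x. norm x \<le> r \<and> E x < m + q n" for n
    using cInf_lessD[OF ne, of "m + q n"] q_pos[of n] by (auto simp: m_def[symmetric])
  then obtain X where X: "\<And>n. norm (X n) \<le> r" "\<And>n. E (X n) < m + q n"
    by metis
  have "Cauchy X"
  proof (rule metric_CauchyI)
    fix e :: real assume e: "0 < e"
    then obtain N where N: "q N < c * e\<^sup>2"
      using reals_Archimedean[of "c * e\<^sup>2"] c by (auto simp: q_def)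
    have "dist (X i) (X j) < e" if "i \<ge> N" "j \<ge> N" for i j
    proof -
      have "E (X i) - m < c * e\<^sup>2" "E (X j) - m < c * e\<^sup>2"
        using X(2)[of i] X(2)[of j] q_mono[OF that(1)] q_mono[OF that(2)] N by linarith+
      with gap[OF X(1) X(1), of i j] have "c * (norm (X i - X j))\<^sup>2 < c * e\<^sup>2"
        by (simp add: field_simps)
      then show ?thesis using c e by (simp add: dist_norm power_less_imp_less_base)
    qed
    then show "\<exists>N. \<forall>i\<ge>N. \<forall>j\<ge>N. dist (X i) (X j) < e" by blast
  qed
  then obtain u where u: "X \<longlonglongrightarrow> u" using Cauchy_convergent convergent_def by blast
  have ur: "norm u \<le> r"
    using Lim_bounded[OF tendsto_norm[OF u]] X(1) by blast
  have "(\<lambda>n. E (X n)) \<longlonglongrightarrow> E u"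
    using cont u by (auto intro!: continuous_on_tendsto_compose[OF cont u])
  moreover have "(\<lambda>n. m + q n) \<longlonglongrightarrow> m + 0"
    unfolding q_def by (intro tendsto_add tendsto_const LIMSEQ_inverse_real_of_nat)
  ultimately have "E u \<le> m + 0"
    by (rule LIMSEQ_le) (intro exI[of _ 0] allI impI less_imp_le X(2))
  then have Eu: "E u = m" using m_le[OF ur] by simp
  have "E u + c * (norm (u - x))\<^sup>2 \<le> E x" if x: "norm x \<le> r" for x
    using gap[OF ur x] m_le[OF x] Eu by simp
  then show ?thesis using ur by blast
qed

text \<open>The minimisers over the closed ball depend on the parameter in a Lipschitz way. As zero is
  the minimiser for parameter zero, for small parameters they stay in the open ball and are
  therefore local minimisers in the whole space.\<close>

lemma strongly_convex_family_minimisers: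
  fixes E :: "real \<Rightarrow> 'a::banach \<Rightarrow> real"
  assumes c: "0 < c" and r: "0 < r" and K: "0 \<le> K"
    and conv: "\<And>\<epsilon> x y t. 0 \<le> \<epsilon> \<Longrightarrow> \<epsilon> < \<eta> \<Longrightarrow> norm x \<le> r \<Longrightarrow> norm y \<le> r \<Longrightarrow> 0 \<le> t \<Longrightarrow> t \<le> 1 \<Longrightarrow>
      E \<epsilon> ((1 - t) *\<^sub>R x + t *\<^sub>R y)
        \<le> (1 - t) * E \<epsilon> x + t * E \<epsilon> y - c * (t * (1 - t) * (norm (x - y))\<^sup>2)"
    and cont: "\<And>\<epsilon>. 0 \<le> \<epsilon> \<Longrightarrow> \<epsilon> < \<eta> \<Longrightarrow> continuous_on UNIV (E \<epsilon>)"
    and lip: "\<And>\<epsilon> \<epsilon>' x y. 0 \<le> \<epsilon> \<Longrightarrow> \<epsilon> < \<eta> \<Longrightarrow> 0 \<le> \<epsilon>' \<Longrightarrow> \<epsilon>' < \<eta> \<Longrightarrow> norm x \<le> r \<Longrightarrow> norm y \<le> r \<Longrightarrow>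
      \<bar>(E \<epsilon> x - E \<epsilon> y) - (E \<epsilon>' x - E \<epsilon>' y)\<bar> \<le> K * \<bar>\<epsilon> - \<epsilon>'\<bar> * norm (x - y)"
    and base: "\<And>x. norm x \<le> r \<Longrightarrow> E 0 0 \<le> E 0 x"
    and \<eta>: "0 < \<eta>"
  shows "\<exists>\<epsilon>0>0. \<epsilon>0 \<le> \<eta> \<and> (\<exists>u :: real \<Rightarrow> 'a. continuous_on {0..<\<epsilon>0} u \<and>
    (\<forall>\<epsilon>\<in>{0..<\<epsilon>0}. norm (u \<epsilon>) < r \<and> locally_unique_minimiser (E \<epsilon>) (u \<epsilon>)))"
proof -
  have ex: "\<exists>u. norm u \<le> r \<and> (\<forall>x. norm x \<le> r \<longrightarrow> E \<epsilon> u + c / 4 * (norm (u - x))\<^sup>2 \<le> E \<epsilon> x)"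
    if \<epsilon>: "0 \<le> \<epsilon>" "\<epsilon> < \<eta>" for \<epsilon>
  proof (rule strongly_convex_minimiser_exists)
    show "E \<epsilon> ((1/2) *\<^sub>R x + (1/2) *\<^sub>R y) \<le> E \<epsilon> x / 2 + E \<epsilon> y / 2 - c / 4 * (norm (x - y))\<^sup>2"
      if "norm x \<le> r" "norm y \<le> r" for x y
      using conv[OF \<epsilon> that, of "1/2"] by simp
    show "E \<epsilon> 0 - K * \<epsilon> * r \<le> E \<epsilon> x" if x: "norm x \<le> r" for x
    proof -
      have "\<bar>(E \<epsilon> x - E \<epsilon> 0) - (E 0 x - E 0 0)\<bar> \<le> K * \<bar>\<epsilon> - 0\<bar> * norm (x - 0)"
        using \<epsilon> \<eta> x r by (intro lip) auto
      also have "\<dots> \<le> K * \<epsilon> * r" using \<epsilon> x K by (auto intro!: mult_left_mono)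
      finally show ?thesis using base[OF x] by simp
    qed
  qed (use c r cont[OF \<epsilon>] in auto)
  define u where "u \<epsilon> = (SOME u. norm u \<le> r \<and>
    (\<forall>x. norm x \<le> r \<longrightarrow> E \<epsilon> u + c / 4 * (norm (u - x))\<^sup>2 \<le> E \<epsilon> x))" for \<epsilon>
  have u: "norm (u \<epsilon>) \<le> r"
    and growth: "norm x \<le> r \<Longrightarrow> E \<epsilon> (u \<epsilon>) + c / 4 * (norm (u \<epsilon> - x))\<^sup>2 \<le> E \<epsilon> x"
    if "0 \<le> \<epsilon>" "\<epsilon> < \<eta>" for \<epsilon> x
    using someI_ex[OF ex[OF that]] unfolding u_def by blast+
  \<comment> \<open>Adding the growth estimates at two parameters bounds the distance of the minimisers.\<close>
  have lipu: "norm (u \<epsilon> - u \<epsilon>') \<le> 2 * K / c * \<bar>\<epsilon> - \<epsilon>'\<bar>"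
    if \<epsilon>: "0 \<le> \<epsilon>" "\<epsilon> < \<eta>" and \<epsilon>': "0 \<le> \<epsilon>'" "\<epsilon>' < \<eta>" for \<epsilon> \<epsilon>'
  proof -
    let ?d = "norm (u \<epsilon> - u \<epsilon>')"
    have "c / 2 * ?d\<^sup>2 \<le> (E \<epsilon>' (u \<epsilon>) - E \<epsilon>' (u \<epsilon>')) - (E \<epsilon> (u \<epsilon>) - E \<epsilon> (u \<epsilon>'))"
      using growth[OF \<epsilon> u[OF \<epsilon>']] growth[OF \<epsilon>' u[OF \<epsilon>]] by (simp add: norm_minus_commute)
    also have "\<dots> \<le> K * \<bar>\<epsilon> - \<epsilon>'\<bar> * ?d"
      using lip[OF \<epsilon>' \<epsilon> u[OF \<epsilon>] u[OF \<epsilon>']] by (simp add: abs_minus_commute)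
    finally have le: "(c / 2 * ?d) * ?d \<le> (K * \<bar>\<epsilon> - \<epsilon>'\<bar>) * ?d" by (simp add: power2_eq_square)
    show ?thesis
    proof (cases "?d = 0")
      case True
      show ?thesis unfolding True using K c by simp
    next
      case False
      then have "c / 2 * ?d \<le> K * \<bar>\<epsilon> - \<epsilon>'\<bar>" using le by (simp add: mult_right_le_imp_le)
      then show ?thesis using c by (simp add: field_simps)
    qed
  qed
  have u0: "u 0 = 0"
  proof -
    have "c / 4 * (norm (u 0))\<^sup>2 \<le> 0" using growth[of 0 0] base[OF u[of 0]] \<eta> r by simp
    then show ?thesis using c by (simp add: mult_le_0_iff)
  qed
  define \<epsilon>0 where "\<epsilon>0 = min \<eta> (r / (2 * K / c + 1))"
  have pos: "2 * K / c + 1 > 0" using K c by (simp add: add_nonneg_pos)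
  have "\<epsilon>0 > 0" "\<epsilon>0 \<le> \<eta>" using \<eta> r pos by (auto simp: \<epsilon>0_def)
  moreover have "continuous_on {0..<\<epsilon>0} u"
  proof (rule continuous_onI)
    fix x e :: real assume x: "x \<in> {0..<\<epsilon>0}" and e: "0 < e"
    have "dist (u x') (u x) \<le> e" if "x' \<in> {0..<\<epsilon>0}" "dist x' x < e / (2 * K / c + 1)" for x'
    proof -
      have "norm (u x' - u x) \<le> 2 * K / c * \<bar>x' - x\<bar>"
        using that x \<open>\<epsilon>0 \<le> \<eta>\<close> by (intro lipu) auto
      also have "\<dots> \<le> (2 * K / c + 1) * \<bar>x' - x\<bar>" by (simp add: distrib_right)
      also have "\<dots> \<le> e"
        using that(2) pos by (simp add: dist_real_def pos_less_divide_eq mult.commute)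
      finally show ?thesis by (simp add: dist_norm)
    qed
    then show "\<exists>d>0. \<forall>x'\<in>{0..<\<epsilon>0}. dist x' x < d \<longrightarrow> dist (u x') (u x) \<le> e"
      using e pos by (intro exI[of _ "e / (2 * K / c + 1)"]) auto
  qed
  moreover have "norm (u \<epsilon>) < r \<and> locally_unique_minimiser (E \<epsilon>) (u \<epsilon>)" if "\<epsilon> \<in> {0..<\<epsilon>0}" for \<epsilon>
  proof -
    have \<epsilon>: "0 \<le> \<epsilon>" "\<epsilon> < \<eta>" using that \<open>\<epsilon>0 \<le> \<eta>\<close> by auto
    have "norm (u \<epsilon>) \<le> 2 * K / c * \<epsilon>" using lipu[OF \<epsilon>, of 0] \<epsilon> \<eta> u0 by simp
    also have "\<dots> \<le> (2 * K / c + 1) * \<epsilon>" using \<epsilon> by (simp add: distrib_right)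
    also have "\<dots> < r"
      using that pos by (simp add: \<epsilon>0_def pos_less_divide_eq mult.commute)
    finally have ur: "norm (u \<epsilon>) < r" .
    define R where "R = r - norm (u \<epsilon>)"
    have R: "R > 0" using ur by (simp add: R_def)
    have ball: "norm w \<le> r" if "w \<in> ball (u \<epsilon>) R" for w
      using that norm_triangle_ineq2[of w "u \<epsilon>"] by (simp add: R_def dist_norm norm_minus_commute)
    have le: "E \<epsilon> (u \<epsilon>) \<le> E \<epsilon> w" if "norm w \<le> r" for w
    proof -
      have "0 \<le> c / 4 * (norm (u \<epsilon> - w))\<^sup>2" using c by simp
      then show ?thesis using growth[OF \<epsilon> that] by linarith
    qed
    then have "local_minimiser (E \<epsilon>) (u \<epsilon>)"
      unfolding local_minimiser_def using R ball by blast
    moreover have uni: "w = u \<epsilon>" if w: "w \<in> ball (u \<epsilon>) R" and lw: "local_minimiser (E \<epsilon>) w" for w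
    proof (rule ccontr)
      assume ne: "w \<noteq> u \<epsilon>"
      obtain s where s: "s > 0" "\<And>z. z \<in> ball w s \<Longrightarrow> E \<epsilon> w \<le> E \<epsilon> z"
        using lw unfolding local_minimiser_def by blast
      let ?D = "norm (w - u \<epsilon>)"
      have D: "?D > 0" using ne by simp
      \<comment> \<open>A point of the segment towards \<open>u \<epsilon>\<close> inside the ball where \<open>w\<close> is minimal.\<close>
      define t where "t = min (1/2) (s / (2 * ?D))"
      have t: "0 < t" "t < 1" using s D by (auto simp: t_def)
      let ?z = "(1 - t) *\<^sub>R w + t *\<^sub>R u \<epsilon>"
      have "w - ?z = t *\<^sub>R (w - u \<epsilon>)" by (simp add: algebra_simps)
      then have "dist w ?z = t * ?D" using t by (simp add: dist_norm)
      also have "\<dots> \<le> s / (2 * ?D) * ?D" by (intro mult_right_mono) (auto simp: t_def)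
      also have "\<dots> < s" using D s by simp
      finally have "E \<epsilon> w \<le> E \<epsilon> ?z" by (intro s) simp
      also have "\<dots> \<le> (1 - t) * E \<epsilon> w + t * E \<epsilon> (u \<epsilon>) - c * (t * (1 - t) * ?D\<^sup>2)"
        using t by (intro conv \<epsilon> ball w u) auto
      also have "\<dots> < (1 - t) * E \<epsilon> w + t * E \<epsilon> (u \<epsilon>)" using c t D by simp
      also have "\<dots> \<le> (1 - t) * E \<epsilon> w + t * E \<epsilon> w"
        using t le[OF ball[OF w]] by (simp add: mult_left_mono)
      finally show False by (simp add: algebra_simps)
    qed
    ultimately show ?thesis using ur R unfolding locally_unique_minimiser_def
      by (intro conjI exI[of _ R] ballI impI uni)
  qed
  ultimately show ?thesis
    by (intro exI[of _ \<epsilon>0] exI[of _ u] conjI ballI) simp_all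
qed

section \<open>Bond coordinates of the lattice space\<close>

lemma finite_nn [simp]: "finite nn"
  by (simp add: nn_def)

lemma nn_at_subset: "nn_at m \<subseteq> nn"
  by (auto simp: nn_at_def)

lemma Dgrad_outside: "\<rho> \<notin> nn \<Longrightarrow> Dgrad u m \<rho> = 0"
  using nn_at_subset[of m] by (auto simp: Dgrad_def)

lemma has_sum_nn:
  fixes f :: "index \<Rightarrow> real"
  assumes "\<And>\<rho>. \<rho> \<notin> nn \<Longrightarrow> f \<rho> = 0"
  shows "(f has_sum (\<Sum>\<rho>\<in>nn. f \<rho>)) UNIV"
  by (rule has_sum_finite_neutralI) (use assms in auto)

lemma has_sum_bonds:
  fixes f :: "index \<times> index \<Rightarrow> real"
  assumes "f summable_on UNIV" and "\<And>m \<rho>. \<rho> \<notin> nn \<Longrightarrow> f (m, \<rho>) = 0"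
  shows "((\<lambda>m. \<Sum>\<rho>\<in>nn. f (m, \<rho>)) has_sum (\<Sum>\<^sub>\<infinity>p. f p)) UNIV"
proof (rule has_sum_SigmaD)
  show "(f has_sum (\<Sum>\<^sub>\<infinity>p. f p)) (UNIV \<times> UNIV)" using assms(1) by simp
  show "((\<lambda>\<rho>. f (m, \<rho>)) has_sum (\<Sum>\<rho>\<in>nn. f (m, \<rho>))) UNIV" for m
    by (rule has_sum_nn) (rule assms(2))
qed

definition bond_gradient :: "(index \<Rightarrow> real) \<Rightarrow> index \<times> index \<Rightarrow> real" where
  "bond_gradient u p = Dgrad u (fst p) (snd p)"

lemma Dnorm_sq_eq_sum: "Dnorm_sq u m = (\<Sum>\<rho>\<in>nn. (bond_gradient u (m, \<rho>))\<^sup>2)"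
  by (simp add: Dnorm_sq_def L2_set_def bond_gradient_def sum_nonneg)

text \<open>The norm sums over sites first; indexing by all pairs of indices instead of actual bonds is
  harmless because the gradient vanishes on the other pairs.\<close>

lemma summable_Dnorm_iff_bond:
  "Dnorm_sq u summable_on UNIV \<longleftrightarrow> (\<lambda>p. (bond_gradient u p)\<^sup>2) summable_on UNIV"
proof
  assume "Dnorm_sq u summable_on UNIV"
  then have "(\<lambda>p. (bond_gradient u p)\<^sup>2) summable_on (UNIV \<times> UNIV)"
    by (intro summable_on_SigmaI[where g = "Dnorm_sq u"])
       (auto simp: Dnorm_sq_eq_sum bond_gradient_def Dgrad_outside intro!: has_sum_nn)
  then show "(\<lambda>p. (bond_gradient u p)\<^sup>2) summable_on UNIV" by simp
next
  assume "(\<lambda>p. (bond_gradient u p)\<^sup>2) summable_on UNIV"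
  from has_sum_bonds[OF this] have "(Dnorm_sq u has_sum (\<Sum>\<^sub>\<infinity>p. (bond_gradient u p)\<^sup>2)) UNIV"
    by (simp add: Dnorm_sq_eq_sum[abs_def] bond_gradient_def Dgrad_outside)
  then show "Dnorm_sq u summable_on UNIV" by (rule has_sum_imp_summable)
qed

lemma infsum_Dnorm_eq_bond:
  assumes "(\<lambda>p. (bond_gradient u p)\<^sup>2) summable_on UNIV"
  shows "(\<Sum>\<^sub>\<infinity>m. Dnorm_sq u m) = (\<Sum>\<^sub>\<infinity>p. (bond_gradient u p)\<^sup>2)"
  using has_sum_bonds[OF assms]
  by (intro infsumI) (simp add: Dnorm_sq_eq_sum[abs_def] bond_gradient_def Dgrad_outside)

definition bond :: "hdot1 \<Rightarrow> index \<times> index \<Rightarrow> real" where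
  "bond u = bond_gradient (lattice_fun u)"

lemma lattice_fun_Abs:
  assumes "(\<lambda>p. (bond_gradient u p)\<^sup>2) summable_on UNIV" "u xhat = 0"
  shows "lattice_fun (Abs_hdot1 u) = u"
  using assms by (intro Abs_hdot1_inverse) (simp add: summable_Dnorm_iff_bond)

lemma bond_summable: "(\<lambda>p. (bond u p)\<^sup>2) summable_on UNIV"
  using lattice_fun[of u] by (simp add: bond_def summable_Dnorm_iff_bond)

lemma lattice_fun_xhat: "lattice_fun u xhat = 0"
  using lattice_fun[of u] by simp

interpretation H: ell2_coordinates bond
proof (rule ell2_coordinates.intro)
  show "linear (\<lambda>x. bond x p)" for p
    by (rule linearI)
       (simp_all add: bond_def bond_gradient_def plus_hdot1.rep_eq scaleR_hdot1.rep_eq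
         Dgrad_add Dgrad_scale)
  fix u
  have "(norm u)\<^sup>2 = (\<Sum>\<^sub>\<infinity>p. (bond u p)\<^sup>2)"
    using infsum_Dnorm_eq_bond[of "lattice_fun u"] bond_summable[of u]
    by (simp add: norm_hdot1.rep_eq bond_def infsum_nonneg)
  then show "((\<lambda>p. (bond u p)\<^sup>2) has_sum (norm u)\<^sup>2) UNIV"
    using has_sum_infsum[OF bond_summable, of u] by simp
qed

definition shift :: "index \<Rightarrow> index \<Rightarrow> nat \<Rightarrow> index" where
  "shift x \<rho> n = (fst x + int n * fst \<rho>, snd x + int n * snd \<rho>)"

text \<open>Cauchy--Schwarz along a straight lattice path that crosses no removed bond.\<close>

lemma path_bound:
  assumes \<rho>: "\<rho> \<noteq> 0" and path: "\<And>k. k < n \<Longrightarrow> \<rho> \<in> nn_at (shift x \<rho> k)"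
  shows "\<bar>lattice_fun u (shift x \<rho> n) - lattice_fun u x\<bar> \<le> sqrt (real n) * norm u"
proof -
  let ?p = "\<lambda>k. (shift x \<rho> k, \<rho>)"
  have step: "shift x \<rho> k + \<rho> = shift x \<rho> (Suc k)" for k
    by (simp add: shift_def prod_eq_iff algebra_simps)
  have b: "bond u (?p k) = lattice_fun u (shift x \<rho> (Suc k)) - lattice_fun u (shift x \<rho> k)"
    if "k < n" for k
    using path[OF that] by (simp add: bond_def bond_gradient_def Dgrad_def step)
  have inj: "inj_on ?p {..<n}"
    using \<rho> by (auto simp: inj_on_def shift_def prod_eq_iff)
  have "lattice_fun u (shift x \<rho> n) - lattice_fun u x = (\<Sum>k<n. bond u (?p k))"
    using sum_lessThan_telescope[of "\<lambda>k. lattice_fun u (shift x \<rho> k)" n]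
    by (simp add: b) (simp add: shift_def)
  also have "\<bar>\<dots>\<bar> \<le> (\<Sum>k<n. \<bar>1\<bar> * \<bar>bond u (?p k)\<bar>)"
    by simp
  also have "\<dots> \<le> L2_set (\<lambda>_. 1) {..<n} * L2_set (\<lambda>k. bond u (?p k)) {..<n}"
    by (rule L2_set_mult_ineq)
  also have "\<dots> \<le> sqrt (real n) * norm u"
  proof (rule mult_mono)
    have "(\<Sum>k<n. (bond u (?p k))\<^sup>2) = (\<Sum>p\<in>?p ` {..<n}. (bond u p)\<^sup>2)"
      using inj by (simp add: sum.reindex)
    also have "\<dots> \<le> (norm u)\<^sup>2"
      by (rule finite_sum_le_has_sum[OF H.has_sum_B]) auto
    finally show "L2_set (\<lambda>k. bond u (?p k)) {..<n} \<le> norm u"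
      unfolding L2_set_def by (rule real_le_lsqrt[rotated -1]) (auto intro: sum_nonneg)
  qed (auto simp: L2_set_def intro: sum_nonneg)
  finally show ?thesis .
qed

definition lattice_weight :: "index \<Rightarrow> real" where
  "lattice_weight m = 1 + \<bar>real_of_int (fst m)\<bar> + \<bar>real_of_int (snd m)\<bar>"

lemma lattice_weight_ge_1: "1 \<le> lattice_weight m"
  by (simp add: lattice_weight_def)

lemma horizontal_nn_at: "(1, 0) \<in> nn_at m" "(-1, 0) \<in> nn_at m"
  by (auto simp: nn_at_def nn_def e1_def e2_def)

lemma vertical_nn_at: "1 \<le> fst m \<Longrightarrow> (0, 1) \<in> nn_at m" "1 \<le> fst m \<Longrightarrow> (0, -1) \<in> nn_at m"
  by (auto simp: nn_at_def nn_def e1_def e2_def Gamma_plus_def Gamma_minus_def site_def)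

text \<open>The path from the site runs horizontally to the column of \<open>xhat\<close>, and then along that column;
  the crack lies to the left of it, so no removed bond is crossed.\<close>

lemma pointwise_bound: "\<bar>lattice_fun u m\<bar> \<le> 2 * sqrt (lattice_weight m) * norm u"
proof -
  obtain i j where m: "m = (i, j)" by fastforce
  have h: "\<bar>lattice_fun u (i, j) - lattice_fun u (1, j)\<bar> \<le> sqrt \<bar>real_of_int (i - 1)\<bar> * norm u"
  proof (cases "1 \<le> i")
    case True
    then show ?thesis
      using path_bound[of "(1, 0)" "nat (i - 1)" "(1, j)" u] horizontal_nn_at
      by (simp add: shift_def zero_prod_def)
  next
    case False
    then show ?thesis
      using path_bound[of "(-1, 0)" "nat (1 - i)" "(1, j)" u] horizontal_nn_at
      by (simp add: shift_def zero_prod_def)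
  qed
  have v: "\<bar>lattice_fun u (1, j) - lattice_fun u (1, 1)\<bar> \<le> sqrt \<bar>real_of_int (j - 1)\<bar> * norm u"
  proof (cases "1 \<le> j")
    case True
    then show ?thesis
      using path_bound[of "(0, 1)" "nat (j - 1)" "(1, 1)" u] vertical_nn_at
      by (simp add: shift_def zero_prod_def)
  next
    case False
    then show ?thesis
      using path_bound[of "(0, -1)" "nat (1 - j)" "(1, 1)" u] vertical_nn_at
      by (simp add: shift_def zero_prod_def)
  qed
  have "sqrt \<bar>real_of_int (i - 1)\<bar> \<le> sqrt (lattice_weight m)" "sqrt \<bar>real_of_int (j - 1)\<bar> \<le> sqrt (lattice_weight m)"
    by (auto simp: m lattice_weight_def)
  then have "sqrt \<bar>real_of_int (i - 1)\<bar> * norm u + sqrt \<bar>real_of_int (j - 1)\<bar> * norm u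
      \<le> sqrt (lattice_weight m) * norm u + sqrt (lattice_weight m) * norm u"
    by (intro add_mono mult_right_mono) auto
  moreover have "lattice_fun u (1, 1) = 0" using lattice_fun_xhat by (simp add: xhat_eq)
  moreover have "2 * sqrt (lattice_weight m) * norm u
      = sqrt (lattice_weight m) * norm u + sqrt (lattice_weight m) * norm u" by simp
  ultimately show ?thesis using h v unfolding m by linarith
qed

text \<open>By the pointwise bound a Cauchy sequence converges at every site; finite partial sums of the
  squared differences pass to the limit.\<close>

instance hdot1 :: banach
proof
  fix X :: "nat \<Rightarrow> hdot1" assume C: "Cauchy X"
  have "Cauchy (\<lambda>n. lattice_fun (X n) m)" for m
  proof (rule metric_CauchyI)
    fix e :: real assume e: "0 < e"
    let ?c = "2 * sqrt (lattice_weight m)"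
    have c: "?c > 0" using lattice_weight_ge_1[of m] by simp
    obtain N where N: "\<And>i j. i \<ge> N \<Longrightarrow> j \<ge> N \<Longrightarrow> norm (X i - X j) < e / ?c"
      using metric_CauchyD[OF C, of "e / ?c"] e c by (auto simp: dist_norm)
    have "dist (lattice_fun (X i) m) (lattice_fun (X j) m) < e" if "i \<ge> N" "j \<ge> N" for i j
    proof -
      have "\<bar>lattice_fun (X i) m - lattice_fun (X j) m\<bar> \<le> ?c * norm (X i - X j)"
        using pointwise_bound[of "X i - X j" m] by (simp add: minus_hdot1.rep_eq)
      also have "\<dots> < e" using N[OF that] c by (simp add: pos_less_divide_eq mult.commute)
      finally show ?thesis by (simp add: dist_real_def)
    qed
    then show "\<exists>N. \<forall>i\<ge>N. \<forall>j\<ge>N. dist (lattice_fun (X i) m) (lattice_fun (X j) m) < e" by blast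
  qed
  then have "\<exists>l. (\<lambda>n. lattice_fun (X n) m) \<longlonglongrightarrow> l" for m
    using Cauchy_convergent convergent_def by blast
  then obtain U where U: "\<And>m. (\<lambda>n. lattice_fun (X n) m) \<longlonglongrightarrow> U m" by metis
  have U0: "U xhat = 0" using U[of xhat] by (simp add: lattice_fun_xhat LIMSEQ_const_iff)
  have bU: "(\<lambda>n. bond (X n) p) \<longlonglongrightarrow> bond_gradient U p" for p
    unfolding bond_def bond_gradient_def Dgrad_def
    by (cases "snd p \<in> nn_at (fst p)") (auto intro!: tendsto_diff U)
  have tail: "(\<Sum>p\<in>F. (bond (X n) p - bond_gradient U p)\<^sup>2) \<le> e\<^sup>2"
    if F: "finite F" and N: "\<And>i j. i \<ge> N \<Longrightarrow> j \<ge> N \<Longrightarrow> norm (X i - X j) < e" and n: "n \<ge> N" for F N n e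
  proof (rule tendsto_upperbound)
    show "(\<lambda>k. \<Sum>p\<in>F. (bond (X n) p - bond (X k) p)\<^sup>2)
        \<longlonglongrightarrow> (\<Sum>p\<in>F. (bond (X n) p - bond_gradient U p)\<^sup>2)"
      by (intro tendsto_sum tendsto_power tendsto_diff tendsto_const bU)
    have "(\<Sum>p\<in>F. (bond (X n) p - bond (X k) p)\<^sup>2) \<le> e\<^sup>2" if "k \<ge> N" for k
    proof -
      have "(\<Sum>p\<in>F. (bond (X n - X k) p)\<^sup>2) \<le> (norm (X n - X k))\<^sup>2"
        by (rule finite_sum_le_has_sum[OF H.has_sum_B]) (use F in auto)
      also have "\<dots> \<le> e\<^sup>2" using N[OF n that] by (intro power_mono) auto
      finally show ?thesis by (simp add: H.B_diff)
    qed
    then show "\<forall>\<^sub>F k in sequentially. (\<Sum>p\<in>F. (bond (X n) p - bond (X k) p)\<^sup>2) \<le> e\<^sup>2"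
      by (auto simp: eventually_sequentially)
  qed auto
  have summ: "(\<lambda>p. (bond (X n) p - bond_gradient U p)\<^sup>2) summable_on UNIV"
    and small: "(\<Sum>\<^sub>\<infinity>p. (bond (X n) p - bond_gradient U p)\<^sup>2) \<le> e\<^sup>2"
    if "\<And>i j. i \<ge> N \<Longrightarrow> j \<ge> N \<Longrightarrow> norm (X i - X j) < e" "n \<ge> N" for N n e
  proof -
    show s: "(\<lambda>p. (bond (X n) p - bond_gradient U p)\<^sup>2) summable_on UNIV"
      by (rule nonneg_bdd_above_summable_on) (use tail[OF _ that] in \<open>auto intro!: bdd_aboveI2\<close>)
    show "(\<Sum>\<^sub>\<infinity>p. (bond (X n) p - bond_gradient U p)\<^sup>2) \<le> e\<^sup>2"
      by (rule infsum_le_finite_sums[OF s tail[OF _ that]]) auto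
  qed
  have C': "\<exists>N. \<forall>i j. i \<ge> N \<longrightarrow> j \<ge> N \<longrightarrow> norm (X i - X j) < e" if "e > 0" for e
    using metric_CauchyD[OF C that] by (auto simp: dist_norm)
  obtain N where N: "\<And>i j. i \<ge> N \<Longrightarrow> j \<ge> N \<Longrightarrow> norm (X i - X j) < 1"
    using C'[of 1] by auto
  have "(\<lambda>p. (bond (X N) p + (- (bond (X N) p - bond_gradient U p)))\<^sup>2) summable_on UNIV"
    using summ[OF N order_refl]
    by (intro summable_on_squares_add bond_summable) (simp add: power2_commute)
  then have UL: "lattice_fun (Abs_hdot1 U) = U"
    using U0 by (intro lattice_fun_Abs) auto
  have "X \<longlonglongrightarrow> Abs_hdot1 U"
  proof (rule metric_LIMSEQ_I)
    fix e :: real assume e: "0 < e"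
    obtain N where N: "\<And>i j. i \<ge> N \<Longrightarrow> j \<ge> N \<Longrightarrow> norm (X i - X j) < e / 2"
      using C'[of "e / 2"] e by auto
    have "dist (X n) (Abs_hdot1 U) < e" if "n \<ge> N" for n
    proof -
      have "(norm (X n - Abs_hdot1 U))\<^sup>2 = (\<Sum>\<^sub>\<infinity>p. (bond (X n) p - bond_gradient U p)\<^sup>2)"
        using H.infsum_B[of "X n - Abs_hdot1 U"] by (simp add: H.B_diff) (simp add: bond_def UL)
      also have "\<dots> \<le> (e / 2)\<^sup>2" by (rule small[OF N that])
      finally have "norm (X n - Abs_hdot1 U) \<le> e / 2" 
        by (rule power2_le_imp_le) (use e in simp)
      then show ?thesis using e by (simp add: dist_norm)
    qed
    then show "\<exists>N. \<forall>n\<ge>N. dist (X n) (Abs_hdot1 U) < e" by blast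
  qed
  then show "convergent X" by (rule convergentI)
qed


section \<open>Density of finitely supported functions\<close>

lemma finite_bond_gradient_support:
  assumes "finite {m. v m \<noteq> 0}"
  shows "finite {p. bond_gradient v p \<noteq> 0}"
proof (rule finite_subset)
  let ?S = "{m. v m \<noteq> 0}"
  show "{p. bond_gradient v p \<noteq> 0} \<subseteq> (?S \<union> (\<lambda>(m, \<rho>). m - \<rho>) ` (?S \<times> nn)) \<times> nn"
  proof
    fix p assume "p \<in> {p. bond_gradient v p \<noteq> 0}"
    then have p: "snd p \<in> nn_at (fst p)" "v (fst p + snd p) \<noteq> v (fst p)"
      by (auto simp: bond_gradient_def Dgrad_def split: if_splits)
    then have nn: "snd p \<in> nn" using nn_at_subset by blast
    have "fst p \<in> ?S \<or> fst p + snd p \<in> ?S" using p(2) by auto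
    then show "p \<in> (?S \<union> (\<lambda>(m, \<rho>). m - \<rho>) ` (?S \<times> nn)) \<times> nn"
    proof
      assume "fst p \<in> ?S"
      then show ?thesis using nn by (auto simp: mem_Times_iff)
    next
      assume "fst p + snd p \<in> ?S"
      then have "fst p \<in> (\<lambda>(m, \<rho>). m - \<rho>) ` (?S \<times> nn)"
        using nn by (intro image_eqI[of _ _ "(fst p + snd p, snd p)"]) auto
      then show ?thesis using nn by (auto simp: mem_Times_iff)
    qed
  qed
  show "finite ((?S \<union> (\<lambda>(m, \<rho>). m - \<rho>) ` (?S \<times> nn)) \<times> nn)"
    using assms by auto
qed

lemma summable_bond_gradient_finite:
  assumes "finite {m. v m \<noteq> 0}"
  shows "(\<lambda>p. (bond_gradient v p)\<^sup>2) summable_on UNIV"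
proof -
  have "((\<lambda>p. (bond_gradient v p)\<^sup>2) has_sum
      (\<Sum>p | bond_gradient v p \<noteq> 0. (bond_gradient v p)\<^sup>2)) UNIV"
    by (rule has_sum_finite_neutralI) (use finite_bond_gradient_support[OF assms] in auto)
  then show ?thesis by (rule has_sum_imp_summable)
qed

definition box_radius :: "index \<Rightarrow> nat" where
  "box_radius m = max (nat \<bar>fst m\<bar>) (nat \<bar>snd m\<bar>)"

lemma box_radius_shell: "finite {m. box_radius m = t}" "card {m. box_radius m = t} \<le> 8 * (t + 1)"
proof -
  let ?I = "{- int t..int t}" and ?E = "{int t, - int t}"
  have sub: "{m. box_radius m = t} \<subseteq> ?E \<times> ?I \<union> ?I \<times> ?E"
    by (auto simp: box_radius_def max_def split: if_splits)
  have fin: "finite (?E \<times> ?I \<union> ?I \<times> ?E)" by auto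
  show "finite {m. box_radius m = t}" by (rule finite_subset[OF sub fin])
  have E: "card ?E \<le> 2" by (simp add: card_insert_if)
  have I: "card ?I = 2 * t + 1" by simp
  have "card {m. box_radius m = t} \<le> card (?E \<times> ?I \<union> ?I \<times> ?E)"
    by (rule card_mono[OF fin sub])
  also have "\<dots> \<le> card (?E \<times> ?I) + card (?I \<times> ?E)" by (rule card_Un_le)
  also have "\<dots> = 2 * (card ?E * (2 * t + 1))" by (simp only: card_cartesian_product I) simp
  also have "\<dots> \<le> 2 * (2 * (2 * t + 1))" using E by (intro mult_le_mono) auto
  finally show "card {m. box_radius m = t} \<le> 8 * (t + 1)" by simp
qed

lemma finite_box: "finite {m. box_radius m < T}"
proof -
  have "{m. box_radius m < T} = (\<Union>t<T. {m. box_radius m = t})" by auto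
  then show ?thesis using box_radius_shell(1) by simp
qed

text \<open>The shell of radius \<open>t\<close> has of the order of \<open>t\<close> sites, so the sum is essentially harmonic.\<close>

lemma sum_box_inverse_square:
  assumes "0 < T"
  shows "(\<Sum>m | box_radius m < T. 1 / (1 + real (box_radius m))\<^sup>2) \<le> 8 * (1 + ln (real T))"
proof -
  have "(\<Sum>m | box_radius m < T. 1 / (1 + real (box_radius m))\<^sup>2)
      = (\<Sum>t<T. \<Sum>m | m \<in> {m. box_radius m < T} \<and> box_radius m = t. 1 / (1 + real (box_radius m))\<^sup>2)"
    by (rule sum.group[symmetric]) (auto simp: finite_box)
  also have "\<dots> \<le> (\<Sum>t<T. 8 / (1 + real t))"
  proof (rule sum_mono)
    fix t assume "t \<in> {..<T}"
    then have eq: "{m. m \<in> {m. box_radius m < T} \<and> box_radius m = t} = {m. box_radius m = t}" by auto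
    have "(\<Sum>m | box_radius m = t. 1 / (1 + real (box_radius m))\<^sup>2)
        = real (card {m. box_radius m = t}) * (1 / (1 + real t)\<^sup>2)" by simp
    also have "\<dots> \<le> real (8 * (t + 1)) * (1 / (1 + real t)\<^sup>2)"
      using box_radius_shell(2)[of t] by (intro mult_right_mono of_nat_mono) auto
    also have "\<dots> = 8 * (1 + real t) * (1 / (1 + real t)\<^sup>2)" by simp
    also have "\<dots> = 8 / (1 + real t)"
    proof -
      have "8 * x * (1 / x\<^sup>2) = 8 / x" if "x \<noteq> 0" for x :: real
        using that by (simp add: power2_eq_square)
      then show ?thesis by (metis add_pos_nonneg less_irrefl of_nat_0_le_iff zero_less_one)
    qed
    finally show "(\<Sum>m | m \<in> {m. box_radius m < T} \<and> box_radius m = t. 1 / (1 + real (box_radius m))\<^sup>2)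
        \<le> 8 / (1 + real t)" unfolding eq .
  qed
  also have "\<dots> = 8 * harm T"
    unfolding harm_def sum_distrib_left
    by (rule sum.reindex_bij_witness[of _ "\<lambda>i. i - 1" Suc]) (auto simp: field_simps)
  also have "\<dots> \<le> 8 * (1 + ln (real T))" 
    using euler_mascheroni_sequence_decreasing[of 1 T] assms by (simp add: harm_expand)
  finally show ?thesis .
qed

text \<open>Equal to one on the box of radius \<open>R\<close> and to zero beyond radius about \<open>R\<^sup>2\<close>, with logarithmic
  decay in between.\<close>

definition log_cutoff :: "nat \<Rightarrow> index \<Rightarrow> real" where
  "log_cutoff R m = max 0 (min 1 (2 - ln (1 + real (box_radius m)) / ln (1 + real R)))"

lemma log_cutoff_range: "0 \<le> log_cutoff R m" "log_cutoff R m \<le> 1"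
  by (auto simp: log_cutoff_def)

lemma log_cutoff_eq_1:
  assumes "0 < R" "box_radius m \<le> R"
  shows "log_cutoff R m = 1"
  using assms by (simp add: log_cutoff_def)

lemma log_cutoff_eq_0:
  assumes "0 < R" "(1 + R)\<^sup>2 \<le> box_radius m + 1"
  shows "log_cutoff R m = 0"
proof -
  have "(1 + real R)\<^sup>2 \<le> 1 + real (box_radius m)"
    using of_nat_mono[OF assms(2), where 'a = real] by simp
  then have "ln ((1 + real R)\<^sup>2) \<le> ln (1 + real (box_radius m))"
    by (intro ln_mono) auto
  then have "2 * ln (1 + real R) \<le> ln (1 + real (box_radius m))"
    by (simp add: ln_realpow)
  then have "2 \<le> ln (1 + real (box_radius m)) / ln (1 + real R)"
    using assms(1) by (subst pos_le_divide_eq) auto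
  then show ?thesis by (simp add: log_cutoff_def)
qed

lemma box_radius_neighbour:
  assumes "\<rho> \<in> nn"
  shows "box_radius (m + \<rho>) \<le> box_radius m + 1" "box_radius m \<le> box_radius (m + \<rho>) + 1"
  using assms by (auto simp: nn_def e1_def e2_def box_radius_def)

lemma ln_diff_bound:
  fixes s t :: nat
  assumes "s \<le> t + 1" "t \<le> s + 1"
  shows "\<bar>ln (1 + real s) - ln (1 + real t)\<bar> \<le> 2 / (1 + real t)"
proof -
  have *: "ln (1 + real b) - ln (1 + real a) \<le> 1 / (1 + real a)" if "b \<le> a + 1" for a b :: nat
  proof -
    have "(1 + real a) * (1 + 1 / (1 + real a)) = 2 + real a" by (simp add: field_simps)
    then have "ln (1 + real b) \<le> ln ((1 + real a) * (1 + 1 / (1 + real a)))"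
      using that by (intro ln_mono) auto
    also have "\<dots> = ln (1 + real a) + ln (1 + 1 / (1 + real a))" by (intro ln_mult_pos) (auto simp: add_pos_pos)
    also have "ln (1 + 1 / (1 + real a)) \<le> 1 / (1 + real a)" by (intro ln_add_one_self_le_self) auto
    finally show ?thesis by simp
  qed
  have "1 / (1 + real s) \<le> 2 / (1 + real t)" "1 / (1 + real t) \<le> 2 / (1 + real t)"
    using assms by (auto simp: field_simps)
  then show ?thesis using *[OF assms(1)] *[OF assms(2)] by (simp add: abs_le_iff)
qed

lemma log_cutoff_gradient:
  assumes R: "0 < R"
  shows "(bond_gradient (log_cutoff R) (m, \<rho>))\<^sup>2 \<le> 4 / (ln (1 + real R))\<^sup>2 * (1 / (1 + real (box_radius m))\<^sup>2)"
proof (cases "\<rho> \<in> nn_at m")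
  case True
  then have \<rho>: "\<rho> \<in> nn" using nn_at_subset by blast
  let ?L = "ln (1 + real R)" and ?t = "box_radius m" and ?s = "box_radius (m + \<rho>)"
  have L: "?L > 0" using R by simp
  have clamp: "\<bar>max 0 (min 1 a) - max 0 (min 1 b)\<bar> \<le> \<bar>a - b\<bar>" for a b :: real
    by (auto simp: max_def min_def)
  have "\<bar>log_cutoff R (m + \<rho>) - log_cutoff R m\<bar>
      \<le> \<bar>(2 - ln (1 + real ?s) / ?L) - (2 - ln (1 + real ?t) / ?L)\<bar>"
    unfolding log_cutoff_def by (rule clamp)
  also have "\<dots> = \<bar>ln (1 + real ?s) - ln (1 + real ?t)\<bar> / ?L"
    using L by (simp add: abs_divide abs_minus_commute flip: diff_divide_distrib)
  also have "\<dots> \<le> (2 / (1 + real ?t)) / ?L"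
    using L ln_diff_bound[OF box_radius_neighbour[OF \<rho>]] by (intro divide_right_mono) auto
  finally have "\<bar>bond_gradient (log_cutoff R) (m, \<rho>)\<bar> \<le> 2 / (1 + real ?t) / ?L"
    using True by (simp add: bond_gradient_def Dgrad_def)
  then have "\<bar>bond_gradient (log_cutoff R) (m, \<rho>)\<bar>\<^sup>2 \<le> (2 / (1 + real ?t) / ?L)\<^sup>2"
    by (intro power_mono) auto
  then show ?thesis by (simp add: power_divide power_mult_distrib mult.commute)
next
  case False
  then show ?thesis by (simp add: bond_gradient_def Dgrad_def)
qed

text \<open>The energy of the cutoff tends to zero only because it falls off logarithmically: the
  shell of radius \<open>t\<close> has about \<open>t\<close> bonds, each with squared gradient of order
  \<open>1 / (t\<^sup>2 ln\<^sup>2 R)\<close>, and the harmonic sum up to \<open>R\<^sup>2\<close> contributes a single \<open>ln R\<close>.\<close>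

lemma log_cutoff_energy:
  assumes R: "0 < R"
  shows "finite {m. log_cutoff R m \<noteq> 0}"
    and "(\<Sum>\<^sub>\<infinity>p. (bond_gradient (log_cutoff R) p)\<^sup>2)
      \<le> 128 * (1 + 2 * ln (1 + real R)) / (ln (1 + real R))\<^sup>2"
proof -
  let ?L = "ln (1 + real R)" and ?g = "\<lambda>p. (bond_gradient (log_cutoff R) p)\<^sup>2"
  let ?S = "{m. box_radius m < (1 + R)\<^sup>2}"
  have z: "log_cutoff R m = 0" if "(1 + R)\<^sup>2 \<le> box_radius m + 1" for m
    using log_cutoff_eq_0[OF R that] .
  have "{m. log_cutoff R m \<noteq> 0} \<subseteq> ?S"
    using z by (force simp: not_less)
  then show fin: "finite {m. log_cutoff R m \<noteq> 0}" by (rule finite_subset) (rule finite_box)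
  have "bond_gradient (log_cutoff R) (m, \<rho>) = 0" if "m \<notin> ?S \<or> \<rho> \<notin> nn" for m \<rho>
  proof (cases "\<rho> \<in> nn")
    case True
    then have "(1 + R)\<^sup>2 \<le> box_radius m" using that by simp
    then have "log_cutoff R m = 0" "log_cutoff R (m + \<rho>) = 0"
      using box_radius_neighbour[OF True, of m] by (auto intro!: z)
    then show ?thesis by (simp add: bond_gradient_def Dgrad_def)
  qed (simp add: bond_gradient_def Dgrad_outside)
  then have "(?g has_sum (\<Sum>p\<in>?S \<times> nn. ?g p)) UNIV"
    by (intro has_sum_finite_neutralI) (auto simp: finite_box)
  then have "(\<Sum>\<^sub>\<infinity>p. ?g p) = (\<Sum>p\<in>?S \<times> nn. ?g p)" by (rule infsumI)
  also have "\<dots> = (\<Sum>m\<in>?S. \<Sum>\<rho>\<in>nn. ?g (m, \<rho>))" by (simp add: sum.cartesian_product)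
  also have "\<dots> \<le> (\<Sum>m\<in>?S. \<Sum>\<rho>\<in>nn. 4 / ?L\<^sup>2 * (1 / (1 + real (box_radius m))\<^sup>2))"
    by (intro sum_mono log_cutoff_gradient R)
  also have "\<dots> = 4 * (4 / ?L\<^sup>2 * (\<Sum>m\<in>?S. 1 / (1 + real (box_radius m))\<^sup>2))"
    by (simp add: nn_def e1_def e2_def sum_distrib_left)
  also have "\<dots> \<le> 4 * (4 / ?L\<^sup>2 * (8 * (1 + ln (real ((1 + R)\<^sup>2)))))"
    by (intro mult_left_mono sum_box_inverse_square) auto
  also have "ln (real ((1 + R)\<^sup>2)) = 2 * ?L" by (simp add: ln_realpow)
  finally show "(\<Sum>\<^sub>\<infinity>p. ?g p) \<le> 128 * (1 + 2 * ?L) / ?L\<^sup>2" by (simp add: field_simps)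
qed

lemma small_energy_cutoff:
  assumes Q: "finite Q" and e: "0 < e"
  obtains \<kappa> :: "index \<Rightarrow> real" where "finite {m. \<kappa> m \<noteq> 0}" "\<And>m. 0 \<le> \<kappa> m" "\<And>m. \<kappa> m \<le> 1"
    "\<And>m. m \<in> Q \<Longrightarrow> \<kappa> m = 1" "(\<Sum>\<^sub>\<infinity>p. (bond_gradient \<kappa> p)\<^sup>2) < e"
proof -
  have "((\<lambda>R. 128 * (1 + 2 * ln (1 + real R)) / (ln (1 + real R))\<^sup>2) \<longlongrightarrow> 0) sequentially"
    by real_asymp
  then have ev: "\<forall>\<^sub>F R in sequentially. 128 * (1 + 2 * ln (1 + real R)) / (ln (1 + real R))\<^sup>2 < e"
    using e by (rule order_tendstoD(2))
  moreover have "\<forall>\<^sub>F R in sequentially. 0 < R \<and> (\<forall>m\<in>Q. box_radius m \<le> R)"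
    using Q by (auto simp: eventually_conj_iff eventually_ball_finite_distrib
      intro: eventually_gt_at_top eventually_ge_at_top)
  ultimately have "\<forall>\<^sub>F R in sequentially. 128 * (1 + 2 * ln (1 + real R)) / (ln (1 + real R))\<^sup>2 < e
      \<and> 0 < R \<and> (\<forall>m\<in>Q. box_radius m \<le> R)"
    by eventually_elim auto
  then obtain R where R: "128 * (1 + 2 * ln (1 + real R)) / (ln (1 + real R))\<^sup>2 < e"
      "0 < R" "\<And>m. m \<in> Q \<Longrightarrow> box_radius m \<le> R"
    by (auto dest: eventually_happens)
  show ?thesis
    using log_cutoff_energy[OF R(2)] R
    by (intro that[of "log_cutoff R"] log_cutoff_range log_cutoff_eq_1) auto
qed

definition truncate :: "real \<Rightarrow> real \<Rightarrow> real" where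
  "truncate N t = max (- N) (min N t)"

text \<open>Truncation at a level that exceeds all values on a large finite set, followed by a cutoff equal
  to one there, changes no bond of that set. On the remaining bonds truncation does not
  increase differences, and the cutoff adds the truncation level times its own gradient, whose
  energy is as small as desired. Both operations preserve the value zero at \<open>xhat\<close>.\<close>

lemma finite_support_dense:
  assumes e: "0 < e"
  shows "\<exists>v. finite_support v \<and> norm (u - v) < e"
proof -
  define w where "w = lattice_fun u"
  define f where "f p = (bond u p)\<^sup>2" for p
  have "f summable_on UNIV" using bond_summable[of u] by (simp add: f_def[abs_def])
  then have "\<exists>F. finite F \<and> F \<subseteq> UNIV \<and> dist (sum f F) (infsum f UNIV) \<le> e\<^sup>2 / 32"
    by (rule infsum_finite_approximation) (use e in simp)
  then obtain F where "finite F" "dist (sum f F) (infsum f UNIV) \<le> e\<^sup>2 / 32"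
    by blast
  then have F: "finite F" "infsum f UNIV - sum f F \<le> e\<^sup>2 / 32"
    unfolding dist_real_def by linarith+
  let ?tail = "\<lambda>p. f p - (if p \<in> F then f p else 0)"
  have tail: "(?tail has_sum (infsum f UNIV - sum f F)) UNIV"
    by (intro has_sum_diff_real has_sum_infsum has_sum_finite_neutralI)
       (use F bond_summable[of u] in \<open>auto simp: f_def[abs_def]\<close>)
  define Q where "Q = fst ` F \<union> (\<lambda>p. fst p + snd p) ` F"
  have Q: "finite Q" using F by (simp add: Q_def)
  \<comment> \<open>A sum rather than a maximum, so that the case of empty \<open>Q\<close> needs no distinction.\<close>
  define N where "N = (\<Sum>m\<in>Q. \<bar>w m\<bar>)"
  have N0: "N \<ge> 0" by (simp add: N_def sum_nonneg)
  have N: "\<bar>w m\<bar> \<le> N" if "m \<in> Q" for m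
    unfolding N_def by (rule member_le_sum[OF that]) (auto simp: Q)
  obtain \<kappa> :: "index \<Rightarrow> real" where \<kappa>: "finite {m. \<kappa> m \<noteq> 0}" "\<And>m. 0 \<le> \<kappa> m" "\<And>m. \<kappa> m \<le> 1"
    "\<And>m. m \<in> Q \<Longrightarrow> \<kappa> m = 1" "(\<Sum>\<^sub>\<infinity>p. (bond_gradient \<kappa> p)\<^sup>2) < e\<^sup>2 / (4 * (N\<^sup>2 + 1))"
    using small_energy_cutoff[OF Q, of "e\<^sup>2 / (4 * (N\<^sup>2 + 1))"] e
    by (auto simp: add_nonneg_pos)
  define v where "v m = \<kappa> m * truncate N (w m)" for m
  have "{m. v m \<noteq> 0} \<subseteq> {m. \<kappa> m \<noteq> 0}" by (auto simp: v_def)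
  then have fin: "finite {m. v m \<noteq> 0}" by (rule finite_subset) (rule \<kappa>(1))
  have "v xhat = 0" using N0 by (simp add: v_def w_def lattice_fun_xhat truncate_def)
  then have LV: "lattice_fun (Abs_hdot1 v) = v"
    by (intro lattice_fun_Abs summable_bond_gradient_finite fin)
  have tr: "\<bar>truncate N a\<bar> \<le> N" "\<bar>truncate N a - truncate N b\<bar> \<le> \<bar>a - b\<bar>"
    "\<bar>(a - b) - (truncate N a - truncate N b)\<bar> \<le> \<bar>a - b\<bar>" for a b
    using N0 by (auto simp: truncate_def max_def min_def)
  have trQ: "truncate N (w m) = w m" if "m \<in> Q" for m
    using N[OF that] by (auto simp: truncate_def max_def min_def)
  \<comment> \<open>The factor 8 comes from \<open>(2 a + N x)\<^sup>2 \<le> 8 a\<^sup>2 + 2 N\<^sup>2 x\<^sup>2\<close>; it is matched by the tail bound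
    \<open>e\<^sup>2 / 32\<close> chosen above.\<close>
  have bnd: "(bond (u - Abs_hdot1 v) p)\<^sup>2 \<le> 8 * ?tail p + 2 * N\<^sup>2 * (bond_gradient \<kappa> p)\<^sup>2" for p
  proof -
    obtain m \<rho> where p: "p = (m, \<rho>)" by (cases p)
    have rhs: "0 \<le> 8 * ?tail p + 2 * N\<^sup>2 * (bond_gradient \<kappa> p)\<^sup>2" by (simp add: f_def)
    show ?thesis
    proof (cases "\<rho> \<in> nn_at m")
      case False
      then have "bond w' p = 0" for w' by (simp add: p bond_def bond_gradient_def Dgrad_def)
      then have "(bond (u - Abs_hdot1 v) p)\<^sup>2 = 0" by simp
      then show ?thesis using rhs by (simp only:)
    next
      case True
      let ?d = "(w (m + \<rho>) - w m) - (v (m + \<rho>) - v m)"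
      have b: "bond (u - Abs_hdot1 v) p = ?d"
        using True by (simp add: H.B_diff) (simp add: p bond_def bond_gradient_def Dgrad_def LV w_def)
      show ?thesis
      proof (cases "p \<in> F")
        case True
        then have "m \<in> Q" "m + \<rho> \<in> Q" by (force simp: Q_def p)+
        then have "?d = 0" by (simp add: v_def \<kappa>(4) trQ)
        then show ?thesis unfolding b using rhs by simp
      next
        case False
        let ?a = "w (m + \<rho>)" and ?b = "w m" and ?x = "\<kappa> (m + \<rho>)" and ?y = "\<kappa> m"
        have "?d = ((?a - ?b) - (truncate N ?a - truncate N ?b))
          + (1 - ?y) * (truncate N ?a - truncate N ?b) - truncate N ?a * (?x - ?y)"
          by (simp add: v_def algebra_simps)
        also have "\<bar>\<dots>\<bar> \<le> \<bar>?a - ?b\<bar> + 1 * \<bar>?a - ?b\<bar> + N * \<bar>?x - ?y\<bar>"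
        proof -
          have "\<bar>(1 - ?y) * (truncate N ?a - truncate N ?b)\<bar> \<le> 1 * \<bar>?a - ?b\<bar>"
            unfolding abs_mult using \<kappa>(2,3)[of m] tr(2) by (intro mult_mono) auto
          moreover have "\<bar>truncate N ?a * (?x - ?y)\<bar> \<le> N * \<bar>?x - ?y\<bar>"
            unfolding abs_mult using tr(1) by (intro mult_right_mono) auto
          ultimately show ?thesis using tr(3)[of ?a ?b] by linarith
        qed
        finally have "\<bar>?d\<bar> \<le> 2 * \<bar>?a - ?b\<bar> + N * \<bar>?x - ?y\<bar>" by simp
        then have "?d\<^sup>2 \<le> (2 * \<bar>?a - ?b\<bar> + N * \<bar>?x - ?y\<bar>)\<^sup>2"
          by (metis abs_ge_zero power2_abs power_mono)
        also have "\<dots> \<le> 2 * (2 * \<bar>?a - ?b\<bar>)\<^sup>2 + 2 * (N * \<bar>?x - ?y\<bar>)\<^sup>2"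
          using sum_squares_bound[of "2 * \<bar>?a - ?b\<bar>" "N * \<bar>?x - ?y\<bar>"] by (simp add: power2_sum)
        also have "\<dots> = 8 * (?a - ?b)\<^sup>2 + 2 * N\<^sup>2 * (?x - ?y)\<^sup>2"
          by (simp add: power_mult_distrib)
        also have "\<dots> = 8 * ?tail p + 2 * N\<^sup>2 * (bond_gradient \<kappa> p)\<^sup>2"
          using True False by (simp add: f_def p bond_def bond_gradient_def Dgrad_def w_def)
        finally show ?thesis unfolding b .
      qed
    qed
  qed
  have "(norm (u - Abs_hdot1 v))\<^sup>2 \<le> 8 * (infsum f UNIV - sum f F)
      + 2 * N\<^sup>2 * (\<Sum>\<^sub>\<infinity>p. (bond_gradient \<kappa> p)\<^sup>2)"
    by (rule has_sum_mono[OF H.has_sum_B has_sum_add[OF has_sum_cmult_right[OF tail]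
          has_sum_cmult_right[OF has_sum_infsum[OF summable_bond_gradient_finite[OF \<kappa>(1)]]]]])
       (rule bnd)
  also have "\<dots> < e\<^sup>2"
  proof -
    have "2 * N\<^sup>2 * (\<Sum>\<^sub>\<infinity>p. (bond_gradient \<kappa> p)\<^sup>2) \<le> 2 * (N\<^sup>2 + 1) * (e\<^sup>2 / (4 * (N\<^sup>2 + 1)))"
      using \<kappa>(5) by (intro mult_mono infsum_nonneg) auto
    also have "\<dots> = e\<^sup>2 / 2"
      by (simp add: field_simps add_nonneg_eq_0_iff)
    finally have *: "2 * N\<^sup>2 * (\<Sum>\<^sub>\<infinity>p. (bond_gradient \<kappa> p)\<^sup>2) \<le> e\<^sup>2 / 2" .
    have "8 * a + b < c" if "b \<le> c / 2" "a \<le> c / 32" "0 < c" for a b c :: real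
      using that by linarith
    from this[OF * F(2) zero_less_power[OF e]] show ?thesis .
  qed
  finally have "norm (u - Abs_hdot1 v) < e"
    using e by (simp add: power_less_imp_less_base)
  then show ?thesis using fin LV by (intro exI[of _ "Abs_hdot1 v"]) (simp add: finite_support_def)
qed

lemma continuous_extension_unique:
  fixes E E' :: "hdot1 \<Rightarrow> real"
  assumes "continuous_on UNIV E" "continuous_on UNIV E'"
    and "\<And>v. finite_support v \<Longrightarrow> E v = E' v"
  shows "E = E'"
proof
  fix u
  have "\<exists>v. finite_support v \<and> norm (u - v) < inverse (real (Suc n))" for n
    by (rule finite_support_dense) simp
  then obtain V where V: "\<And>n. finite_support (V n)" "\<And>n. norm (u - V n) < inverse (real (Suc n))"
    by metis
  have "V \<longlonglongrightarrow> u"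
  proof (rule metric_LIMSEQ_I)
    fix e :: real assume "0 < e"
    then obtain N where N: "inverse (real (Suc N)) < e" using reals_Archimedean by blast
    have "dist (V n) u < e" if "n \<ge> N" for n
    proof -
      have "inverse (real (Suc n)) \<le> inverse (real (Suc N))" using that by (intro le_imp_inverse_le) auto
      from less_trans[OF less_le_trans[OF V(2) this] N] show ?thesis
        by (simp add: dist_norm norm_minus_commute)
    qed
    then show "\<exists>N. \<forall>n\<ge>N. dist (V n) u < e" by blast
  qed
  then have "(\<lambda>n. E (V n)) \<longlonglongrightarrow> E u" "(\<lambda>n. E' (V n)) \<longlonglongrightarrow> E' u"
    using assms(1,2) by (auto intro: continuous_on_tendsto_compose)
  then show "E u = E' u" using assms(3)[OF V(1)] by (simp add: LIMSEQ_unique)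
qed


section \<open>The predictor and its residual\<close>

(* The square root enters through its square, its modulus and its half-plane, not through the
   explicit formula. *)
declare csqrt.simps [simp del]

text \<open>Let \<open>p\<close> be the third-order Taylor polynomial of \<open>sqrt (1 + w)\<close>. Then \<open>s\<^sup>2 - p\<^sup>2\<close> is divisible by
  \<open>w\<^sup>4\<close>, and \<open>s + p\<close> is bounded away from zero when \<open>s\<close> is the root with nonnegative real part.\<close>

lemma sqrt_third_order_expansion:
  fixes s w :: complex
  assumes s: "s\<^sup>2 = 1 + w" and Re: "0 \<le> Re s" and w: "cmod w \<le> 1"
  shows "cmod (s - (1 + w/2 - w^2/8 + w^3/16)) \<le> cmod w ^ 4"
proof -
  let ?p = "1 + w/2 - w^2/8 + w^3/16"
  let ?q = "5/64 - w/64 + w^2/256"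
  have "(x - y) * (x + y) = x\<^sup>2 - y\<^sup>2" for x y :: complex
    by (simp add: power2_eq_square algebra_simps)
  then have "(s - ?p) * (s + ?p) = s\<^sup>2 - ?p\<^sup>2" .
  also have "\<dots> = - (w^4 * ?q)"
  proof -
    \<comment> \<open>Rescaling by 16 makes all coefficients integers.\<close>
    have "(1 + 16 * v) - (1 + 8 * v - 32 * v^2 + 256 * v^3)^2
        = - (v^4 * (5120 - 16384 * v + 65536 * v^2))" for v :: complex by algebra
    note id = this[of "w / 16"]
    have p: "1 + 8 * (w / 16) - 32 * (w / 16)^2 + 256 * (w / 16)^3 = ?p"
      by (simp add: power_divide)
    have q: "(w / 16)^4 * (5120 - 16384 * (w / 16) + 65536 * (w / 16)^2) = w^4 * ?q"
      by (simp add: power_divide field_simps)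
    show ?thesis unfolding s using id unfolding p q by simp
  qed
  finally have "cmod ((s - ?p) * (s + ?p)) = cmod (w^4 * ?q)"
    by (simp only: norm_minus_cancel)
  then have prod: "cmod (s - ?p) * cmod (s + ?p) = cmod w ^ 4 * cmod ?q"
    by (simp only: norm_mult norm_power)
  have w2: "cmod w ^ 2 \<le> 1" "cmod w ^ 3 \<le> 1" using w by (auto intro!: power_le_one)
  have "cmod ?q \<le> cmod (5/64 - w/64) + cmod (w^2/256)" by (rule norm_triangle_ineq)
  also have "\<dots> \<le> cmod (5/64) + cmod (w/64) + cmod (w^2/256)"
    using norm_triangle_ineq4[of "5/64" "w/64"] by simp
  also have "\<dots> \<le> 5/16"
    using w w2 by (simp add: norm_divide norm_power)
  finally have q: "cmod ?q \<le> 5/16" .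
  have "cmod (w/2 - w^2/8 + w^3/16) \<le> cmod (w/2) + cmod (w^2/8) + cmod (w^3/16)"
    by (smt (verit) norm_triangle_ineq norm_triangle_ineq4)
  also have "\<dots> \<le> 11/16"
    using w w2 by (simp add: norm_divide norm_power)
  finally have "- (11/16) \<le> Re (w/2 - w^2/8 + w^3/16)"
    using abs_Re_le_cmod[of "w/2 - w^2/8 + w^3/16"] by linarith
  then have "5/16 \<le> Re (s + ?p)" using Re by simp
  also have "\<dots> \<le> cmod (s + ?p)" by (rule complex_Re_le_cmod)
  finally have "cmod (s - ?p) * (5/16) \<le> cmod (s - ?p) * cmod (s + ?p)"
    by (intro mult_left_mono) auto
  also have "\<dots> \<le> cmod w ^ 4 * (5/16)"
    unfolding prod using q by (intro mult_left_mono) auto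
  finally show ?thesis by simp
qed

definition cpos :: "index \<Rightarrow> complex" where
  "cpos m = Complex (fst (site m)) (snd (site m))"

definition cdir :: "index \<Rightarrow> complex" where
  "cdir \<rho> = Complex (real_of_int (fst \<rho>)) (real_of_int (snd \<rho>))"

lemma Re_cpos: "Re (cpos m) = real_of_int (fst m) - 1/2"
  and Im_cpos: "Im (cpos m) = real_of_int (snd m) - 1/2"
  by (simp_all add: cpos_def site_def)

lemma cpos_add: "cpos (m + \<rho>) = cpos m + cdir \<rho>"
  by (simp add: complex_eq_iff Re_cpos Im_cpos cdir_def)

lemma Im_cpos_nonzero: "Im (cpos m) \<noteq> 0"
proof
  assume "Im (cpos m) = 0"
  then have "real_of_int (2 * snd m) = real_of_int 1" by (simp add: Im_cpos)
  then have "2 * snd m = 1" by (simp only: of_int_eq_iff)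
  then show False by presburger
qed

lemma cpos_nonzero: "cpos m \<noteq> 0"
  using Im_cpos_nonzero[of m] by auto

text \<open>Every lattice site has distance at least \<open>1/2\<close> from both coordinate axes.\<close>

lemma half_le_abs: "1/2 \<le> \<bar>real_of_int i - 1/2\<bar>"
proof (cases "1 \<le> i")
  case True
  then have "1 \<le> real_of_int i" by simp
  then show ?thesis by simp
next
  case False
  then have "real_of_int i \<le> 0" by simp
  then show ?thesis by simp
qed

lemma lattice_weight_le: "lattice_weight m \<le> 6 * cmod (cpos m)"
  using half_le_abs[of "fst m"] half_le_abs[of "snd m"]
    abs_Re_le_cmod[of "cpos m"] abs_Im_le_cmod[of "cpos m"]
  unfolding lattice_weight_def Re_cpos Im_cpos by linarith

lemma u_hat_eq_csqrt: "u_hat \<epsilon> m = \<epsilon> * Im (csqrt (cpos m))"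
proof -
  have "csqrt (cpos m) = rcis (sqrt (cmod (cpos m))) (Arg (cpos m) / 2)"
    using rcis_cmod_Arg[of "csqrt (cpos m)"] by simp
  then show ?thesis
    by (simp add: u_hat_def omega_def polar_r_def polar_theta_def cpos_def cmod_def)
qed

lemma Gamma_iff:
  "m \<in> Gamma_plus \<longleftrightarrow> fst m \<le> 0 \<and> snd m = 1" "m \<in> Gamma_minus \<longleftrightarrow> fst m \<le> 0 \<and> snd m = 0"
  unfolding Gamma_plus_def Gamma_minus_def by (auto simp: site_def)

lemma nn_cases:
  assumes "\<rho> \<in> nn"
  obtains "\<rho> = (1, 0)" | "\<rho> = (-1, 0)" | "\<rho> = (0, 1)" | "\<rho> = (0, -1)"
  using assms by (auto simp: nn_def e1_def e2_def)

text \<open>Either the step stays on one side of the real axis, or it joins two mirror sites; in the second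
  case the bond is intact exactly on the uncracked half-line.\<close>

lemma neighbour_position:
  assumes "\<rho> \<in> nn"
  shows "\<rho> \<in> nn_at m \<and> 0 < Im (cpos m) * Im (cpos (m + \<rho>)) \<or>
    cpos (m + \<rho>) = cnj (cpos m) \<and> (if \<rho> \<in> nn_at m then 0 < Re (cpos m) else Re (cpos m) < 0)"
proof -
  obtain i j where m: "m = (i, j)" by (cases m)
  have sgn: "real_of_int a - 1/2 > 0 \<longleftrightarrow> a \<ge> 1" "real_of_int a - 1/2 < 0 \<longleftrightarrow> a \<le> 0" for a
    by linarith+
  have pos: "0 < Im (cpos m') * Im (cpos m'') \<longleftrightarrow> (1 \<le> snd m' \<longleftrightarrow> 1 \<le> snd m'')" for m' m''
    unfolding Im_cpos zero_less_mult_iff sgn by linarith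
  have cn: "cpos (m + \<rho>) = cnj (cpos m) \<longleftrightarrow> fst \<rho> = 0 \<and> 2 * j + snd \<rho> = 1"
  proof -
    have "real_of_int j + real_of_int (snd \<rho>) - 1/2 = - (real_of_int j - 1/2) \<longleftrightarrow>
        real_of_int (2 * j + snd \<rho>) = real_of_int 1" by auto
    then show ?thesis
      by (simp only: complex_eq_iff Re_cpos Im_cpos complex_cnj of_int_eq_iff m cnj.simps fst_add
          snd_add fst_conv snd_conv of_int_add) auto
  qed
  have re: "0 < Re (cpos m) \<longleftrightarrow> 1 \<le> i" "Re (cpos m) < 0 \<longleftrightarrow> i \<le> 0"
    unfolding Re_cpos m by (simp_all only: sgn fst_conv)
  from assms show ?thesis
    unfolding pos cn re nn_at_def Gamma_iff by (cases rule: nn_cases) (auto simp: m nn_def e1_def e2_def)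
qed

text \<open>The value at the neighbour of the branch of the square root continued from \<open>m\<close>. Across
  the crack it is minus the principal value at the mirror point, whose imaginary part equals
  that at \<open>m\<close>: the predictor extends evenly through the crack, so a removed bond may be
  reinstated with zero difference.\<close>

definition branch_root :: "index \<Rightarrow> index \<Rightarrow> complex" where
  "branch_root m \<rho> = (if \<rho> \<in> nn_at m then csqrt (cpos (m + \<rho>)) else - csqrt (cpos (m + \<rho>)))"

lemma branch_root_square: "(branch_root m \<rho>)\<^sup>2 = cpos m + cdir \<rho>"
  by (simp add: branch_root_def cpos_add)

lemma csqrt_cnj_cpos: "csqrt (cnj (cpos m)) = cnj (csqrt (cpos m))"
  using Im_cpos_nonzero[of m] by (intro cnj_csqrt[symmetric]) (auto simp: complex_nonpos_Reals_iff)

lemma branch_root_Im: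
  assumes "\<rho> \<in> nn"
  shows "Im (branch_root m \<rho> - csqrt (cpos m)) = Dgrad (u_hat 1) m \<rho>"
proof (cases "\<rho> \<in> nn_at m")
  case True
  then show ?thesis by (simp add: branch_root_def Dgrad_def u_hat_eq_csqrt)
next
  case False
  then have "cpos (m + \<rho>) = cnj (cpos m)" using neighbour_position[OF assms, of m] by auto
  then show ?thesis using False by (simp add: branch_root_def Dgrad_def csqrt_cnj_cpos)
qed

text \<open>This says that the quotient of the two roots has nonnegative real part, so it is the branch to
  which the expansion of \<open>sqrt (1 + w)\<close> applies.\<close>

lemma branch_root_same_side:
  assumes "\<rho> \<in> nn"
  shows "0 \<le> Re (branch_root m \<rho> * cnj (csqrt (cpos m)))"
proof -
  consider "\<rho> \<in> nn_at m" "0 < Im (cpos m) * Im (cpos (m + \<rho>))"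
    | "cpos (m + \<rho>) = cnj (cpos m)" "if \<rho> \<in> nn_at m then 0 < Re (cpos m) else Re (cpos m) < 0"
    using neighbour_position[OF assms, of m] by blast
  then show ?thesis
  proof cases
    case 1
    then have "sgn (Im (cpos m)) * sgn (Im (cpos (m + \<rho>))) = 1"
      by (metis sgn_mult sgn_pos)
    moreover have sq: "sqrt ((cmod z - Re z) / 2) \<ge> 0" for z
      using complex_Re_le_cmod[of z] by simp
    moreover have I: "Im (csqrt z) = sgn (Im z) * sqrt ((cmod z - Re z) / 2)" if "Im z \<noteq> 0" for z
      using that by (simp add: csqrt.simps)
    ultimately have "0 \<le> Im (csqrt (cpos m)) * Im (csqrt (cpos (m + \<rho>)))"
      unfolding I[OF Im_cpos_nonzero]
      by (metis mult.assoc mult.left_commute mult_1 mult_nonneg_nonneg)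
    then show ?thesis
      using 1 Re_csqrt[of "cpos m"] Re_csqrt[of "cpos (m + \<rho>)"]
      by (simp add: branch_root_def mult.commute)
  next
    case 2
    have "Re (cnj (csqrt (cpos m)) * cnj (csqrt (cpos m))) = Re ((csqrt (cpos m))\<^sup>2)"
      by (simp add: power2_eq_square)
    also have "\<dots> = Re (cpos m)" by (simp only: power2_csqrt)
    finally have R: "Re (cnj (csqrt (cpos m)) * cnj (csqrt (cpos m))) = Re (cpos m)" .
    show ?thesis
      using 2(2) R unfolding branch_root_def 2(1) csqrt_cnj_cpos by (auto split: if_splits)
  qed
qed

lemma cmod_cdir: "\<rho> \<in> nn \<Longrightarrow> cmod (cdir \<rho>) = 1"
  by (auto simp: nn_def e1_def e2_def cdir_def cmod_def)

text \<open>From \<open>(b - a) (b + a) = b\<^sup>2 - a\<^sup>2\<close>, which has modulus one, and \<open>\<bar>b + a\<bar> \<ge> \<bar>a\<bar>\<close>, as the two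
  roots enclose an angle of at most \<open>\<pi>/2\<close>.\<close>

lemma branch_root_increment:
  assumes "\<rho> \<in> nn"
  shows "cmod (branch_root m \<rho> - csqrt (cpos m)) \<le> 1 / sqrt (cmod (cpos m))"
proof -
  let ?a = "csqrt (cpos m)" and ?b = "branch_root m \<rho>"
  have "(?b - ?a) * (?b + ?a) = ?b\<^sup>2 - ?a\<^sup>2" by (simp add: power2_eq_square algebra_simps)
  also have "\<dots> = cdir \<rho>" by (simp only: branch_root_square power2_csqrt) simp
  finally have p: "cmod (?b - ?a) * cmod (?b + ?a) = 1"
    using cmod_cdir[OF assms] by (metis norm_mult)
  have "(cmod ?a)\<^sup>2 \<le> (cmod (?b + ?a))\<^sup>2"
    using branch_root_same_side[OF assms, of m]
    unfolding cmod_power2 by (simp add: power2_eq_square algebra_simps)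
  then have "sqrt (cmod (cpos m)) \<le> cmod (?b + ?a)"
    by (metis norm_csqrt norm_ge_zero power2_le_imp_le)
  then have "cmod (?b - ?a) * sqrt (cmod (cpos m)) \<le> cmod (?b - ?a) * cmod (?b + ?a)"
    by (intro mult_left_mono) auto
  then show ?thesis using p cpos_nonzero[of m] by (simp add: pos_le_divide_eq)
qed

lemma predictor_gradient_bound:
  "(Dgrad (u_hat 1) m \<rho>)\<^sup>2 \<le> 6 / lattice_weight m"
proof (cases "\<rho> \<in> nn")
  case True
  let ?r = "cmod (cpos m)"
  have "\<bar>Dgrad (u_hat 1) m \<rho>\<bar> \<le> 1 / sqrt ?r"
    using branch_root_increment[OF True, of m] abs_Im_le_cmod order_trans
    unfolding branch_root_Im[OF True, symmetric] by blast
  then have "\<bar>Dgrad (u_hat 1) m \<rho>\<bar>\<^sup>2 \<le> (1 / sqrt ?r)\<^sup>2" by (intro power_mono) auto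
  also have "\<dots> = 1 / ?r" by (simp add: power_divide)
  also have "\<dots> \<le> 6 / lattice_weight m"
    using lattice_weight_le[of m] lattice_weight_ge_1[of m] cpos_nonzero[of m] by (simp add: field_simps)
  finally show ?thesis by simp
next
  case False
  then show ?thesis using lattice_weight_ge_1[of m] by (simp add: Dgrad_outside)
qed

definition predictor_residual :: "index \<Rightarrow> real" where
  "predictor_residual m = (\<Sum>\<rho>\<in>nn. Dgrad (u_hat 1) m \<rho>)"

text \<open>The four neighbours lie at \<open>z + i\<^sup>k\<close>, and the sums of the first three powers of the
  fourth roots of unity vanish, so the expansion of the square root leaves only the fourth-order
  remainder.\<close>

lemma predictor_residual_bound:
  "\<bar>predictor_residual m\<bar> \<le> 4 * sqrt (cmod (cpos m)) / cmod (cpos m) ^ 4"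
proof -
  let ?z = "cpos m" and ?a = "csqrt (cpos m)"
  let ?r = "cmod ?z" and ?b = "branch_root m"
  have r: "?r > 0" using cpos_nonzero by simp
  have nn4: "(\<Sum>\<rho>\<in>nn. f \<rho>) = f (1, 0) + f (0, 1) + f (-1, 0) + f (0, -1)"
    for f :: "index \<Rightarrow> 'c::comm_monoid_add"
    by (simp add: nn_def e1_def e2_def add.assoc)
  have "predictor_residual m = Im (\<Sum>\<rho>\<in>nn. ?b \<rho> - ?a)"
    unfolding predictor_residual_def by (simp add: branch_root_Im[symmetric])
  then have le: "\<bar>predictor_residual m\<bar> \<le> cmod (\<Sum>\<rho>\<in>nn. ?b \<rho> - ?a)"
    by (simp only: abs_Im_le_cmod)
  have card: "card nn = 4" by (simp add: nn_def e1_def e2_def)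
  show ?thesis
  proof (cases "1 \<le> ?r")
    case False
    have "cmod (\<Sum>\<rho>\<in>nn. ?b \<rho> - ?a) \<le> (\<Sum>\<rho>\<in>nn. 1 / sqrt ?r)"
      by (rule order_trans[OF norm_sum sum_mono]) (rule branch_root_increment)
    also have "\<dots> = 4 * sqrt ?r / ?r"
      using r by (simp add: card field_simps)
    also have "\<dots> \<le> 4 * sqrt ?r / ?r ^ 4"
    proof (rule divide_left_mono)
      show "?r ^ 4 \<le> ?r" using power_decreasing[of 1 4 ?r] False r by simp
    qed (use r in auto)
    finally show ?thesis using le by linarith
  next
    case True
    let ?w = "\<lambda>\<rho>. cdir \<rho> / ?z"
    let ?p = "\<lambda>w :: complex. 1 + w/2 - w^2/8 + w^3/16"
    have a0: "?a \<noteq> 0" using cpos_nonzero by (simp)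
    have est: "cmod (?b \<rho> / ?a - ?p (?w \<rho>)) \<le> 1 / ?r ^ 4" if \<rho>: "\<rho> \<in> nn" for \<rho>
    proof -
      have A: "(?b \<rho> / ?a)\<^sup>2 = 1 + ?w \<rho>"
        using cpos_nonzero[of m] unfolding power_divide branch_root_square power2_csqrt
        by (simp add: add_divide_distrib)
      have P: "0 \<le> Re (?b \<rho> / ?a)"
        using branch_root_same_side[OF \<rho>, of m] by (simp add: complex_div_cnj[of "?b \<rho>" ?a] Re_divide_of_real)
      have C: "cmod (?w \<rho>) = 1 / ?r" using cmod_cdir[OF \<rho>] by (simp add: norm_divide)
      have "cmod (?w \<rho>) \<le> 1" unfolding C using True r by (simp add: divide_le_eq)
      from sqrt_third_order_expansion[OF A P this] show ?thesis
        unfolding C by (simp only: power_one_over)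
    qed
    have "(\<Sum>\<rho>\<in>nn. ?p (?w \<rho>) - 1) = 0"
    proof -
      \<comment> \<open>The steps are the fourth roots of unity.\<close>
      have c: "cdir (1, 0) = 1" "cdir (0, 1) = \<i>" "cdir (-1, 0) = -1" "cdir (0, -1) = -\<i>"
        by (simp_all add: cdir_def complex_eq_iff)
      show ?thesis unfolding nn4 c by (simp add: power_divide power2_eq_square power3_eq_cube)
    qed
    then have "(\<Sum>\<rho>\<in>nn. ?b \<rho> - ?a) = ?a * (\<Sum>\<rho>\<in>nn. (?b \<rho> / ?a - 1) - (?p (?w \<rho>) - 1))"
      using a0 unfolding sum_subtractf[of "\<lambda>\<rho>. ?b \<rho> / ?a - 1"] by (simp add: sum_distrib_left right_diff_distrib)
    also have "cmod \<dots> \<le> sqrt ?r * (\<Sum>\<rho>\<in>nn. 1 / ?r ^ 4)"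
      unfolding norm_mult norm_csqrt
    proof (rule mult_left_mono)
      have "cmod (\<Sum>\<rho>\<in>nn. (?b \<rho> / ?a - 1) - (?p (?w \<rho>) - 1)) \<le> (\<Sum>\<rho>\<in>nn. cmod (?b \<rho> / ?a - ?p (?w \<rho>)))"
        by (rule order_trans[OF norm_sum]) (simp add: algebra_simps)
      also have "\<dots> \<le> (\<Sum>\<rho>\<in>nn. 1 / ?r ^ 4)" by (rule sum_mono) (rule est)
      finally show "cmod (\<Sum>\<rho>\<in>nn. (?b \<rho> / ?a - 1) - (?p (?w \<rho>) - 1)) \<le> (\<Sum>\<rho>\<in>nn. 1 / ?r ^ 4)" .
    qed simp
    also have "\<dots> = 4 * sqrt ?r / ?r ^ 4" by (simp add: card)
    finally show ?thesis using le by linarith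
  qed
qed

text \<open>The factor \<open>sqrt\<close> of the weight is the growth of functions of the space, so that the residual
  can be paired with them.\<close>

lemma predictor_residual_weighted:
  "\<bar>predictor_residual m\<bar> * sqrt (lattice_weight m) \<le> 5184 / lattice_weight m ^ 3"
proof (rule power2_le_imp_le)
  let ?r = "cmod (cpos m)" and ?w = "lattice_weight m"
  have r: "?r > 0" using cpos_nonzero by simp
  have w: "?w \<ge> 1" by (rule lattice_weight_ge_1)
  show "0 \<le> 5184 / ?w ^ 3" using w by simp
  have "\<bar>predictor_residual m\<bar>\<^sup>2 \<le> (4 * sqrt ?r / ?r ^ 4)\<^sup>2"
    using predictor_residual_bound by (intro power_mono) auto
  also have "\<dots> = 16 * (1 / ?r) ^ 7"
    using r by (simp add: power_divide power_mult_distrib field_simps flip: power_mult power_Suc)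
  also have "\<dots> \<le> 16 * (6 / ?w) ^ 7"
    using lattice_weight_le[of m] w r by (intro mult_left_mono power_mono) (auto simp: field_simps)
  finally have "\<bar>predictor_residual m\<bar>\<^sup>2 * ?w \<le> 16 * (6 / ?w) ^ 7 * ?w"
    using w by (intro mult_right_mono) auto
  also have "\<dots> = (16 * 6 ^ 7) / ?w ^ 6"
    using w by (simp add: power_divide field_simps flip: power_Suc)
  also have "\<dots> \<le> (5184 / ?w ^ 3)\<^sup>2"
    using w by (simp add: power_divide divide_right_mono flip: power_mult)
  finally show "(\<bar>predictor_residual m\<bar> * sqrt ?w)\<^sup>2 \<le> (5184 / ?w ^ 3)\<^sup>2"
    using w by (simp add: power_mult_distrib)
qed

text \<open>The weight dominates \<open>1 + \<bar>i\<bar>\<close> and \<open>1 + \<bar>j\<bar>\<close>, so the summand is at most a product of two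
  one-dimensional summands with exponent \<open>-3/2\<close>.\<close>

lemma summable_inverse_weight_cubed: "(\<lambda>m. 1 / lattice_weight m ^ 3) summable_on UNIV"
proof -
  let ?a = "\<lambda>i :: int. (1 + \<bar>real_of_int i\<bar>) powr (-3/2)"
  have "summable (\<lambda>n. real (Suc n) powr (-3/2))"
    using summable_Suc_iff[of "\<lambda>n. real n powr (-3/2)"] summable_real_powr_iff[of "-3/2"] by simp
  then have nat: "(\<lambda>n. real (Suc n) powr (-3/2)) summable_on UNIV"
    by (intro norm_summable_imp_summable_on) simp
  have "?a summable_on range int"
    using nat by (subst summable_on_reindex) (auto simp: o_def add.commute)
  moreover have "?a summable_on range (\<lambda>n. - int n)"
    using nat by (subst summable_on_reindex) (auto simp: o_def add.commute inj_on_def)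
  ultimately have "?a summable_on range int \<union> range (\<lambda>n. - int n)"
    by (rule summable_on_union)
  moreover have "i \<in> range int \<union> range (\<lambda>n. - int n)" for i
    by (cases i rule: int_cases2) auto
  then have "range int \<union> range (\<lambda>n. - int n) = UNIV" by blast
  ultimately have a: "?a summable_on UNIV" by simp
  have "((\<lambda>m. ?a (fst m) * ?a (snd m))) summable_on (UNIV \<times> UNIV)"
  proof (rule summable_on_SigmaI)
    show "((\<lambda>j. ?a (fst (i, j)) * ?a (snd (i, j))) has_sum ?a i * infsum ?a UNIV) UNIV" for i
      using has_sum_cmult_right[OF has_sum_infsum[OF a], of "?a i"] by simp
    show "(\<lambda>i. ?a i * infsum ?a UNIV) summable_on UNIV" by (intro summable_on_cmult_left a)
  qed auto
  then have "(\<lambda>m. ?a (fst m) * ?a (snd m)) summable_on UNIV" by simp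
  then show ?thesis
  proof (rule summable_on_real_bound)
    fix m
    have w: "lattice_weight m \<ge> 1" by (rule lattice_weight_ge_1)
    have "1 / lattice_weight m ^ 3 = lattice_weight m powr (-3/2) * lattice_weight m powr (-3/2)"
      using w by (simp add: powr_minus_divide powr_realpow flip: powr_add)
    also have "\<dots> \<le> ?a (fst m) * ?a (snd m)"
      by (intro mult_mono powr_mono2') (auto simp: lattice_weight_def)
    finally show "\<bar>1 / lattice_weight m ^ 3\<bar> \<le> ?a (fst m) * ?a (snd m)" using w by simp
  qed
qed

definition predictor_gradient :: "index \<times> index \<Rightarrow> real" where
  "predictor_gradient = bond_gradient (u_hat 1)"

lemma predictor_gradient_le: "\<bar>predictor_gradient p\<bar> \<le> 3"
proof -
  have "(predictor_gradient p)\<^sup>2 \<le> 6 / lattice_weight (fst p)"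
    unfolding predictor_gradient_def bond_gradient_def by (rule predictor_gradient_bound)
  also have "\<dots> \<le> 3\<^sup>2" using lattice_weight_ge_1[of "fst p"] by (simp add: divide_le_eq)
  finally show ?thesis by (metis abs_le_square_iff abs_numeral)
qed

lemma predictor_gradient_cubed_summable: "(\<lambda>p. (predictor_gradient p ^ 3)\<^sup>2) summable_on UNIV"
proof -
  have "(\<lambda>m. 216 * (1 / lattice_weight m ^ 3)) summable_on UNIV"
    by (intro summable_on_cmult_right summable_inverse_weight_cubed)
  then have "(\<lambda>m. real (card nn) * (216 * (1 / lattice_weight m ^ 3))) summable_on UNIV"
    by (rule summable_on_cmult_right)
  then have "(\<lambda>p. if snd p \<in> nn then 216 * (1 / lattice_weight (fst p) ^ 3) else 0) summable_on (UNIV \<times> UNIV)"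
  proof (rule summable_on_SigmaI[rotated])
    show "((\<lambda>\<rho>. if snd (m, \<rho>) \<in> nn then 216 * (1 / lattice_weight (fst (m, \<rho>)) ^ 3) else 0)
        has_sum real (card nn) * (216 * (1 / lattice_weight m ^ 3))) UNIV" for m :: index
      by (rule has_sum_finite_neutralI[where B = nn]) auto
    show "0 \<le> (if snd (m, \<rho>) \<in> nn then 216 * (1 / lattice_weight (fst (m, \<rho>)) ^ 3) else 0)" for m \<rho> :: index
      using lattice_weight_ge_1[of m] by simp
  qed
  then have "(\<lambda>p. if snd p \<in> nn then 216 * (1 / lattice_weight (fst p) ^ 3) else 0) summable_on UNIV"
    by simp
  then show ?thesis
  proof (rule summable_on_real_bound)
    fix p :: "index \<times> index"
    show "\<bar>(predictor_gradient p ^ 3)\<^sup>2\<bar> \<le> (if snd p \<in> nn then 216 * (1 / lattice_weight (fst p) ^ 3) else 0)"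
    proof (cases "snd p \<in> nn")
      case True
      have "((predictor_gradient p)\<^sup>2) ^ 3 \<le> (6 / lattice_weight (fst p)) ^ 3"
        unfolding predictor_gradient_def bond_gradient_def
        by (intro power_mono predictor_gradient_bound) simp
      then show ?thesis using True by (simp add: power_divide flip: power_mult)
    next
      case False
      then show ?thesis by (simp add: predictor_gradient_def bond_gradient_def Dgrad_outside)
    qed
  qed
qed

text \<open>The bounded extension of \<open>u \<mapsto> \<Sum> \<alpha> b\<close>. The factor \<open>-2\<close> arises because every bond is counted
  once from each of its endpoints.\<close>

definition predictor_load :: "hdot1 \<Rightarrow> real" where
  "predictor_load u = - 2 * (\<Sum>\<^sub>\<infinity>m. predictor_residual m * lattice_fun u m)"

lemma residual_times_function:
  "\<bar>predictor_residual m * lattice_fun u m\<bar> \<le> (10368 * norm u) * (1 / lattice_weight m ^ 3)"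
proof -
  have "\<bar>predictor_residual m * lattice_fun u m\<bar>
      \<le> \<bar>predictor_residual m\<bar> * (2 * sqrt (lattice_weight m) * norm u)"
    unfolding abs_mult by (intro mult_left_mono pointwise_bound) simp
  also have "\<dots> = (2 * norm u) * (\<bar>predictor_residual m\<bar> * sqrt (lattice_weight m))" by simp
  also have "\<dots> \<le> (2 * norm u) * (5184 / lattice_weight m ^ 3)"
    by (intro mult_left_mono predictor_residual_weighted) simp
  finally show ?thesis by simp
qed

lemma residual_summable: "(\<lambda>m. predictor_residual m * lattice_fun u m) summable_on UNIV"
  by (rule summable_on_real_bound[OF summable_on_cmult_right[OF summable_inverse_weight_cubed]])
     (rule residual_times_function)

lemma bounded_linear_predictor_load: "bounded_linear predictor_load"
proof (rule bounded_linear_intro)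
  fix u v :: hdot1 and r :: real
  show "predictor_load (u + v) = predictor_load u + predictor_load v"
    using infsum_add[OF residual_summable[of u] residual_summable[of v]]
    by (simp add: predictor_load_def plus_hdot1.rep_eq distrib_left)
  show "predictor_load (r *\<^sub>R u) = r *\<^sub>R predictor_load u"
    using infsum_cmult_right[OF residual_summable[of u], of r]
    by (simp add: predictor_load_def scaleR_hdot1.rep_eq mult.left_commute)
  let ?S = "\<Sum>\<^sub>\<infinity>m. 1 / lattice_weight m ^ 3"
  have "norm (\<Sum>\<^sub>\<infinity>m. predictor_residual m * lattice_fun u m) \<le> (10368 * norm u) * ?S"
    by (rule norm_infsum_le[OF has_sum_infsum[OF residual_summable]
          has_sum_cmult_right[OF has_sum_infsum[OF summable_inverse_weight_cubed]]])
       (use residual_times_function in simp)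
  then show "norm (predictor_load u) \<le> norm u * (20736 * ?S)"
    by (simp add: predictor_load_def abs_mult)
qed

lemma nn_at_reverse: "- \<rho> \<in> nn_at (m + \<rho>) \<longleftrightarrow> \<rho> \<in> nn_at m"
proof -
  have "- \<rho> \<in> nn_at (m + \<rho>)" if "\<rho> \<in> nn_at m" for \<rho> m
  proof -
    from that have "\<rho> \<in> nn" using nn_at_subset by blast
    then show ?thesis
      using that by (cases rule: nn_cases) (auto simp: nn_at_def nn_def e1_def e2_def Gamma_iff split: if_splits)
  qed
  from this[of \<rho> m] this[of "- \<rho>" "m + \<rho>"] show ?thesis by auto
qed

lemma bond_gradient_reverse: "bond_gradient v (m + \<rho>, - \<rho>) = - bond_gradient v (m, \<rho>)"
  by (simp add: bond_gradient_def Dgrad_def nn_at_reverse)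

text \<open>Summation by parts: reversing every bond pairs its two endpoints.\<close>

lemma predictor_load_finite_support:
  assumes fin: "finite_support u"
  shows "((\<lambda>p. predictor_gradient p * bond u p) has_sum predictor_load u) UNIV"
proof -
  let ?S = "{m. lattice_fun u m \<noteq> 0}"
  define f where "f p = predictor_gradient p * lattice_fun u (fst p)" for p
  have z: "predictor_gradient (m, \<rho>) = 0" if "\<rho> \<notin> nn" for m \<rho>
    using that by (simp add: predictor_gradient_def bond_gradient_def Dgrad_outside)
  have "(f has_sum sum f (?S \<times> nn)) UNIV"
    by (rule has_sum_finite_neutralI) (use fin z in \<open>auto simp: f_def finite_support_def\<close>)
  then have sf: "f summable_on UNIV" by (rule has_sum_imp_summable)
  have "((\<lambda>m. \<Sum>\<rho>\<in>nn. f (m, \<rho>)) has_sum infsum f UNIV) UNIV"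
    by (rule has_sum_bonds[OF sf]) (simp add: f_def z)
  moreover have "(\<Sum>\<rho>\<in>nn. f (m, \<rho>)) = predictor_residual m * lattice_fun u m" for m
    by (simp add: f_def predictor_residual_def predictor_gradient_def bond_gradient_def sum_distrib_right)
  ultimately have L: "predictor_load u = - infsum f UNIV - infsum f UNIV"
    by (simp add: predictor_load_def infsumI)
  define \<tau> :: "index \<times> index \<Rightarrow> index \<times> index" where "\<tau> p = (fst p + snd p, - snd p)" for p
  have "bij \<tau>" by (rule involuntory_imp_bij) (simp add: \<tau>_def)
  then have "((\<lambda>p. f (\<tau> p)) has_sum infsum f UNIV) UNIV"
    using has_sum_infsum[OF sf] by (subst has_sum_reindex_bij_betw)
  then have "((\<lambda>p. - f (\<tau> p) - f p) has_sum predictor_load u) UNIV"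
    unfolding L by (intro has_sum_diff_real has_sum_infsum sf) (simp add: has_sum_uminus)
  moreover have "- f (\<tau> p) - f p = predictor_gradient p * bond u p" for p
  proof -
    obtain m \<rho> where Pair: "p = (m, \<rho>)" by (cases p)
    show ?thesis
      by (simp add: Pair \<tau>_def f_def predictor_gradient_def bond_gradient_reverse bond_def)
         (simp add: bond_gradient_def Dgrad_def algebra_simps)
  qed
  ultimately show ?thesis by simp
qed


section \<open>The energy difference\<close>

text \<open>With \<open>c = 1\<close> and \<open>c = -1\<close>: derivatives of even functions are odd and conversely.\<close>

lemma derivative_parity:
  fixes f f' :: "real \<Rightarrow> real"
  assumes "\<And>t. (f has_real_derivative f' t) (at t)" and "\<And>t. f (- t) = c * f t"
  shows "f' (- t) = (- c) * f' t"
proof -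
  have "((\<lambda>t. f (- t)) has_real_derivative - f' (- t)) (at t)"
    using assms(1)[of "- t"] by (simp add: DERIV_mirror)
  moreover have "((\<lambda>t. f (- t)) has_real_derivative c * f' t) (at t)"
    unfolding assms(2) using assms(1)[of t] by (intro DERIV_cmult)
  ultimately have "- f' (- t) = c * f' t" by (rule DERIV_unique)
  then show ?thesis by linarith
qed

text \<open>The mean value theorem in the first argument, and then in the second.\<close>

lemma double_difference_bound:
  fixes f f' f'' :: "real \<Rightarrow> real"
  assumes f: "\<And>t. (f has_real_derivative f' t) (at t)" "\<And>t. (f' has_real_derivative f'' t) (at t)"
    and s: "\<bar>s\<bar> \<le> A" "\<bar>s'\<bar> \<le> A" and x: "\<bar>x\<bar> \<le> X" "\<bar>y\<bar> \<le> X"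
    and C: "\<And>t. \<bar>t\<bar> \<le> A + X \<Longrightarrow> \<bar>f'' t\<bar> \<le> C"
  shows "\<bar>(f (s + x) - f (s + y)) - (f (s' + x) - f (s' + y))\<bar> \<le> C * \<bar>s - s'\<bar> * \<bar>x - y\<bar>"
proof -
  let ?h = "\<lambda>t. f (t + x) - f (t + y)"
  have "(?h has_real_derivative f' (t + x) - f' (t + y)) (at t)" for t
    by (intro DERIV_diff DERIV_shift[THEN iffD1] f(1))
  then obtain \<xi> where \<xi>: "?h (s' + (s - s')) - ?h s' = (s - s') * (f' (\<xi> + x) - f' (\<xi> + y))"
    "min s' (s' + (s - s')) \<le> \<xi>" "\<xi> \<le> max s' (s' + (s - s'))"
    using mvt_increment[of ?h "\<lambda>t. f' (t + x) - f' (t + y)" s' "s - s'"] by blast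
  then have \<xi>A: "\<bar>\<xi>\<bar> \<le> A" using s by (auto simp: min_def max_def split: if_splits)
  obtain \<zeta> where \<zeta>: "f' (\<xi> + y + (x - y)) - f' (\<xi> + y) = (x - y) * f'' \<zeta>"
    "min (\<xi> + y) (\<xi> + y + (x - y)) \<le> \<zeta>" "\<zeta> \<le> max (\<xi> + y) (\<xi> + y + (x - y))"
    using mvt_increment[of f' f'' "\<xi> + y" "x - y"] f(2) by blast
  then have "\<bar>\<zeta>\<bar> \<le> A + X" using \<xi>A x by (auto simp: min_def max_def split: if_splits)
  then have "\<bar>f'' \<zeta>\<bar> \<le> C" by (rule C)
  moreover have "(f (s + x) - f (s + y)) - (f (s' + x) - f (s' + y)) = ((s - s') * (x - y)) * f'' \<zeta>"
    using \<xi>(1) \<zeta>(1) by simp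
  ultimately show ?thesis
    by (simp only: abs_mult) (simp add: mult_left_mono mult.commute[of C] mult.assoc)
qed

locale smooth_potential =
  fixes \<phi> :: "real \<Rightarrow> real" and k :: nat
  assumes k5: "5 \<le> k" and C_k: "C_k_real k \<phi>" and \<phi>0: "\<phi> 0 = 0"
    and even: "\<And>r. \<phi> (- r) = \<phi> r" and stiffness: "(deriv ^^ 2) \<phi> 0 = 1"
begin

abbreviation D :: "nat \<Rightarrow> real \<Rightarrow> real" where
  "D j \<equiv> (deriv ^^ j) \<phi>"

lemma D_deriv:
  assumes "j < k"
  shows "(D j has_real_derivative D (Suc j) t) (at t)"
proof -
  have "D j differentiable (at t)"
    using C_k assms by (simp add: C_k_real_def differentiable_on_def)
  then show ?thesis by (simp add: DERIV_deriv_iff_real_differentiable)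
qed

lemma D_deriv_low:
  "(\<phi> has_real_derivative D 1 t) (at t)" "(D 1 has_real_derivative D 2 t) (at t)"
  "(D 2 has_real_derivative D 3 t) (at t)" "(D 3 has_real_derivative D 4 t) (at t)"
  using D_deriv[of 0 t] D_deriv[of 1 t] D_deriv[of 2 t] D_deriv[of 3 t] k5
  by (simp_all add: eval_nat_numeral)

lemma D_continuous:
  assumes "j \<le> k"
  shows "continuous_on S (D j)"
proof (cases "j = k")
  case True
  then show ?thesis using C_k by (auto simp: C_k_real_def intro: continuous_on_subset)
next
  case False
  then have "isCont (D j) t" for t using D_deriv[of j t] assms by (auto intro: DERIV_isCont)
  then show ?thesis by (simp add: continuous_at_imp_continuous_on)
qed

lemma D_bounded:
  assumes "j \<le> k"
  obtains C where "0 \<le> C" "\<And>t. \<bar>t\<bar> \<le> R \<Longrightarrow> \<bar>D j t\<bar> \<le> C"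
proof -
  have "compact (D j ` {-R..R})" by (intro compact_continuous_image D_continuous assms) simp
  then obtain C where C: "\<And>y. y \<in> D j ` {-R..R} \<Longrightarrow> norm y \<le> C"
    using compact_imp_bounded bounded_iff by metis
  have "\<bar>D j t\<bar> \<le> max 0 C" if "\<bar>t\<bar> \<le> R" for t
  proof -
    have "t \<in> {-R..R}" using that by auto
    then show ?thesis using C[of "D j t"] by auto
  qed
  then show ?thesis by (intro that[of "max 0 C"]) auto
qed

lemma D_uniform:
  assumes "j \<le> k" "0 < e"
  obtains d where "0 < d" "\<And>s t. \<bar>s\<bar> \<le> R \<Longrightarrow> \<bar>t\<bar> \<le> R \<Longrightarrow> \<bar>s - t\<bar> < d \<Longrightarrow> \<bar>D j s - D j t\<bar> \<le> e"
proof -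
  have "uniformly_continuous_on {-R..R} (D j)"
    by (intro compact_uniformly_continuous D_continuous assms) simp
  then obtain d where d: "0 < d"
    "\<And>s t. s \<in> {-R..R} \<Longrightarrow> t \<in> {-R..R} \<Longrightarrow> dist s t < d \<Longrightarrow> dist (D j s) (D j t) < e"
    using assms(2) unfolding uniformly_continuous_on_def by metis
  have "\<bar>D j s - D j t\<bar> \<le> e" if "\<bar>s\<bar> \<le> R" "\<bar>t\<bar> \<le> R" "\<bar>s - t\<bar> < d" for s t
    using d(2)[of s t] that by (auto simp: dist_real_def abs_le_iff)
  then show ?thesis by (rule that[OF d(1)])
qed

lemma D_odd_zero: "D 1 0 = 0" "D 3 0 = 0"
proof -
  have 1: "D 1 (- t) = - 1 * D 1 t" for t
    using derivative_parity[of \<phi> "D 1" 1 t] D_deriv_low(1) even by simp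
  have 2: "D 2 (- t) = 1 * D 2 t" for t
    using derivative_parity[of "D 1" "D 2" "-1" t] D_deriv_low(2) 1 by simp
  have 3: "D 3 (- t) = - 1 * D 3 t" for t
    using derivative_parity[of "D 2" "D 3" 1 t] D_deriv_low(3) 2 by simp
  show "D 1 0 = 0" "D 3 0 = 0" using 1[of 0] 3[of 0] by simp_all
qed

text \<open>Evenness removes the cubic term of the potential, so that the stress differs from the
  linear one only at third order.\<close>

lemma anharmonic_bounds:
  obtains M where "0 \<le> M" "\<And>t. \<bar>t\<bar> \<le> R \<Longrightarrow> \<bar>D 2 t - 1\<bar> \<le> M * t\<^sup>2"
    "\<And>t. \<bar>t\<bar> \<le> R \<Longrightarrow> \<bar>D 1 t - t\<bar> \<le> M * \<bar>t\<bar> ^ 3"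
proof -
  obtain M where M: "0 \<le> M" "\<And>t. \<bar>t\<bar> \<le> R \<Longrightarrow> \<bar>D 4 t\<bar> \<le> M"
    using D_bounded[of 4 R] k5 by auto
  have step: "\<bar>f t\<bar> \<le> M * \<bar>t\<bar> ^ Suc n"
    if f: "\<And>t. (f has_real_derivative f' t) (at t)" and f0: "f 0 = 0"
      and f': "\<And>t. \<bar>t\<bar> \<le> R \<Longrightarrow> \<bar>f' t\<bar> \<le> M * \<bar>t\<bar> ^ n" and t: "\<bar>t\<bar> \<le> R" for f f' :: "real \<Rightarrow> real" and n t
  proof -
    obtain \<xi> where \<xi>: "f (0 + t) - f 0 = t * f' \<xi>" "\<bar>\<xi> - 0\<bar> \<le> \<bar>t\<bar>"
      using mvt_increment[of f f' 0 t] f by blast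
    have "\<bar>f' \<xi>\<bar> \<le> M * \<bar>\<xi>\<bar> ^ n" using \<xi>(2) t by (intro f') auto
    also have "\<dots> \<le> M * \<bar>t\<bar> ^ n" using \<xi>(2) M(1) by (intro mult_left_mono power_mono) auto
    finally have "\<bar>t\<bar> * \<bar>f' \<xi>\<bar> \<le> \<bar>t\<bar> * (M * \<bar>t\<bar> ^ n)" by (rule mult_left_mono) simp
    then show ?thesis using \<xi>(1) f0 by (simp add: abs_mult mult_ac)
  qed
  have 3: "\<bar>D 3 t\<bar> \<le> M * \<bar>t\<bar> ^ Suc 0" if "\<bar>t\<bar> \<le> R" for t
    by (rule step[of "D 3" "D 4"]) (use D_deriv_low D_odd_zero M that in auto)
  have 2: "\<bar>D 2 t - 1\<bar> \<le> M * \<bar>t\<bar> ^ Suc (Suc 0)" if "\<bar>t\<bar> \<le> R" for t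
  proof (rule step[of "\<lambda>t. D 2 t - 1" "D 3", OF _ _ 3 that])
    show "((\<lambda>t. D 2 t - 1) has_real_derivative D 3 t) (at t)" for t
      using DERIV_diff[OF D_deriv_low(3)[of t] DERIV_const[of 1]] by simp
  qed (simp add: stiffness)
  have 1: "\<bar>D 1 t - t\<bar> \<le> M * \<bar>t\<bar> ^ Suc (Suc (Suc 0))" if "\<bar>t\<bar> \<le> R" for t
  proof (rule step[of "\<lambda>t. D 1 t - t" "\<lambda>t. D 2 t - 1", OF _ _ 2 that])
    show "((\<lambda>t. D 1 t - t) has_real_derivative D 2 t - 1) (at t)" for t
      using DERIV_diff[OF D_deriv_low(2)[of t] DERIV_ident] by simp
  qed (use D_odd_zero in simp)
  show ?thesis
    by (rule that[OF M(1)]) (use 1 2 in \<open>auto simp: power2_eq_square power3_eq_cube mult_ac\<close>)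
qed

text \<open>The contribution of a bond and its derivatives in \<open>t\<close>. The linear term \<open>a * t\<close> is subtracted
  because its sum over the bonds need not converge absolutely.\<close>

definition summand :: "real \<Rightarrow> nat \<Rightarrow> index \<times> index \<Rightarrow> real \<Rightarrow> real" where
  "summand \<epsilon> j p t = (let a = \<epsilon> * predictor_gradient p in
    if j = 0 then \<phi> (a + t) - \<phi> a - a * t else if j = 1 then D 1 (a + t) - a else D j (a + t))"

lemma summand_0: "summand \<epsilon> 0 p t = \<phi> (\<epsilon> * predictor_gradient p + t)
    - \<phi> (\<epsilon> * predictor_gradient p) - \<epsilon> * predictor_gradient p * t"
  and summand_1: "summand \<epsilon> 1 p t = D 1 (\<epsilon> * predictor_gradient p + t) - \<epsilon> * predictor_gradient p"
  and summand_2: "2 \<le> j \<Longrightarrow> summand \<epsilon> j p t = D j (\<epsilon> * predictor_gradient p + t)"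
  by (simp_all add: summand_def Let_def)

lemma scaled_gradient_le: "\<bar>\<epsilon> * predictor_gradient p\<bar> \<le> 3 * \<bar>\<epsilon>\<bar>"
  using mult_left_mono[OF predictor_gradient_le[of p], of "\<bar>\<epsilon>\<bar>"] by (simp add: abs_mult)

sublocale S: superposition bond "summand \<epsilon>" k for \<epsilon>
proof (unfold_locales)
  show "2 \<le> k" using k5 by simp
  show "(summand \<epsilon> j p has_real_derivative summand \<epsilon> (Suc j) p t) (at t)" if "j < k" for j p t
  proof -
    let ?a = "\<epsilon> * predictor_gradient p"
    have sh: "((\<lambda>t. D j (?a + t)) has_real_derivative D (Suc j) (?a + t)) (at t)"
      using D_deriv[OF that, of "?a + t"] DERIV_shift[of "D j" _ t ?a] by (simp add: add.commute)
    consider "j = 0" | "j = 1" | "2 \<le> j" by linarith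
    then show ?thesis
    proof cases
      case 1
      have "((\<lambda>t. \<phi> (?a + t) - \<phi> ?a - ?a * t) has_real_derivative D 1 (?a + t) - 0 - ?a) (at t)"
        using sh 1 by (intro DERIV_diff) (auto intro!: derivative_eq_intros)
      then show ?thesis unfolding 1 by (simp add: summand_def[abs_def] Let_def)
    next
      case 2
      have "((\<lambda>t. D 1 (?a + t) - ?a) has_real_derivative D 2 (?a + t) - 0) (at t)"
        using sh 2 by (intro DERIV_diff) (auto simp: numeral_2_eq_2)
      then show ?thesis unfolding 2 by (simp add: summand_def[abs_def] Let_def numeral_2_eq_2)
    next
      case 3
      then show ?thesis using sh by (simp add: summand_def[abs_def] Let_def)
    qed
  qed
  show "\<exists>C. \<forall>p t. \<bar>t\<bar> \<le> R \<longrightarrow> \<bar>summand \<epsilon> j p t\<bar> \<le> C" if j: "2 \<le> j" "j \<le> k" for j R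
  proof -
    obtain C where C: "\<And>t. \<bar>t\<bar> \<le> 3 * \<bar>\<epsilon>\<bar> + R \<Longrightarrow> \<bar>D j t\<bar> \<le> C" using D_bounded[OF j(2)] by blast
    have "\<bar>summand \<epsilon> j p t\<bar> \<le> C" if "\<bar>t\<bar> \<le> R" for p t
      unfolding summand_2[OF j(1)] using scaled_gradient_le[of \<epsilon> p] that by (intro C) linarith
    then show ?thesis by blast
  qed
  show "\<exists>d>0. \<forall>p s t. \<bar>s\<bar> \<le> R \<longrightarrow> \<bar>t\<bar> \<le> R \<longrightarrow> \<bar>s - t\<bar> < d \<longrightarrow>
      \<bar>summand \<epsilon> j p s - summand \<epsilon> j p t\<bar> \<le> e" if j: "2 \<le> j" "j \<le> k" and e: "0 < e" for j R e
  proof -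
    obtain d where d: "0 < d" "\<And>s t. \<bar>s\<bar> \<le> 3 * \<bar>\<epsilon>\<bar> + R \<Longrightarrow> \<bar>t\<bar> \<le> 3 * \<bar>\<epsilon>\<bar> + R \<Longrightarrow>
        \<bar>s - t\<bar> < d \<Longrightarrow> \<bar>D j s - D j t\<bar> \<le> e" using D_uniform[OF j(2) e] by blast
    have "\<bar>summand \<epsilon> j p s - summand \<epsilon> j p t\<bar> \<le> e"
      if "\<bar>s\<bar> \<le> R" "\<bar>t\<bar> \<le> R" "\<bar>s - t\<bar> < d" for p s t
      unfolding summand_2[OF j(1)] using scaled_gradient_le[of \<epsilon> p] that
      by (intro d(2)) linarith+
    then show ?thesis using d(1) by blast
  qed
  show "summand \<epsilon> 0 p 0 = 0" for p by (simp add: summand_0)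
  obtain M where M: "0 \<le> M" "\<And>t. \<bar>t\<bar> \<le> 3 * \<bar>\<epsilon>\<bar> \<Longrightarrow> \<bar>D 1 t - t\<bar> \<le> M * \<bar>t\<bar> ^ 3"
    using anharmonic_bounds by blast
  show "(\<lambda>p. (summand \<epsilon> 1 p 0)\<^sup>2) summable_on UNIV"
  proof (rule summable_on_real_bound)
    show "(\<lambda>p. (M * \<bar>\<epsilon>\<bar> ^ 3)\<^sup>2 * (predictor_gradient p ^ 3)\<^sup>2) summable_on UNIV"
      by (intro summable_on_cmult_right predictor_gradient_cubed_summable)
    show "\<bar>(summand \<epsilon> 1 p 0)\<^sup>2\<bar> \<le> (M * \<bar>\<epsilon>\<bar> ^ 3)\<^sup>2 * (predictor_gradient p ^ 3)\<^sup>2" for p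
    proof -
      have "\<bar>summand \<epsilon> 1 p 0\<bar> \<le> (M * \<bar>\<epsilon>\<bar> ^ 3) * \<bar>predictor_gradient p ^ 3\<bar>"
        using M(2)[OF scaled_gradient_le[of \<epsilon> p]]
        by (simp only: summand_1 add_0_right) (simp add: abs_mult power_mult_distrib power_abs mult.assoc)
      then have "\<bar>summand \<epsilon> 1 p 0\<bar>\<^sup>2 \<le> ((M * \<bar>\<epsilon>\<bar> ^ 3) * \<bar>predictor_gradient p ^ 3\<bar>)\<^sup>2"
        by (intro power_mono) auto
      then show ?thesis by (simp add: power_mult_distrib)
    qed
  qed
qed

definition energy_jet :: "real \<Rightarrow> nat \<Rightarrow> hdot1 \<Rightarrow> hdot1 list \<Rightarrow> real" where
  "energy_jet \<epsilon> j u v = S.jet \<epsilon> j u v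
    + (if j = 0 then \<epsilon> * predictor_load u else if j = 1 then \<epsilon> * predictor_load (hd v) else 0)"

lemma frechet_jet_energy: "frechet_jet k (energy_jet \<epsilon>)"
  unfolding energy_jet_def[abs_def]
  by (rule frechet_jet_add_linear[OF S.frechet_jet]) (intro bounded_linear_const_mult bounded_linear_predictor_load)

definition extended_energy :: "real \<Rightarrow> hdot1 \<Rightarrow> real" where
  "extended_energy \<epsilon> u = energy_jet \<epsilon> 0 u []"

lemma has_sum_summand_0:
  "((\<lambda>p. summand \<epsilon> 0 p (bond u p)) has_sum S.jet \<epsilon> 0 u []) UNIV"
  unfolding S.jet_def using has_sum_infsum[OF S.summable_value[of \<epsilon> u]] by simp

lemma extended_energy_eq: "extended_energy \<epsilon> u = S.jet \<epsilon> 0 u [] + \<epsilon> * predictor_load u"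
  by (simp add: extended_energy_def energy_jet_def)

lemma continuous_extended_energy: "continuous_on UNIV (extended_energy \<epsilon>)"
  unfolding extended_energy_def[abs_def]
  using frechet_jet_has_derivative[OF frechet_jet_energy] k5
  by (intro continuous_at_imp_continuous_on ballI has_derivative_continuous) auto

lemma Dgrad_u_hat: "Dgrad (u_hat \<epsilon>) m \<rho> = \<epsilon> * predictor_gradient (m, \<rho>)"
  by (simp add: predictor_gradient_def bond_gradient_def Dgrad_def u_hat_def right_diff_distrib)

text \<open>For finite support the sum of the subtracted linear terms is finite, and the linear functional
  restores it.\<close>

lemma extended_energy_finite_support:
  assumes "finite_support u"
  shows "extended_energy \<epsilon> u = energy_fin \<phi> \<epsilon> u"
proof -
  define f where "f p = \<phi> (\<epsilon> * predictor_gradient p + bond u p) - \<phi> (\<epsilon> * predictor_gradient p)" for p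
  have "((\<lambda>p. summand \<epsilon> 0 p (bond u p) + \<epsilon> * (predictor_gradient p * bond u p))
      has_sum extended_energy \<epsilon> u) UNIV"
    unfolding extended_energy_eq
    by (intro has_sum_add has_sum_summand_0 has_sum_cmult_right predictor_load_finite_support assms)
  moreover have "summand \<epsilon> 0 p (bond u p) + \<epsilon> * (predictor_gradient p * bond u p) = f p" for p
    by (simp add: summand_0 f_def)
  ultimately have f: "(f has_sum extended_energy \<epsilon> u) UNIV" by simp
  have "((\<lambda>m. \<Sum>\<rho>\<in>nn. f (m, \<rho>)) has_sum infsum f UNIV) UNIV"
    by (rule has_sum_bonds[OF has_sum_imp_summable[OF f]])
       (simp add: f_def bond_def bond_gradient_def Dgrad_outside)
  moreover have "(\<Sum>\<rho>\<in>nn. f (m, \<rho>)) = site_potential \<phi> (\<lambda>\<rho>. Dgrad (u_hat \<epsilon>) m \<rho> + Dgrad (lattice_fun u) m \<rho>)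
         - site_potential \<phi> (Dgrad (u_hat \<epsilon>) m)" for m
    by (simp add: site_potential_def f_def Dgrad_u_hat bond_def bond_gradient_def sum_subtractf)
  ultimately show ?thesis unfolding energy_fin_def using f by (simp add: infsumI)
qed

lemma is_energy_extension_iff: "is_energy_extension \<phi> \<epsilon> E \<longleftrightarrow> E = extended_energy \<epsilon>"
proof
  assume "is_energy_extension \<phi> \<epsilon> E"
  then show "E = extended_energy \<epsilon>"
    using continuous_extended_energy extended_energy_finite_support
    by (intro continuous_extension_unique) (auto simp: is_energy_extension_def)
next
  show "E = extended_energy \<epsilon> \<Longrightarrow> is_energy_extension \<phi> \<epsilon> E"
    using continuous_extended_energy extended_energy_finite_support
    by (auto simp: is_energy_extension_def)
qed

lemma energy_eq: "energy \<phi> \<epsilon> = extended_energy \<epsilon>"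
  unfolding energy_def is_energy_extension_iff by simp

lemma second_variation_energy:
  "second_variation (extended_energy \<epsilon>) u v v
    = (\<Sum>\<^sub>\<infinity>p. D 2 (\<epsilon> * predictor_gradient p + bond u p) * (bond v p)\<^sup>2)"
proof -
  have "second_variation (extended_energy \<epsilon>) u v v = energy_jet \<epsilon> 2 u [v, v]"
    by (rule frechet_jet_second_variation[OF frechet_jet_energy]) (use k5 in \<open>auto simp: extended_energy_def\<close>)
  then show ?thesis by (simp add: energy_jet_def S.jet_def summand_2 power2_eq_square)
qed

lemma strong_stability:
  assumes conv: "\<And>t. \<bar>t\<bar> \<le> \<delta> \<Longrightarrow> 1/2 \<le> D 2 t" and small: "3 * \<bar>\<epsilon>\<bar> + norm u \<le> \<delta>"
  shows "1/2 * (norm v)\<^sup>2 \<le> second_variation (extended_energy \<epsilon>) u v v"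
proof -
  have "(\<lambda>p. summand \<epsilon> 2 p (bond u p) * H.Bprod [v, v] p) summable_on UNIV"
    using k5 by (intro S.summable_jet(1)) auto
  then have s: "(\<lambda>p. D 2 (\<epsilon> * predictor_gradient p + bond u p) * (bond v p)\<^sup>2) summable_on UNIV"
    by (simp add: summand_2 power2_eq_square)
  show ?thesis
    unfolding second_variation_energy
  proof (rule has_sum_mono[OF has_sum_cmult_right[OF H.has_sum_B] has_sum_infsum[OF s]])
    fix p
    have "1/2 \<le> D 2 (\<epsilon> * predictor_gradient p + bond u p)"
      using scaled_gradient_le[of \<epsilon> p] H.abs_B_le[of u p] small by (intro conv) linarith
    then show "1/2 * (bond v p)\<^sup>2 \<le> D 2 (\<epsilon> * predictor_gradient p + bond u p) * (bond v p)\<^sup>2"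
      by (rule mult_right_mono) simp
  qed
qed

lemma energy_strongly_convex:
  assumes conv: "\<And>t. \<bar>t\<bar> \<le> \<delta> \<Longrightarrow> 1/2 \<le> D 2 t" and small: "3 * \<bar>\<epsilon>\<bar> + r \<le> \<delta>"
    and x: "norm x \<le> r" "norm y \<le> r" and t: "0 \<le> t" "t \<le> 1"
  shows "extended_energy \<epsilon> ((1 - t) *\<^sub>R x + t *\<^sub>R y) \<le> (1 - t) * extended_energy \<epsilon> x
    + t * extended_energy \<epsilon> y - 1/4 * (t * (1 - t) * (norm (x - y))\<^sup>2)"
proof -
  interpret L: bounded_linear predictor_load by (rule bounded_linear_predictor_load)
  have "1/2 \<le> summand \<epsilon> 2 p s" if "\<bar>s\<bar> \<le> r" for p s
    unfolding summand_2[OF order_refl]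
    using scaled_gradient_le[of \<epsilon> p] small that by (intro conv) linarith
  note jet = S.strongly_convex_on_ball[OF this x t]
  have load: "predictor_load ((1 - t) *\<^sub>R x + t *\<^sub>R y) = (1 - t) * predictor_load x + t * predictor_load y"
    by (simp only: L.add L.scaleR real_scaleR_def)
  show ?thesis
    unfolding extended_energy_eq load using jet by (simp add: algebra_simps)
qed

lemma energy_minimal_at_zero_load:
  assumes conv: "\<And>t. \<bar>t\<bar> \<le> \<delta> \<Longrightarrow> 1/2 \<le> D 2 t" and x: "norm x \<le> \<delta>"
  shows "extended_energy 0 0 \<le> extended_energy 0 x"
proof -
  have pos: "0 \<le> \<phi> t" if t: "\<bar>t\<bar> \<le> \<delta>" for t
  proof -
    obtain \<xi> where \<xi>: "\<phi> (0 + t) - \<phi> 0 = t * D 1 \<xi>" "\<bar>\<xi> - 0\<bar> \<le> \<bar>t\<bar>" "min 0 (0 + t) \<le> \<xi>" "\<xi> \<le> max 0 (0 + t)"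
      using mvt_increment[of \<phi> "D 1" 0 t] D_deriv_low(1) by blast
    obtain \<zeta> where \<zeta>: "D 1 (0 + \<xi>) - D 1 0 = \<xi> * D 2 \<zeta>" "\<bar>\<zeta> - 0\<bar> \<le> \<bar>\<xi>\<bar>"
      using mvt_increment[of "D 1" "D 2" 0 \<xi>] D_deriv_low(2) by blast
    have "1/2 \<le> D 2 \<zeta>" using \<xi>(2) \<zeta>(2) t by (intro conv) linarith
    moreover have "0 \<le> t * \<xi>" using \<xi>(3,4) by (cases "0 \<le> t") (auto simp: mult_nonpos_nonpos)
    moreover have "\<phi> t = (t * \<xi>) * D 2 \<zeta>" using \<xi>(1) \<zeta>(1) D_odd_zero \<phi>0 by simp
    ultimately show ?thesis by simp
  qed
  have "extended_energy 0 0 = 0"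
    by (simp add: extended_energy_eq S.jet_def summand_0)
  moreover have "0 \<le> extended_energy 0 x"
  proof -
    have "0 \<le> summand 0 0 p (bond x p)" for p
      using pos[of "bond x p"] H.abs_B_le[of x p] x \<phi>0 by (simp add: summand_0)
    then have "0 \<le> S.jet 0 0 x []" by (intro has_sum_nonneg[OF has_sum_summand_0])
    then show ?thesis by (simp add: extended_energy_eq)
  qed
  ultimately show ?thesis by simp
qed

text \<open>In the double difference of two loads and two displacements the quadratic part of the
  potential cancels; what remains is controlled by \<open>\<phi>'' - 1\<close>, which is quadratically small, and
  the resulting cube of the predictor gradient is square summable.\<close>

lemma energy_lipschitz_in_load:
  assumes r: "0 \<le> r"
  shows "\<exists>K\<ge>0. \<forall>\<epsilon> \<epsilon>' x y. \<bar>\<epsilon>\<bar> \<le> 1 \<longrightarrow> \<bar>\<epsilon>'\<bar> \<le> 1 \<longrightarrow> norm x \<le> r \<longrightarrow> norm y \<le> r \<longrightarrow>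
    \<bar>(extended_energy \<epsilon> x - extended_energy \<epsilon> y) - (extended_energy \<epsilon>' x - extended_energy \<epsilon>' y)\<bar>
      \<le> K * \<bar>\<epsilon> - \<epsilon>'\<bar> * norm (x - y)"
proof -
  interpret L: bounded_linear predictor_load by (rule bounded_linear_predictor_load)
  obtain KL where KL: "0 \<le> KL" "\<And>u. \<bar>predictor_load u\<bar> \<le> norm u * KL"
    using L.nonneg_bounded by auto
  obtain M where M: "0 \<le> M" "\<And>t. \<bar>t\<bar> \<le> 3 + r \<Longrightarrow> \<bar>D 2 t - 1\<bar> \<le> M * t\<^sup>2"
    using anharmonic_bounds by metis
  define A where "A = (\<Sum>\<^sub>\<infinity>p. (predictor_gradient p ^ 3)\<^sup>2)"
  define W where "W = sqrt (12 * A + 108 * r\<^sup>2 * r\<^sup>2 + 108 * r\<^sup>2 * r\<^sup>2)"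
  have A0: "0 \<le> A" unfolding A_def by (intro infsum_nonneg) simp
  have W0: "0 \<le> W" unfolding W_def using A0 by simp
  let ?\<psi> = "\<lambda>t. \<phi> t - t\<^sup>2 / 2"
  have psi: "(?\<psi> has_real_derivative D 1 t - t) (at t)"
    "((\<lambda>t. D 1 t - t) has_real_derivative D 2 t - 1) (at t)" for t
    using D_deriv_low(1,2)[of t] by (auto intro!: derivative_eq_intros)
  have main: "\<bar>(extended_energy \<epsilon> x - extended_energy \<epsilon> y) - (extended_energy \<epsilon>' x - extended_energy \<epsilon>' y)\<bar>
      \<le> (M * W + KL) * \<bar>\<epsilon> - \<epsilon>'\<bar> * norm (x - y)"
    if \<epsilon>: "\<bar>\<epsilon>\<bar> \<le> 1" "\<bar>\<epsilon>'\<bar> \<le> 1" and x: "norm x \<le> r" "norm y \<le> r" for \<epsilon> \<epsilon>' x y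
  proof -
    define Q where "Q p = (summand \<epsilon> 0 p (bond x p) - summand \<epsilon> 0 p (bond y p))
      - (summand \<epsilon>' 0 p (bond x p) - summand \<epsilon>' 0 p (bond y p))" for p
    have hsQ: "(Q has_sum (S.jet \<epsilon> 0 x [] - S.jet \<epsilon> 0 y []) - (S.jet \<epsilon>' 0 x [] - S.jet \<epsilon>' 0 y [])) UNIV"
      unfolding Q_def[abs_def] by (intro has_sum_diff_real has_sum_summand_0)
    define c where "c p = 2 * \<bar>predictor_gradient p ^ 3\<bar> + 6 * r * \<bar>bond x p\<bar> + 6 * r * \<bar>bond y p\<bar>" for p
    have c0: "0 \<le> c p" for p using r by (simp add: c_def)
    have Q: "\<bar>Q p\<bar> \<le> (M * \<bar>\<epsilon> - \<epsilon>'\<bar>) * (\<bar>c p\<bar> * \<bar>bond (x - y) p\<bar>)" for p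
    proof -
      let ?a = "predictor_gradient p" and ?x = "bond x p" and ?y = "bond y p"
      let ?X = "max \<bar>?x\<bar> \<bar>?y\<bar>"
      have xr: "\<bar>?x\<bar> \<le> r" "\<bar>?y\<bar> \<le> r" using H.abs_B_le x order_trans by blast+
      have Q_eq: "Q p = (?\<psi> (\<epsilon> * ?a + ?x) - ?\<psi> (\<epsilon> * ?a + ?y)) - (?\<psi> (\<epsilon>' * ?a + ?x) - ?\<psi> (\<epsilon>' * ?a + ?y))"
        by (simp add: Q_def summand_0 power2_eq_square field_simps)
      have "\<bar>Q p\<bar> \<le> (M * (\<bar>?a\<bar> + ?X)\<^sup>2) * \<bar>\<epsilon> * ?a - \<epsilon>' * ?a\<bar> * \<bar>?x - ?y\<bar>"
        unfolding Q_eq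
      proof (rule double_difference_bound[OF psi])
        show "\<bar>\<epsilon> * ?a\<bar> \<le> \<bar>?a\<bar>" "\<bar>\<epsilon>' * ?a\<bar> \<le> \<bar>?a\<bar>"
          using mult_right_mono[OF \<epsilon>(1), of "\<bar>?a\<bar>"] mult_right_mono[OF \<epsilon>(2), of "\<bar>?a\<bar>"] by (simp_all add: abs_mult)
        fix t assume t: "\<bar>t\<bar> \<le> \<bar>?a\<bar> + ?X"
        then have "\<bar>t\<bar> \<le> 3 + r" using xr predictor_gradient_le[of p] by linarith
        then have "\<bar>D 2 t - 1\<bar> \<le> M * \<bar>t\<bar>\<^sup>2" using M(2)[of t] by simp
        also have "\<dots> \<le> M * (\<bar>?a\<bar> + ?X)\<^sup>2" using t M(1) by (intro mult_left_mono power_mono) auto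
        finally show "\<bar>D 2 t - 1\<bar> \<le> M * (\<bar>?a\<bar> + ?X)\<^sup>2" .
      qed auto
      also have "\<dots> = (M * \<bar>\<epsilon> - \<epsilon>'\<bar>) * ((\<bar>?a\<bar> * (\<bar>?a\<bar> + ?X)\<^sup>2) * \<bar>?x - ?y\<bar>)"
        by (simp add: abs_mult flip: left_diff_distrib)
      also have "\<dots> \<le> (M * \<bar>\<epsilon> - \<epsilon>'\<bar>) * (c p * \<bar>?x - ?y\<bar>)"
      proof (intro mult_left_mono mult_right_mono)
        have "(\<bar>?a\<bar> + ?X)\<^sup>2 \<le> 2 * ?a\<^sup>2 + 2 * ?X\<^sup>2"
          using sum_squares_bound[of "\<bar>?a\<bar>" ?X] by (simp add: power2_sum)
        also have "?X\<^sup>2 \<le> r * \<bar>?x\<bar> + r * \<bar>?y\<bar>"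
          using xr r mult_right_mono[OF xr(1), of "\<bar>?x\<bar>"] mult_right_mono[OF xr(2), of "\<bar>?y\<bar>"]
          by (auto simp: max_def power2_eq_square intro: add_increasing add_increasing2)
        finally have "\<bar>?a\<bar> * (\<bar>?a\<bar> + ?X)\<^sup>2 \<le> \<bar>?a\<bar> * (2 * ?a\<^sup>2 + 2 * (r * \<bar>?x\<bar> + r * \<bar>?y\<bar>))"
          by (intro mult_left_mono) auto
        also have "\<dots> = 2 * \<bar>?a ^ 3\<bar> + \<bar>?a\<bar> * (2 * (r * \<bar>?x\<bar> + r * \<bar>?y\<bar>))"
          by (simp add: distrib_left power3_eq_cube power2_eq_square abs_mult)
        also have "\<bar>?a\<bar> * (2 * (r * \<bar>?x\<bar> + r * \<bar>?y\<bar>)) \<le> 3 * (2 * (r * \<bar>?x\<bar> + r * \<bar>?y\<bar>))"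
          using r by (intro mult_right_mono predictor_gradient_le) auto
        finally show "\<bar>?a\<bar> * (\<bar>?a\<bar> + ?X)\<^sup>2 \<le> c p" by (simp add: c_def)
      qed (use M(1) in auto)
      finally show ?thesis using c0[of p] by (simp add: H.B_diff)
    qed
    \<comment> \<open>The square sum of \<open>c\<close> must be bounded uniformly over the ball, not just finite.\<close>
    have c2: "(c p)\<^sup>2 \<le> 12 * (predictor_gradient p ^ 3)\<^sup>2 + 108 * r\<^sup>2 * (bond x p)\<^sup>2 + 108 * r\<^sup>2 * (bond y p)\<^sup>2" for p
    proof -
      have "(a + b + d)\<^sup>2 \<le> 3 * a\<^sup>2 + 3 * b\<^sup>2 + 3 * d\<^sup>2" for a b d :: real
        using sum_squares_bound[of a b] sum_squares_bound[of a d] sum_squares_bound[of b d]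
        by (simp add: power2_eq_square algebra_simps)
      from this[of "2 * \<bar>predictor_gradient p ^ 3\<bar>" "6 * r * \<bar>bond x p\<bar>" "6 * r * \<bar>bond y p\<bar>"]
      show ?thesis by (simp add: c_def power_mult_distrib)
    qed
    have hs: "((\<lambda>p. 12 * (predictor_gradient p ^ 3)\<^sup>2 + 108 * r\<^sup>2 * (bond x p)\<^sup>2 + 108 * r\<^sup>2 * (bond y p)\<^sup>2)
        has_sum 12 * A + 108 * r\<^sup>2 * (norm x)\<^sup>2 + 108 * r\<^sup>2 * (norm y)\<^sup>2) UNIV"
      unfolding A_def by (intro has_sum_add has_sum_cmult_right has_sum_infsum H.has_sum_B
        predictor_gradient_cubed_summable)
    have sc: "(\<lambda>p. (c p)\<^sup>2) summable_on UNIV"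
      by (rule summable_on_real_bound[OF has_sum_imp_summable[OF hs]]) (use c2 in simp)
    have "(\<Sum>\<^sub>\<infinity>p. (c p)\<^sup>2) \<le> 12 * A + 108 * r\<^sup>2 * (norm x)\<^sup>2 + 108 * r\<^sup>2 * (norm y)\<^sup>2"
      by (rule has_sum_mono[OF has_sum_infsum[OF sc] hs]) (rule c2)
    also have "\<dots> \<le> 12 * A + 108 * r\<^sup>2 * r\<^sup>2 + 108 * r\<^sup>2 * r\<^sup>2"
      using x by (intro add_mono mult_left_mono power_mono) auto
    finally have cW: "sqrt (\<Sum>\<^sub>\<infinity>p. (c p)\<^sup>2) \<le> W" unfolding W_def by (rule real_sqrt_le_mono)
    have Me: "0 \<le> M * \<bar>\<epsilon> - \<epsilon>'\<bar>" using M(1) by simp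
    have "\<bar>infsum Q UNIV\<bar> \<le> (M * \<bar>\<epsilon> - \<epsilon>'\<bar>) * (sqrt (\<Sum>\<^sub>\<infinity>p. (c p)\<^sup>2) * norm (x - y))"
      by (rule H.pairing(2)[OF sc Me Q])
    also have "\<dots> \<le> (M * \<bar>\<epsilon> - \<epsilon>'\<bar>) * (W * norm (x - y))"
      using cW Me by (intro mult_left_mono mult_right_mono) auto
    finally have 1: "\<bar>infsum Q UNIV\<bar> \<le> M * W * \<bar>\<epsilon> - \<epsilon>'\<bar> * norm (x - y)" by (simp add: mult_ac)
    have "\<bar>(\<epsilon> - \<epsilon>') * predictor_load (x - y)\<bar> \<le> \<bar>\<epsilon> - \<epsilon>'\<bar> * (norm (x - y) * KL)"
      unfolding abs_mult by (intro mult_left_mono KL) simp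
    then have 2: "\<bar>(\<epsilon> - \<epsilon>') * predictor_load (x - y)\<bar> \<le> KL * \<bar>\<epsilon> - \<epsilon>'\<bar> * norm (x - y)"
      by (simp add: mult_ac)
    have "(extended_energy \<epsilon> x - extended_energy \<epsilon> y) - (extended_energy \<epsilon>' x - extended_energy \<epsilon>' y)
        = infsum Q UNIV + (\<epsilon> - \<epsilon>') * predictor_load (x - y)"
      using infsumI[OF hsQ] by (simp add: extended_energy_eq L.diff algebra_simps)
    also have "\<bar>\<dots>\<bar> \<le> M * W * \<bar>\<epsilon> - \<epsilon>'\<bar> * norm (x - y) + KL * \<bar>\<epsilon> - \<epsilon>'\<bar> * norm (x - y)"
      using 1 2 by linarith
    finally show ?thesis by (simp add: algebra_simps)
  qed
  show ?thesis
    by (intro exI[of _ "M * W + KL"] conjI allI impI main) (use M(1) W0 KL(1) in auto)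
qed

text \<open>The neighbourhood in which \<open>\<phi>'' \<ge> 1/2\<close> is shared evenly between the loaded predictor, whose
  bond differences are at most \<open>3 \<epsilon>\<close>, and the displacement.\<close>

lemma stable_minimisers:
  "\<exists>\<epsilon>0>0. \<exists>ubar :: real \<Rightarrow> hdot1. continuous_on {0..<\<epsilon>0} ubar \<and>
    (\<forall>\<epsilon>\<in>{0..<\<epsilon>0}. locally_unique_minimiser (extended_energy \<epsilon>) (ubar \<epsilon>) \<and>
      (\<exists>lam>0. \<forall>v. second_variation (extended_energy \<epsilon>) (ubar \<epsilon>) v v \<ge> lam * (norm v)\<^sup>2))"
proof -
  have "isCont (D 2) 0" using D_deriv_low(3) DERIV_isCont by blast
  then have "(D 2 \<longlongrightarrow> D 2 0) (nhds 0)"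
    by (simp only: isCont_def tendsto_at_iff_tendsto_nhds)
  then have "\<forall>\<^sub>F t in nhds 0. D 2 t > 1/2"
    by (rule order_tendstoD(1)) (simp add: stiffness)
  then obtain \<delta>' where \<delta>': "\<delta>' > 0" "\<And>t. \<bar>t\<bar> < \<delta>' \<Longrightarrow> D 2 t > 1/2"
    by (auto simp: eventually_nhds_metric dist_real_def)
  define \<delta> where "\<delta> = \<delta>' / 2"
  have \<delta>: "\<delta> > 0" "\<And>t. \<bar>t\<bar> \<le> \<delta> \<Longrightarrow> 1/2 \<le> D 2 t" using \<delta>' by (auto simp: \<delta>_def less_imp_le)
  define r where "r = \<delta> / 2"
  define \<eta> where "\<eta> = min 1 (\<delta> / 6)"
  have r: "0 < r" and \<eta>: "0 < \<eta>" using \<delta>(1) by (auto simp: r_def \<eta>_def)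
  have small: "3 * \<bar>\<epsilon>\<bar> + r \<le> \<delta>" if "0 \<le> \<epsilon>" "\<epsilon> < \<eta>" for \<epsilon>
    using that by (simp add: r_def \<eta>_def)
  obtain K where K: "0 \<le> K" and lip: "\<And>\<epsilon> \<epsilon>' x y. \<bar>\<epsilon>\<bar> \<le> 1 \<Longrightarrow> \<bar>\<epsilon>'\<bar> \<le> 1 \<Longrightarrow> norm x \<le> r \<Longrightarrow> norm y \<le> r \<Longrightarrow>
    \<bar>(extended_energy \<epsilon> x - extended_energy \<epsilon> y) - (extended_energy \<epsilon>' x - extended_energy \<epsilon>' y)\<bar>
      \<le> K * \<bar>\<epsilon> - \<epsilon>'\<bar> * norm (x - y)"
    using energy_lipschitz_in_load[of r] r by auto
  have "\<exists>\<epsilon>0>0. \<epsilon>0 \<le> \<eta> \<and> (\<exists>u :: real \<Rightarrow> hdot1. continuous_on {0..<\<epsilon>0} u \<and>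
    (\<forall>\<epsilon>\<in>{0..<\<epsilon>0}. norm (u \<epsilon>) < r \<and> locally_unique_minimiser (extended_energy \<epsilon>) (u \<epsilon>)))"
  proof (rule strongly_convex_family_minimisers[where c = "1/4" and K = K])
    show "extended_energy \<epsilon> ((1 - t) *\<^sub>R x + t *\<^sub>R y) \<le> (1 - t) * extended_energy \<epsilon> x
      + t * extended_energy \<epsilon> y - 1/4 * (t * (1 - t) * (norm (x - y))\<^sup>2)"
      if "0 \<le> \<epsilon>" "\<epsilon> < \<eta>" "norm x \<le> r" "norm y \<le> r" "0 \<le> t" "t \<le> 1" for \<epsilon> x y t
      using that by (intro energy_strongly_convex[OF \<delta>(2) small])
    show "\<bar>(extended_energy \<epsilon> x - extended_energy \<epsilon> y) - (extended_energy \<epsilon>' x - extended_energy \<epsilon>' y)\<bar>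
      \<le> K * \<bar>\<epsilon> - \<epsilon>'\<bar> * norm (x - y)"
      if "0 \<le> \<epsilon>" "\<epsilon> < \<eta>" "0 \<le> \<epsilon>'" "\<epsilon>' < \<eta>" "norm x \<le> r" "norm y \<le> r" for \<epsilon> \<epsilon>' x y
      using that by (intro lip) (auto simp: \<eta>_def)
    show "extended_energy 0 0 \<le> extended_energy 0 x" if "norm x \<le> r" for x
      using that \<delta>(1) by (intro energy_minimal_at_zero_load[OF \<delta>(2)]) (auto simp: r_def)
  qed (use r \<eta> K continuous_extended_energy in auto)
  then obtain \<epsilon>0 u where \<epsilon>0: "\<epsilon>0 > 0" "\<epsilon>0 \<le> \<eta>" and u: "continuous_on {0..<\<epsilon>0} u"
    "\<forall>\<epsilon>\<in>{0..<\<epsilon>0}. norm (u \<epsilon>) < r \<and> locally_unique_minimiser (extended_energy \<epsilon>) (u \<epsilon>)"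
    by blast
  have "1/2 * (norm v)\<^sup>2 \<le> second_variation (extended_energy \<epsilon>) (u \<epsilon>) v v"
    if "\<epsilon> \<in> {0..<\<epsilon>0}" for \<epsilon> v
  proof (rule strong_stability[OF \<delta>(2)])
    have "norm (u \<epsilon>) < r" using u(2) that by blast
    moreover have "3 * \<bar>\<epsilon>\<bar> + r \<le> \<delta>" using that \<epsilon>0(2) by (intro small) auto
    ultimately show "3 * \<bar>\<epsilon>\<bar> + norm (u \<epsilon>) \<le> \<delta>" by linarith
  qed
  then have "\<forall>\<epsilon>\<in>{0..<\<epsilon>0}. locally_unique_minimiser (extended_energy \<epsilon>) (u \<epsilon>) \<and>
      (\<exists>lam>0. \<forall>v. second_variation (extended_energy \<epsilon>) (u \<epsilon>) v v \<ge> lam * (norm v)\<^sup>2)"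
    using u(2) by (intro ballI conjI exI[of _ "1/2"] allI) auto
  then show ?thesis using \<epsilon>0(1) u(1) by (intro exI[of _ \<epsilon>0] exI[of _ u] conjI)
qed

end

theorem theorem2p3:
  fixes k :: nat and \<phi> :: "real \<Rightarrow> real"
  assumes "k \<ge> 5"
    and "C_k_real k \<phi>"
    and "\<phi> 0 = 0"
    and "\<And>r. \<phi> (- r) = \<phi> r"
    and "(deriv ^^ 2) \<phi> 0 = 1"
  shows "(\<forall>\<epsilon>\<ge>0. (\<exists>!E. is_energy_extension \<phi> \<epsilon> E) \<and> C_k_frechet k (energy \<phi> \<epsilon>)) \<and>
    (\<exists>\<epsilon>0>0. \<exists>ubar :: real \<Rightarrow> hdot1. continuous_on {0..<\<epsilon>0} ubar \<and>
      (\<forall>\<epsilon>\<in>{0..<\<epsilon>0}. locally_unique_minimiser (energy \<phi> \<epsilon>) (ubar \<epsilon>) \<and>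
        (\<exists>lam>0. \<forall>v. second_variation (energy \<phi> \<epsilon>) (ubar \<epsilon>) v v \<ge> lam * (norm v)\<^sup>2)))"
proof -
  interpret smooth_potential \<phi> k by unfold_locales (rule assms)+
  have "C_k_frechet k (extended_energy \<epsilon>)" for \<epsilon>
    by (rule frechet_jet_imp_C_k[OF frechet_jet_energy]) (simp add: extended_energy_def)
  then show ?thesis
    using stable_minimisers unfolding energy_eq is_energy_extension_iff by simp
qed

end
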